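(* For every subset $I\subset\mathbf{N}$ there exists a finitely generated group $G$ having a normal subgroup $N$ such that $N$ is locally finite and nilpotent of class at most $3$, $G/N$ is abelian, and $\mathcal{R}(G)\sim I$, i.e. $\mathcal{R}_S(G)\sim I$ for every finite generating subset $S$ of $G$.
   Context: For a group $G$ with a generating subset $S$, let $F_S$ be the free group on $S$ with its word length, let $N_S$ be the kernel of the natural map $F_S\to G$, and for $n\ge 0$ let $N_{S,n}$ be the normal subgroup of $F_S$ generated (as a normal subgroup) by the elements of $N_S$ of length at most $n$ ($N_{S,-1}$ is trivial). The relation range $\mathcal{R}_S(G)$ is the set of integers $n\ge 0$ such that $N_{S,n}$ properly contains $N_{S,n-1}$. For $A,B\subset\mathbf{R}_+$, write $A\preccurlyeq B$ if there exists $c\ge 1$ such that for every $a\in A$ with $a\ge c$ there is an element of $B$ in the interval $[c^{-1}a,ca]$; write $A\sim B$ if $A\preccurlyeq B$ and $B\preccurlyeq A$. For a finitely generated group $G$, the $\sim$-class of $\mathcal{R}_S(G)$ does not depend on the finite generating subset $S$ and is denoted $\mathcal{R}(G)$. *)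

theory Defs
  imports Complex_Main "HOL-Algebra.Generated_Groups"
begin

section \<open>Free groups\<close>

text \<open>
  The free group on \<open>S\<close> is realised on the freely reduced words over \<open>S\<close>, so that the word
  length of an element is the length of the list representing it.
  The letter \<open>(a, True)\<close> stands for the generator \<open>a\<close>, and \<open>(a, False)\<close> for its formal inverse.
\<close>

definition inv_letter :: "'a \<times> bool \<Rightarrow> 'a \<times> bool" where
  "inv_letter x = (fst x, \<not> snd x)"

definition reduced :: "('a \<times> bool) list \<Rightarrow> bool" where
  "reduced w \<longleftrightarrow> (\<forall>i. Suc i < length w \<longrightarrow> w ! Suc i \<noteq> inv_letter (w ! i))"

definition cancel_cons :: "'a \<times> bool \<Rightarrow> ('a \<times> bool) list \<Rightarrow> ('a \<times> bool) list" where
  "cancel_cons x w = (if w \<noteq> [] \<and> hd w = inv_letter x then tl w else x # w)"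

text \<open>
  For reduced \<open>u\<close> and \<open>v\<close>, the list \<open>foldr cancel_cons u v\<close> is the free reduction of \<open>u @ v\<close>.
\<close>

definition free_group :: "'a set \<Rightarrow> ('a \<times> bool) list monoid" where
  "free_group S = \<lparr>carrier = {w. reduced w \<and> fst ` set w \<subseteq> S},
                   mult = (\<lambda>u v. foldr cancel_cons u v),
                   one = []\<rparr>"

definition letter_value :: "('a, 'b) monoid_scheme \<Rightarrow> 'a \<times> bool \<Rightarrow> 'a" where
  "letter_value G x = (if snd x then fst x else inv\<^bsub>G\<^esub> fst x)"

text \<open>The natural map from the free group on \<open>S \<subseteq> carrier G\<close> to \<open>G\<close>.\<close>

definition word_value :: "('a, 'b) monoid_scheme \<Rightarrow> ('a \<times> bool) list \<Rightarrow> 'a" where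
  "word_value G w = foldr (\<lambda>x g. letter_value G x \<otimes>\<^bsub>G\<^esub> g) w \<one>\<^bsub>G\<^esub>"

lemma inv_letter_inv_letter [simp]: "inv_letter (inv_letter x) = x"
  by (simp add: inv_letter_def)

lemma fst_inv_letter [simp]: "fst (inv_letter x) = fst x"
  by (simp add: inv_letter_def)

lemma reduced_Nil [simp]: "reduced []"
  by (simp add: reduced_def)

lemma reduced_Cons:
  "reduced (x # w) \<longleftrightarrow> reduced w \<and> (w = [] \<or> hd w \<noteq> inv_letter x)"
proof
  assume r: "reduced (x # w)"
  have "reduced w"
    unfolding reduced_def
  proof (intro allI impI)
    fix i assume "Suc i < length w"
    then show "w ! Suc i \<noteq> inv_letter (w ! i)"
      using r unfolding reduced_def by (metis Suc_less_eq length_Cons nth_Cons_Suc)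
  qed
  moreover have "w = [] \<or> hd w \<noteq> inv_letter x"
    using r unfolding reduced_def by (cases w) auto
  ultimately show "reduced w \<and> (w = [] \<or> hd w \<noteq> inv_letter x)" ..
next
  assume "reduced w \<and> (w = [] \<or> hd w \<noteq> inv_letter x)"
  then show "reduced (x # w)"
    unfolding reduced_def by (cases w) (auto simp: nth_Cons split: nat.split)
qed

lemma reduced_cancel_cons: "reduced w \<Longrightarrow> reduced (cancel_cons x w)"
  by (cases w) (auto simp: cancel_cons_def reduced_Cons)

lemma reduced_foldr: "reduced v \<Longrightarrow> reduced (foldr cancel_cons u v)"
  by (induction u) (auto simp: reduced_cancel_cons)

lemma cancel_cons_inv_letter:
  "reduced w \<Longrightarrow> cancel_cons (inv_letter x) (cancel_cons x w) = w"
  by (cases w) (auto simp: cancel_cons_def reduced_Cons split: if_splits)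

lemma cancel_cons_inv_letter':
  "reduced w \<Longrightarrow> cancel_cons x (cancel_cons (inv_letter x) w) = w"
  using cancel_cons_inv_letter[of w "inv_letter x"] by simp

lemma foldr_cancel_cons_Nil: "reduced w \<Longrightarrow> foldr cancel_cons w [] = w"
  by (induction w) (auto simp: reduced_Cons cancel_cons_def)

lemma foldr_cancel_cons_cancel_cons:
  assumes "reduced w"
  shows "foldr cancel_cons (cancel_cons x u) w = cancel_cons x (foldr cancel_cons u w)"
proof (cases "u \<noteq> [] \<and> hd u = inv_letter x")
  case True
  then obtain u' where u': "u = inv_letter x # u'" by (cases u) auto
  then have "cancel_cons x u = u'" by (simp add: cancel_cons_def)
  then show ?thesis
    by (simp add: u' cancel_cons_inv_letter' reduced_foldr[OF assms])
next
  case False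
  then have "cancel_cons x u = x # u" by (auto simp: cancel_cons_def)
  then show ?thesis by simp
qed

lemma foldr_cancel_cons_assoc:
  "reduced w \<Longrightarrow>
    foldr cancel_cons (foldr cancel_cons u v) w = foldr cancel_cons u (foldr cancel_cons v w)"
  by (induction u) (auto simp: foldr_cancel_cons_cancel_cons)

lemma set_foldr_cancel_cons: "set (foldr cancel_cons u v) \<subseteq> set u \<union> set v"
proof (induction u)
  case (Cons x u)
  have "set (cancel_cons x w) \<subseteq> insert x (set w)" for w
    by (auto simp: cancel_cons_def dest: list.set_sel(2))
  with Cons show ?case by fastforce
qed simp

lemma foldr_cancel_cons_rev:
  "reduced w \<Longrightarrow> foldr cancel_cons (rev (map inv_letter u)) (foldr cancel_cons u w) = w"
  by (induction u arbitrary: w) (auto simp: cancel_cons_inv_letter reduced_foldr)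

theorem group_free_group: "group (free_group S)"
proof (rule groupI)
  fix u v assume "u \<in> carrier (free_group S)" "v \<in> carrier (free_group S)"
  then show "u \<otimes>\<^bsub>free_group S\<^esub> v \<in> carrier (free_group S)"
    using set_foldr_cancel_cons[of u v] reduced_foldr[of v u]
    by (fastforce simp: free_group_def)
next
  fix u assume u: "u \<in> carrier (free_group S)"
  define v where "v = foldr cancel_cons (rev (map inv_letter u)) []"
  have "fst ` set v \<subseteq> fst ` set (rev (map inv_letter u))"
    using set_foldr_cancel_cons[of "rev (map inv_letter u)" "[]"] by (auto simp: v_def)
  also have "\<dots> \<subseteq> S"
    using u by (auto simp: free_group_def)
  finally have "v \<in> carrier (free_group S)"
    by (simp add: free_group_def v_def reduced_foldr)
  moreover have "v \<otimes>\<^bsub>free_group S\<^esub> u = \<one>\<^bsub>free_group S\<^esub>"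
    using u foldr_cancel_cons_rev[of "[]" u]
    by (simp add: free_group_def v_def foldr_cancel_cons_assoc foldr_cancel_cons_Nil)
  ultimately show "\<exists>v\<in>carrier (free_group S). v \<otimes>\<^bsub>free_group S\<^esub> u = \<one>\<^bsub>free_group S\<^esub>" ..
qed (auto simp: free_group_def foldr_cancel_cons_assoc)

theorem (in group) word_value_hom:
  assumes S: "S \<subseteq> carrier G"
  shows "word_value G \<in> hom (free_group S) G"
proof -
  have val: "letter_value G x \<in> carrier G" if "fst x \<in> S" for x
    using that S by (auto simp: letter_value_def)
  have cl: "word_value G w \<in> carrier G" if "fst ` set w \<subseteq> S" for w
    using that by (induction w) (auto simp: word_value_def val)
  have inv: "letter_value G x \<otimes> (letter_value G (inv_letter x) \<otimes> g) = g"
    if "fst x \<in> S" "g \<in> carrier G" for x g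
  proof -
    have "fst x \<in> carrier G" using that S by auto
    with that show ?thesis
      by (simp add: letter_value_def inv_letter_def m_assoc[symmetric])
  qed
  have cons: "word_value G (cancel_cons x w) = letter_value G x \<otimes> word_value G w"
    if "fst x \<in> S" "fst ` set w \<subseteq> S" for x w
    using that cl[of "tl w"] inv[of x "word_value G (tl w)"]
    by (cases w) (auto simp: cancel_cons_def word_value_def)
  have "word_value G (foldr cancel_cons u v) = word_value G u \<otimes> word_value G v"
    if "fst ` set u \<subseteq> S" "fst ` set v \<subseteq> S" for u v
    using that
  proof (induction u)
    case Nil
    then show ?case using cl[of v] by (simp add: word_value_def)
  next
    case (Cons x u)
    have sub: "fst ` set (foldr cancel_cons u v) \<subseteq> S"
      using Cons.prems set_foldr_cancel_cons[of u v] by fastforce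
    have "word_value G (foldr cancel_cons (x # u) v)
        = letter_value G x \<otimes> (word_value G u \<otimes> word_value G v)"
      using Cons cons[OF _ sub, of x] by simp
    also have "\<dots> = word_value G (x # u) \<otimes> word_value G v"
      using Cons.prems cl[of u] cl[of v] val[of x]
      by (simp add: word_value_def m_assoc)
    finally show ?case .
  qed
  then show ?thesis
    using cl by (auto simp: hom_def free_group_def)
qed


section \<open>The relation range\<close>

definition normal_closure :: "('a, 'b) monoid_scheme \<Rightarrow> 'a set \<Rightarrow> 'a set" where
  "normal_closure G A = \<Inter>{H. H \<lhd> G \<and> A \<subseteq> H}"

text \<open>The index is an integer so that the index \<open>-1\<close> makes sense.\<close>

definition bounded_relators :: "('a, 'b) monoid_scheme \<Rightarrow> 'a set \<Rightarrow> int \<Rightarrow> ('a \<times> bool) list set" where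
  "bounded_relators G S n =
     normal_closure (free_group S)
       {w \<in> kernel (free_group S) G (word_value G). int (length w) \<le> n}"

lemma bounded_relators_minus_one: "bounded_relators G S (-1) = {\<one>\<^bsub>free_group S\<^esub>}"
proof -
  interpret F: group "free_group S" by (rule group_free_group)
  have "\<one>\<^bsub>free_group S\<^esub> \<in> H" if "H \<lhd> free_group S" for H
    using that by (simp add: normal_def subgroup.one_closed)
  then show ?thesis
    using F.one_is_normal by (auto simp: bounded_relators_def normal_closure_def)
qed

definition relation_range :: "('a, 'b) monoid_scheme \<Rightarrow> 'a set \<Rightarrow> nat set" where
  "relation_range G S = {n. bounded_relators G S (int n - 1) \<subset> bounded_relators G S (int n)}"


section \<open>Comparison of sets of nonnegative reals\<close>

definition coarse_le :: "real set \<Rightarrow> real set \<Rightarrow> bool"  (infix "\<preceq>\<^sub>c" 50) where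
  "A \<preceq>\<^sub>c B \<longleftrightarrow> (\<exists>c\<ge>1. \<forall>a\<in>A. a \<ge> c \<longrightarrow> (\<exists>b\<in>B. b \<in> {inverse c * a .. c * a}))"

definition coarse_eq :: "real set \<Rightarrow> real set \<Rightarrow> bool"  (infix "\<sim>\<^sub>c" 50) where
  "A \<sim>\<^sub>c B \<longleftrightarrow> A \<preceq>\<^sub>c B \<and> B \<preceq>\<^sub>c A"


section \<open>Group-theoretic properties\<close>

definition finite_generating_set :: "('a, 'b) monoid_scheme \<Rightarrow> 'a set \<Rightarrow> bool" where
  "finite_generating_set G S \<longleftrightarrow> finite S \<and> S \<subseteq> carrier G \<and> generate G S = carrier G"

definition finitely_generated_group :: "('a, 'b) monoid_scheme \<Rightarrow> bool" where
  "finitely_generated_group G \<longleftrightarrow> group G \<and> (\<exists>S. finite_generating_set G S)"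

definition locally_finite_group :: "('a, 'b) monoid_scheme \<Rightarrow> bool" where
  "locally_finite_group G \<longleftrightarrow>
     group G \<and> (\<forall>A. finite A \<and> A \<subseteq> carrier G \<longrightarrow> finite (generate G A))"

text \<open>
  The term with index \<open>n\<close> is what is usually written \<open>\<gamma>\<close> with index \<open>n + 1\<close>: the series
  starts at index \<open>0\<close> with the whole group.
\<close>

primrec lower_central :: "('a, 'b) monoid_scheme \<Rightarrow> nat \<Rightarrow> 'a set" where
  "lower_central G 0 = carrier G"
| "lower_central G (Suc n) =
     generate G {x \<otimes>\<^bsub>G\<^esub> y \<otimes>\<^bsub>G\<^esub> inv\<^bsub>G\<^esub> x \<otimes>\<^bsub>G\<^esub> inv\<^bsub>G\<^esub> y | x y.
       x \<in> lower_central G n \<and> y \<in> carrier G}"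

definition nilpotent_class_at_most :: "nat \<Rightarrow> ('a, 'b) monoid_scheme \<Rightarrow> bool" where
  "nilpotent_class_at_most c G \<longleftrightarrow> group G \<and> lower_central G c = {\<one>\<^bsub>G\<^esub>}"

end

theory Submission
  imports Defs "HOL-Algebra.Weak_Morphisms" "HOL-Library.Z2" "HOL-Library.Countable_Set"
    "HOL-Computational_Algebra.Formal_Laurent_Series"
begin

text \<open>
  Start from Abels' group of upper triangular \<open>4 \<times> 4\<close> matrices with diagonal \<open>(1, a, b, 1)\<close>, where
  \<open>a\<close> and \<open>b\<close> are products of powers of \<open>t\<close> and \<open>1 + t\<close>, over the ring generated by \<open>1/t\<close>, \<open>t\<close> and
  \<open>1/(1 + t)\<close> in characteristic two; it is only used as the image of a finitely presented group
  \<open>H\<close>.  The elements \<open>w\<^sub>j\<close> of \<open>H\<close> (\<open>center_elem\<close>) that map to the matrices with corner entry \<open>1/t\<^bsup>j\<^esup>\<close>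
  are central of order two and have word length linear in \<open>j\<close>, while an element of length \<open>n\<close> maps to a
  matrix whose entries have degree \<open>O(n)\<close> in \<open>1/t\<close>.  So when the relators \<open>w\<^sub>j\<close>, \<open>j \<in> I\<close>, are added to
  those of \<open>H\<close>, new relations appear, up to a multiplicative constant and finitely many lengths,
  exactly at the lengths in \<open>I\<close>.

  Finitely many relators suffice for \<open>H\<close> because each of the five root elements \<open>x, y, z, e, g\<close> is
  centralized by one of three rank-two subgroups of the torus \<open>T\<close>, any two of which generate \<open>T\<close>: if
  two root elements with different such centralizers commute, then so do their \<open>T\<close>-orbits.
  Commutativity inside the orbits of \<open>x\<close>, \<open>y\<close> and \<open>z\<close> uses the unit \<open>1 + t\<close>.
\<close>

section \<open>Groups generated by orbits of involutions\<close>

text \<open>The outer diagonal entries are 1, so the torus fixes the corner entry; this leaves room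
  for infinitely many independent central elements beside a finite list of relators. The obstacle is
  that nothing is established about the kernel of the map from H to matrices: the relators give no
  normal form, and a matrix does not tell whether a word is trivial in H. The way round rests on two
  facts. In every quotient of H the image of w_j is central of order at most two, so one more
  relator w_j enlarges a kernel by index at most two; and the coefficient of the corner entry at
  t^(-j) detects w_j. Together they show that a relation whose matrix has degree at most m in 1/t
  follows from the relators of H and the w_j with j at most m. Characteristic two thus serves twice:
  it bounds that index, and it makes the unipotent part locally finite. An arbitrary finite
  generating set S is treated directly, by rewriting words in the seven generators over S and
  back.\<close>

definition conjugate :: "('a, 'b) monoid_scheme \<Rightarrow> 'a \<Rightarrow> 'a \<Rightarrow> 'a" where
  "conjugate G u a = u \<otimes>\<^bsub>G\<^esub> a \<otimes>\<^bsub>G\<^esub> inv\<^bsub>G\<^esub> u"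

definition commutator :: "('a, 'b) monoid_scheme \<Rightarrow> 'a \<Rightarrow> 'a \<Rightarrow> 'a" where
  "commutator G a b = a \<otimes>\<^bsub>G\<^esub> b \<otimes>\<^bsub>G\<^esub> inv\<^bsub>G\<^esub> a \<otimes>\<^bsub>G\<^esub> inv\<^bsub>G\<^esub> b"

text \<open>For normal \<open>M\<close> this is the preimage of the centralizer of the image of
  \<open>B\<close> in the quotient by \<open>M\<close>. Iterating it in \<open>M\<close> builds an
  ascending central series.\<close>

definition centralizer :: "('a, 'b) monoid_scheme \<Rightarrow> 'a set \<Rightarrow> 'a set \<Rightarrow> 'a set" where
  "centralizer G M B = {d \<in> carrier G. \<forall>b\<in>B. commutator G d b \<in> M}"

definition orbit :: "('a, 'b) monoid_scheme \<Rightarrow> 'a set \<Rightarrow> 'a \<Rightarrow> 'a set" where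
  "orbit G Q a = (\<lambda>u. conjugate G u a) ` Q"

section \<open>Conjugation and commutator calculus\<close>

context group
begin

abbreviation "commutes a b \<equiv> a \<otimes> b = b \<otimes> a"

lemma inv_cancel_left [simp]:
  assumes "a \<in> carrier G" "b \<in> carrier G"
  shows "inv a \<otimes> (a \<otimes> b) = b" "a \<otimes> (inv a \<otimes> b) = b"
  using assms by (simp_all flip: m_assoc)

lemma conjugate_closed [simp, intro]:
  "u \<in> carrier G \<Longrightarrow> a \<in> carrier G \<Longrightarrow> conjugate G u a \<in> carrier G"
  by (simp add: conjugate_def)

lemma commutator_closed [simp, intro]:
  "a \<in> carrier G \<Longrightarrow> b \<in> carrier G \<Longrightarrow> commutator G a b \<in> carrier G"
  by (simp add: commutator_def)

lemma conjugate_one [simp]: "a \<in> carrier G \<Longrightarrow> conjugate G \<one> a = a"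
  "u \<in> carrier G \<Longrightarrow> conjugate G u \<one> = \<one>"
  by (simp_all add: conjugate_def)

lemma conjugate_mult_left:
  "u \<in> carrier G \<Longrightarrow> v \<in> carrier G \<Longrightarrow> a \<in> carrier G \<Longrightarrow>
    conjugate G (u \<otimes> v) a = conjugate G u (conjugate G v a)"
  by (simp add: conjugate_def inv_mult_group m_assoc)

lemma conjugate_mult:
  "u \<in> carrier G \<Longrightarrow> a \<in> carrier G \<Longrightarrow> b \<in> carrier G \<Longrightarrow>
    conjugate G u (a \<otimes> b) = conjugate G u a \<otimes> conjugate G u b"
  by (simp add: conjugate_def inv_mult_group m_assoc)

lemma conjugate_inv:
  "u \<in> carrier G \<Longrightarrow> a \<in> carrier G \<Longrightarrow> conjugate G u (inv a) = inv (conjugate G u a)"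
  by (simp add: conjugate_def inv_mult_group m_assoc)

lemma conjugate_inv_cancel [simp]:
  assumes "u \<in> carrier G" "a \<in> carrier G"
  shows "conjugate G (inv u) (conjugate G u a) = a" "conjugate G u (conjugate G (inv u) a) = a"
  using assms by (simp_all flip: conjugate_mult_left)

lemma conjugate_commutator:
  "u \<in> carrier G \<Longrightarrow> a \<in> carrier G \<Longrightarrow> b \<in> carrier G \<Longrightarrow>
    conjugate G u (commutator G a b) = commutator G (conjugate G u a) (conjugate G u b)"
  by (simp add: commutator_def conjugate_mult conjugate_inv)

lemma conjugate_eq_iff:
  assumes "u \<in> carrier G" "a \<in> carrier G" "b \<in> carrier G"
  shows "conjugate G u a = conjugate G u b \<longleftrightarrow> a = b"
  using assms by (metis conjugate_inv_cancel(1))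

lemma commutator_eq_conjugate: "commutator G a b = conjugate G a b \<otimes> inv b"
  by (simp add: commutator_def conjugate_def)

lemma conjugate_eq_commutator:
  "a \<in> carrier G \<Longrightarrow> b \<in> carrier G \<Longrightarrow> conjugate G a b = commutator G a b \<otimes> b"
  by (simp add: commutator_def conjugate_def m_assoc)

lemma commutator_eq_one_iff:
  assumes "a \<in> carrier G" "b \<in> carrier G"
  shows "commutator G a b = \<one> \<longleftrightarrow> commutes a b"
proof -
  have "commutator G a b = (a \<otimes> b) \<otimes> inv (b \<otimes> a)"
    using assms by (simp add: commutator_def inv_mult_group m_assoc)
  then show ?thesis
    using assms by (metis inv_solve_right' l_one m_closed one_closed r_inv)
qed

lemma inv_commutator:
  "a \<in> carrier G \<Longrightarrow> b \<in> carrier G \<Longrightarrow> inv (commutator G a b) = commutator G b a"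
  by (simp add: commutator_def inv_mult_group m_assoc)

lemma conjugate_eq_iff_commutes:
  assumes "u \<in> carrier G" "a \<in> carrier G"
  shows "conjugate G u a = a \<longleftrightarrow> commutes u a"
  using assms by (metis commutator_closed commutator_eq_conjugate commutator_eq_one_iff
      conjugate_closed inv_solve_right' l_one one_closed)

lemma commutes_conjugate:
  assumes "u \<in> carrier G" "a \<in> carrier G" "b \<in> carrier G" "commutes a b"
  shows "commutes (conjugate G u a) (conjugate G u b)"
  using assms by (metis conjugate_mult)

lemma commutes_inv:
  assumes "a \<in> carrier G" "b \<in> carrier G" "commutes a b"
  shows "commutes (inv a) b"
  using assms by (metis inv_cancel_left(1) inv_closed m_assoc m_closed r_inv r_one)

lemma commutes_mult:
  assumes "a \<in> carrier G" "b \<in> carrier G" "c \<in> carrier G" "commutes a c" "commutes b c"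
  shows "commutes (a \<otimes> b) c"
  using assms by (metis m_assoc)

lemma commutes_generate:
  assumes A: "A \<subseteq> carrier G" and B: "B \<subseteq> carrier G"
    and c: "\<And>a b. a \<in> A \<Longrightarrow> b \<in> B \<Longrightarrow> commutes a b"
    and u: "u \<in> generate G A" and v: "v \<in> generate G B"
  shows "commutes u v"
proof -
  have 1: "commutes u b" if b: "b \<in> B" for b
    using u
  proof induction
    case one show ?case using b B by auto
  next
    case (incl h) show ?case using c[OF incl b] .
  next
    case (inv h) show ?case using commutes_inv[of h b] c[OF inv b] A B b inv by blast
  next
    case (eng h k) then show ?case
      using commutes_mult[of h k b] generate_in_carrier[OF A] B b by blast
  qed
  have uc: "u \<in> carrier G" using generate_in_carrier[OF A u] .
  have "commutes v u"
    using v
  proof induction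
    case one show ?case using uc by auto
  next
    case (incl h) show ?case using 1[OF incl] by simp
  next
    case (inv h) show ?case using commutes_inv[of h u] 1[OF inv] B inv uc by fastforce
  next
    case (eng h k) then show ?case
      using commutes_mult[of h k u] generate_in_carrier[OF B] uc by blast
  qed
  then show ?thesis by simp
qed

lemma conjugate_generate:
  assumes A: "A \<subseteq> carrier G" and L: "subgroup L G" and u: "u \<in> carrier G"
    and *: "\<And>a. a \<in> A \<Longrightarrow> conjugate G u a \<in> L" and h: "h \<in> generate G A"
  shows "conjugate G u h \<in> L"
  using h
proof induction
  case one show ?case using u L by (simp add: subgroup.one_closed)
next
  case (incl h) then show ?case using * by blast
next
  case (inv h)
  then have "conjugate G u (inv h) = inv (conjugate G u h)"
    using u A conjugate_inv by blast
  then show ?case using *[OF inv] L by (simp add: subgroup.m_inv_closed)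
next
  case (eng h k)
  then show ?case
    using generate_in_carrier[OF A] L u by (simp add: conjugate_mult subgroup.m_closed)
qed

lemma normalI_conjugate:
  assumes "subgroup L G" "\<And>u a. u \<in> carrier G \<Longrightarrow> a \<in> L \<Longrightarrow> conjugate G u a \<in> L"
  shows "L \<lhd> G"
  using assms by (intro normal_invI) (auto simp: conjugate_def)

lemma normal_conjugate:
  assumes "L \<lhd> G" "u \<in> carrier G" "a \<in> L"
  shows "conjugate G u a \<in> L"
  using assms by (simp add: conjugate_def normal.inv_op_closed2)

lemma normal_generate:
  assumes A: "A \<subseteq> carrier G" and T: "T \<subseteq> carrier G" and gT: "generate G T = carrier G"
    and *: "\<And>t a. t \<in> T \<Longrightarrow> a \<in> A \<Longrightarrow> conjugate G t a \<in> generate G A"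
    and **: "\<And>t a. t \<in> T \<Longrightarrow> a \<in> A \<Longrightarrow> conjugate G (inv t) a \<in> generate G A"
  shows "generate G A \<lhd> G"
proof (rule normalI_conjugate)
  show L: "subgroup (generate G A) G" using A by (rule generate_is_subgroup)
  fix u a assume u: "u \<in> carrier G" and a: "a \<in> generate G A"
  have "u \<in> generate G T" using u gT by simp
  then have "\<forall>a\<in>generate G A. conjugate G u a \<in> generate G A"
  proof induction
    case one show ?case using generate_in_carrier[OF A] by simp
  next
    case (incl h)
    then show ?case using conjugate_generate[OF A L, of h] * T by blast
  next
    case (inv h)
    then show ?case using conjugate_generate[OF A L, of "inv h"] ** T by blast
  next
    case (eng h k)
    then show ?case using generate_in_carrier[OF A] gT by (simp add: conjugate_mult_left)
  qed
  then show "conjugate G u a \<in> generate G A" using a by blast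
qed

lemma subgroup_centralizer:
  assumes M: "M \<lhd> G" and B: "B \<subseteq> carrier G"
  shows "subgroup (centralizer G M B) G"
proof -
  interpret M: normal M G by fact
  have 1: "commutator G (d \<otimes> d') b = conjugate G d (commutator G d' b) \<otimes> commutator G d b"
    if "d \<in> carrier G" "d' \<in> carrier G" "b \<in> carrier G" for d d' b
    using that by (simp add: commutator_def conjugate_def inv_mult_group m_assoc)
  have 2: "commutator G (inv d) b = conjugate G (inv d) (inv (commutator G d b))"
    if "d \<in> carrier G" "b \<in> carrier G" for d b
    using that by (simp add: commutator_def conjugate_def inv_mult_group m_assoc)
  show ?thesis
  proof
    show "centralizer G M B \<subseteq> carrier G" by (auto simp: centralizer_def)
    show "\<one> \<in> centralizer G M B"
      using B by (auto simp: centralizer_def commutator_def subset_iff)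
    fix d d' assume d: "d \<in> centralizer G M B"
    show "inv d \<in> centralizer G M B"
      using d B by (auto simp: centralizer_def 2 subset_iff intro!: normal_conjugate M)
    assume "d' \<in> centralizer G M B"
    then show "d \<otimes> d' \<in> centralizer G M B"
      using d B by (auto simp: centralizer_def 1 subset_iff intro!: normal_conjugate M)
  qed
qed

lemma centralizer_sym:
  assumes "M \<lhd> G" "a \<in> carrier G" "b \<in> carrier G"
  shows "commutator G a b \<in> M \<longleftrightarrow> commutator G b a \<in> M"
proof -
  interpret M: normal M G by fact
  show ?thesis using assms inv_commutator by (metis M.m_inv_closed)
qed

text \<open>The centralizer modulo \<open>M\<close> is a subgroup, so the condition passes from
  \<open>A\<close> to the group it generates; the symmetry of the condition then does the same for
  \<open>B\<close>.\<close>

lemma commutator_generate: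
  assumes M: "M \<lhd> G" and A: "A \<subseteq> carrier G" and B: "B \<subseteq> carrier G"
    and c: "\<And>a b. a \<in> A \<Longrightarrow> b \<in> B \<Longrightarrow> commutator G a b \<in> M"
    and u: "u \<in> generate G A" and v: "v \<in> generate G B"
  shows "commutator G u v \<in> M"
proof -
  have "A \<subseteq> centralizer G M B" using A c by (auto simp: centralizer_def)
  then have "generate G A \<subseteq> centralizer G M B"
    by (intro generate_subgroup_incl subgroup_centralizer M B)
  then have 1: "commutator G u b \<in> M" if "b \<in> B" for b
    using u that by (auto simp: centralizer_def)
  have uc: "u \<in> carrier G" using generate_in_carrier[OF A u] .
  have "B \<subseteq> centralizer G M {u}"
    using B 1 uc centralizer_sym[OF M] by (auto simp: centralizer_def)
  then have "generate G B \<subseteq> centralizer G M {u}"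
    using uc by (intro generate_subgroup_incl subgroup_centralizer M) auto
  then have "commutator G v u \<in> M" using v by (auto simp: centralizer_def)
  then show ?thesis
    using centralizer_sym[OF M] uc generate_in_carrier[OF B v] by blast
qed

lemma normal_centralizer:
  assumes M: "M \<lhd> G" and N: "N \<lhd> G"
  shows "centralizer G M N \<lhd> G"
proof (rule normalI_conjugate)
  have Nc: "N \<subseteq> carrier G" using N by (simp add: normal_imp_subgroup subgroup.subset)
  show "subgroup (centralizer G M N) G" by (rule subgroup_centralizer[OF M Nc])
  fix u a assume u: "u \<in> carrier G" and a: "a \<in> centralizer G M N"
  have ac: "a \<in> carrier G" using a by (simp add: centralizer_def)
  have "commutator G (conjugate G u a) n \<in> M" if n: "n \<in> N" for n
  proof -
    have nc: "n \<in> carrier G" using n Nc by blast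
    have "conjugate G (inv u) n \<in> N" using normal_conjugate[OF N _ n] u by simp
    then have "conjugate G u (commutator G a (conjugate G (inv u) n)) \<in> M"
      using a u by (intro normal_conjugate[OF M]) (auto simp: centralizer_def)
    then show ?thesis using u ac nc by (simp add: conjugate_commutator)
  qed
  then show "conjugate G u a \<in> centralizer G M N"
    using u ac by (simp add: centralizer_def)
qed

text \<open>Since \<open>a\<close> is an involution, conjugating \<open>b\<close> twice by
  \<open>a\<close> changes nothing; since the commutator commutes with \<open>a\<close>, each of the
  two conjugations multiplies \<open>b\<close> by it.\<close>

lemma commutator_square:
  assumes "a \<in> carrier G" "b \<in> carrier G" "a \<otimes> a = \<one>" "commutes a (commutator G a b)"
  shows "commutator G a b \<otimes> commutator G a b = \<one>"
proof -
  let ?c = "commutator G a b"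
  have "b = conjugate G (a \<otimes> a) b" using assms by simp
  also have "\<dots> = conjugate G a (?c \<otimes> b)"
    using assms(1,2) by (simp only: conjugate_mult_left conjugate_eq_commutator)
  also have "\<dots> = conjugate G a ?c \<otimes> conjugate G a b"
    using assms by (simp add: conjugate_mult)
  also have "conjugate G a ?c = ?c"
    using assms by (simp add: conjugate_eq_iff_commutes)
  also have "conjugate G a b = ?c \<otimes> b"
    using assms by (simp add: conjugate_eq_commutator)
  finally have "b = (?c \<otimes> ?c) \<otimes> b" using assms by (simp add: m_assoc)
  then show ?thesis using assms by (metis commutator_closed m_closed r_cancel_one')
qed

text \<open>Conjugation by \<open>x\<close> fixes \<open>z\<close> and turns \<open>y\<close> into
  \<open>e y\<close>, so it turns \<open>g = [y, z]\<close> into \<open>[e y, z] = g [e, z]\<close>.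
  For matrices, both double commutators put the product of the three superdiagonal entries into the
  corner.\<close>

lemma commutator_commutator:
  assumes [simp]: "x \<in> carrier G" "y \<in> carrier G" "z \<in> carrier G"
    and xz: "commutes x z"
    and eg: "commutes (commutator G x y) (commutator G y z)"
    and gz: "commutes (commutator G y z) z"
  shows "commutator G x (commutator G y z) = commutator G (commutator G x y) z"
proof -
  define e g where "e = commutator G x y" and "g = commutator G y z"
  have [simp]: "e \<in> carrier G" "g \<in> carrier G" by (simp_all add: e_def g_def)
  have "conjugate G x g = commutator G (conjugate G x y) (conjugate G x z)"
    by (simp add: g_def conjugate_commutator)
  also have "conjugate G x z = z" using xz by (simp add: conjugate_eq_iff_commutes)
  also have "conjugate G x y = e \<otimes> y" by (simp add: e_def conjugate_eq_commutator)
  also have "commutator G (e \<otimes> y) z = conjugate G e g \<otimes> commutator G e z"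
    by (simp add: g_def commutator_def conjugate_def inv_mult_group m_assoc)
  also have "conjugate G e g = g"
    using eg by (simp add: conjugate_eq_iff_commutes e_def g_def)
  finally have 1: "conjugate G x g = g \<otimes> commutator G e z" .
  have "commutes e g" "commutes z g" using eg gz by (simp_all add: e_def g_def)
  then have "commutes (commutator G e z) g"
    unfolding commutator_def by (intro commutes_mult commutes_inv) simp_all
  then have "conjugate G x g = commutator G e z \<otimes> g" using 1 by simp
  then have "commutator G x g = commutator G e z"
    by (simp add: commutator_eq_conjugate[of x g] m_assoc)
  then show ?thesis by (simp add: e_def g_def)
qed

lemma generate_Un_commuting:
  assumes A: "A \<subseteq> carrier G" and B: "B \<subseteq> carrier G"
    and c: "\<And>a b. a \<in> A \<Longrightarrow> b \<in> B \<Longrightarrow> commutes a b"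
    and u: "u \<in> generate G (A \<union> B)"
  shows "\<exists>m\<in>generate G A. \<exists>n\<in>generate G B. u = m \<otimes> n"
  using u
proof induction
  case one
  then show ?case using generate.one by (intro bexI[of _ \<one>]) auto
next
  case (incl h)
  then have "h \<in> carrier G" using A B by blast
  then have "h = h \<otimes> \<one>" "h = \<one> \<otimes> h" by simp_all
  then show ?case using incl by (blast intro: generate.intros)
next
  case (inv h)
  then have "h \<in> carrier G" using A B by blast
  then have "inv h = inv h \<otimes> \<one>" "inv h = \<one> \<otimes> inv h" by simp_all
  then show ?case using inv by (blast intro: generate.intros)
next
  case (eng h k)
  then obtain m n m' n' where *: "m \<in> generate G A" "n \<in> generate G B" "h = m \<otimes> n"
    "m' \<in> generate G A" "n' \<in> generate G B" "k = m' \<otimes> n'" by blast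
  have cl: "m \<in> carrier G" "n \<in> carrier G" "m' \<in> carrier G" "n' \<in> carrier G"
    using * generate_in_carrier A B by blast+
  have "commutes m' n" using commutes_generate[OF A B c] * by blast
  then have "n \<otimes> (m' \<otimes> n') = m' \<otimes> (n \<otimes> n')"
    using cl by (simp flip: m_assoc)
  then have "h \<otimes> k = (m \<otimes> m') \<otimes> (n \<otimes> n')"
    unfolding * using cl by (simp add: m_assoc)
  moreover have "m \<otimes> m' \<in> generate G A" "n \<otimes> n' \<in> generate G B"
    using * by (auto intro: generate.eng)
  ultimately show ?case by blast
qed

lemma generate_subset_generate:
  "A \<subseteq> carrier G \<Longrightarrow> B \<subseteq> generate G A \<Longrightarrow> generate G B \<subseteq> generate G A"
  by (intro generate_subgroup_incl generate_is_subgroup)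

section \<open>Conjugation orbits and simultaneous conjugation\<close>

lemma orbit_self: "subgroup Q G \<Longrightarrow> a \<in> carrier G \<Longrightarrow> a \<in> orbit G Q a"
  by (metis conjugate_one(1) image_eqI orbit_def subgroup.one_closed)

lemma orbit_subset_carrier: "Q \<subseteq> carrier G \<Longrightarrow> a \<in> carrier G \<Longrightarrow> orbit G Q a \<subseteq> carrier G"
  by (auto simp: orbit_def)

lemma conjugate_orbit:
  assumes "subgroup Q G" "a \<in> carrier G" "u \<in> Q" "b \<in> orbit G Q a"
  shows "conjugate G u b \<in> orbit G Q a"
proof -
  obtain v where "v \<in> Q" "b = conjugate G v a" using assms by (auto simp: orbit_def)
  moreover have "u \<otimes> v \<in> Q" using assms calculation by (simp add: subgroup.m_closed)
  moreover have "u \<in> carrier G" "v \<in> carrier G"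
    using subgroup.mem_carrier[OF assms(1)] assms(3) calculation(1) by simp_all
  ultimately have "conjugate G u b = conjugate G (u \<otimes> v) a" "u \<otimes> v \<in> Q"
    using assms by (simp_all add: conjugate_mult_left)
  then show ?thesis by (simp add: orbit_def)
qed

text \<open>If \<open>\<alpha>\<close> is the conjugate of \<open>a\<close> by \<open>u\<close>,
  \<open>\<beta>\<close> that of \<open>b\<close> by \<open>v\<close>, and
  \<open>inv u \<otimes> v = m \<otimes> n\<close>, then \<open>u \<otimes> m\<close> serves both,
  because \<open>m\<close> fixes \<open>a\<close> and \<open>n\<close> fixes \<open>b\<close>. Hence
  a single relation between \<open>a\<close> and \<open>b\<close> spreads to all pairs from the two
  orbits.\<close>

lemma simultaneous_conjugate:
  assumes Q: "subgroup Q G" and a: "a \<in> carrier G" and b: "b \<in> carrier G"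
    and fac: "\<And>u. u \<in> Q \<Longrightarrow> \<exists>m\<in>Qa. \<exists>n\<in>Qb. u = m \<otimes> n"
    and sub: "Qa \<subseteq> Q" "Qb \<subseteq> Q"
    and fa: "\<And>m. m \<in> Qa \<Longrightarrow> conjugate G m a = a"
    and fb: "\<And>n. n \<in> Qb \<Longrightarrow> conjugate G n b = b"
    and \<alpha>: "\<alpha> \<in> orbit G Q a" and \<beta>: "\<beta> \<in> orbit G Q b"
  shows "\<exists>u\<in>Q. \<alpha> = conjugate G u a \<and> \<beta> = conjugate G u b"
proof -
  have Qc: "Q \<subseteq> carrier G" using Q by (rule subgroup.subset)
  obtain u v where u: "u \<in> Q" "\<alpha> = conjugate G u a" and v: "v \<in> Q" "\<beta> = conjugate G v b"
    using \<alpha> \<beta> by (auto simp: orbit_def)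
  have "inv u \<otimes> v \<in> Q" using Q u v by (simp add: subgroup.m_closed subgroup.m_inv_closed)
  then obtain m n where mn: "m \<in> Qa" "n \<in> Qb" "inv u \<otimes> v = m \<otimes> n" using fac by blast
  have cl: "u \<in> carrier G" "v \<in> carrier G" "m \<in> carrier G" "n \<in> carrier G"
    using u v mn sub Qc by blast+
  have "v = u \<otimes> (inv u \<otimes> v)" using cl by simp
  then have "v = (u \<otimes> m) \<otimes> n" unfolding mn(3) using cl by (simp add: m_assoc)
  then have "\<beta> = conjugate G ((u \<otimes> m) \<otimes> n) b" using v(2) by simp
  also have "\<dots> = conjugate G (u \<otimes> m) (conjugate G n b)"
    using cl b by (intro conjugate_mult_left) simp_all
  finally have "\<beta> = conjugate G (u \<otimes> m) b" using fb[OF mn(2)] by simp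
  moreover have "\<alpha> = conjugate G (u \<otimes> m) a"
    using cl a fa[OF mn(1)] unfolding u(2) by (simp add: conjugate_mult_left)
  moreover have "u \<otimes> m \<in> Q" using u mn sub Q by (meson subgroup.m_closed subsetD)
  ultimately show ?thesis by blast
qed

section \<open>Commutation within one orbit\<close>

lemma conjugate_shift:
  assumes cl [simp]: "a \<in> carrier G" "p \<in> carrier G" "q \<in> carrier G"
    and pq: "commutes p q" and q: "conjugate G q a = a \<otimes> conjugate G p a"
  shows "conjugate G q (conjugate G (p [^] (i::int)) a) =
    conjugate G (p [^] i) a \<otimes> conjugate G (p [^] (i + 1)) a"
proof -
  have "p [^] i \<in> generate G {p}" by (auto simp: generate_pow)
  then have "commutes q (p [^] i)"
    using commutes_generate[of "{q}" "{p}" q "p [^] i"] pq by (auto simp: generate.incl)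
  then have "conjugate G q (conjugate G (p [^] i) a) = conjugate G (p [^] i) (conjugate G q a)"
    by (simp flip: conjugate_mult_left)
  also have "\<dots> = conjugate G (p [^] i) a \<otimes> conjugate G (p [^] i \<otimes> p) a"
    by (simp add: q conjugate_mult conjugate_mult_left)
  also have "p [^] i \<otimes> p = p [^] (i + 1)" by (simp add: int_pow_mult)
  finally show ?thesis .
qed

text \<open>
  If \<open>q\<close> acts as \<open>1 + p\<close>, a single commutation \<open>[a, a\<^sup>p] = 1\<close> propagates: conjugating
  \<open>[a, a\<^bsup>p^n\<^esup>] = 1\<close> by \<open>q\<close> yields \<open>[a, a\<^bsup>p^(n+1)\<^esup>] = 1\<close> (Baumslag's trick).
\<close>

lemma commutes_powers:
  assumes cl [simp]: "a \<in> carrier G" "p \<in> carrier G" "q \<in> carrier G"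
    and pq: "commutes p q" and ap: "commutes a (conjugate G p a)"
    and q: "conjugate G q a = a \<otimes> conjugate G p a"
  shows "commutes (conjugate G (p [^] (i::int)) a) (conjugate G (p [^] (j::int)) a)"
proof -
  define b where "b i = conjugate G (p [^] (i::int)) a" for i
  have [simp]: "b i \<in> carrier G" for i by (simp add: b_def)
  have b_shift: "conjugate G (p [^] i) (b j) = b (i + j)" for i j
    by (simp add: b_def int_pow_mult conjugate_mult_left)
  have b0: "b 0 = a" by (simp add: b_def)
  have b1: "b 1 = conjugate G p a" by (simp add: b_def)
  have qb: "conjugate G q (b i) = b i \<otimes> b (i + 1)" for i
    unfolding b_def by (rule conjugate_shift[OF cl pq q])
  have *: "\<forall>k\<le>n. commutes a (b (int k))" for n
  proof (induction n)
    case 0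
    then show ?case by (simp add: b0)
  next
    case (Suc n)
    show ?case
    proof (cases "n = 0")
      case True
      then show ?thesis using ap by (auto simp: le_Suc_eq b0 b1)
    next
      case False
      have near: "commutes (b i) (b (i + int k))" if "k \<le> n" for i k
        using commutes_conjugate[of "p [^] i" a "b (int k)"] Suc that
        by (simp add: b_shift) (simp add: b_def)
      \<comment> \<open>Conjugating \<open>commutes a ?u\<close> by \<open>q\<close> makes
        \<open>a \<otimes> b 1\<close> commute with \<open>?u \<otimes> ?v\<close>. The factor
        \<open>b 1\<close> is at distance \<open>n - 1\<close> from \<open>?u\<close> and
        \<open>n\<close> from \<open>?v\<close>, so the induction hypothesis removes it; cancelling
        \<open>?u\<close> leaves \<open>?v\<close>.\<close>
      let ?u = "b (int n)" and ?v = "b (int n + 1)"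
      have au: "commutes a ?u" using Suc by blast
      have c1: "commutes (b 1) ?u" "commutes (b 1) ?v"
        using near[of "n - 1" 1] near[of n 1] False by (auto simp: add.commute)
      have "commutes (a \<otimes> b 1) (?u \<otimes> ?v)"
        using commutes_conjugate[of q a ?u] au qb[of 0] qb[of "int n"] by (simp add: b0)
      moreover have "commutes (?u \<otimes> ?v) (b 1)"
        by (rule commutes_mult) (simp_all add: c1)
      ultimately have "(a \<otimes> (?u \<otimes> ?v)) \<otimes> b 1 = ((?u \<otimes> ?v) \<otimes> a) \<otimes> b 1"
        by (simp only: m_assoc[of a "b 1"] m_assoc[of a "?u \<otimes> ?v" "b 1"]
            m_assoc[of "?u \<otimes> ?v" a "b 1"] cl \<open>\<And>i. b i \<in> carrier G\<close> m_closed)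
      then have "a \<otimes> (?u \<otimes> ?v) = (?u \<otimes> ?v) \<otimes> a" by simp
      moreover have "a \<otimes> (?u \<otimes> ?v) = ?u \<otimes> (a \<otimes> ?v)"
        using au by (simp flip: m_assoc)
      ultimately have "?u \<otimes> (a \<otimes> ?v) = ?u \<otimes> (?v \<otimes> a)" by (simp add: m_assoc)
      then have "commutes a ?v" by simp
      then show ?thesis using Suc by (auto simp: le_Suc_eq algebra_simps)
    qed
  qed
  have "commutes (b i) (b (i + int k))" for i k
    using commutes_conjugate[of "p [^] i" a "b (int k)"] *[of k]
    by (simp add: b_shift) (simp add: b_def)
  then have **: "commutes (b i) (b j)" if "i \<le> j" for i j
    using that by (metis zle_iff_zadd)
  show ?thesis using **[of i j] **[of j i] by (cases "i \<le> j") (auto simp: b_def)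
qed

text \<open>Positive powers of \<open>q\<close> preserve the group \<open>M\<close> generated by the
  conjugates of \<open>a\<close> under powers of \<open>p\<close>, but \<open>inv q\<close> need
  not: it acts as the inverse of 1 + p. The orbit is therefore caught in a larger set
  \<open>M'\<close>, which inherits commutativity because any two of its elements are moved into
  \<open>M\<close> by a common power of \<open>q\<close>.\<close>

lemma commutes_orbit:
  assumes cl [simp]: "a \<in> carrier G" "p \<in> carrier G" "q \<in> carrier G"
    and pq: "commutes p q" and ap: "commutes a (conjugate G p a)"
    and q: "conjugate G q a = a \<otimes> conjugate G p a"
    and \<alpha>: "\<alpha> \<in> orbit G (generate G {p, q}) a" and \<beta>: "\<beta> \<in> orbit G (generate G {p, q}) a"
  shows "commutes \<alpha> \<beta>"
proof -
  define b where "b i = conjugate G (p [^] (i::int)) a" for i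
  have [simp]: "b i \<in> carrier G" for i by (simp add: b_def)
  have b0: "b 0 = a" by (simp add: b_def)
  have b_shift: "conjugate G (p [^] i) (b j) = b (i + j)" for i j
    by (simp add: b_def int_pow_mult conjugate_mult_left)
  define M where "M = generate G (range b)"
  have M: "subgroup M G" unfolding M_def by (rule generate_is_subgroup) auto
  have Mc: "M \<subseteq> carrier G" using M by (rule subgroup.subset)
  have M_comm: "commutes h k" if "h \<in> M" "k \<in> M" for h k
    by (rule commutes_generate[OF _ _ _ that[unfolded M_def]])
      (auto simp: b_def commutes_powers[OF cl pq ap q])
  have bM: "b i \<in> M" for i by (auto simp: M_def intro: generate.incl)
  have qp: "commutes q (p [^] i)" for i :: int
  proof -
    have "p [^] i \<in> generate G {p}" by (auto simp: generate_pow)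
    then show ?thesis
      using commutes_generate[of "{q}" "{p}" q "p [^] i"] pq by (auto simp: generate.incl)
  qed
  have qb: "conjugate G q (b i) = b i \<otimes> b (i + 1)" for i
    unfolding b_def by (rule conjugate_shift[OF cl pq q])
  have qM: "conjugate G q h \<in> M" if "h \<in> M" for h
    by (rule conjugate_generate[OF _ M _ _ that[unfolded M_def]])
      (auto simp: qb bM subgroup.m_closed[OF M])
  have pM: "conjugate G (p [^] i) h \<in> M" if "h \<in> M" for h and i :: int
    by (rule conjugate_generate[OF _ M _ _ that[unfolded M_def]]) (auto simp: b_shift bM)
  have qnM: "conjugate G (q [^] n) h \<in> M" if "h \<in> M" for h and n :: nat
  proof (induction n)
    case 0
    then show ?case using that Mc by auto
  next
    case (Suc n)
    have "conjugate G (q [^] Suc n) h = conjugate G q (conjugate G (q [^] n) h)"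
      using that Mc by (subst nat_pow_Suc2) (auto simp: conjugate_mult_left)
    then show ?case using qM[OF Suc] by simp
  qed
  \<comment> \<open>The ascending union of the conjugates of \<open>M\<close> by negative powers of
    \<open>q\<close>, the analogue of localizing at 1 + t.\<close>
  define M' where "M' = {h \<in> carrier G. \<exists>n::nat. conjugate G (q [^] n) h \<in> M}"
  have aM': "a \<in> M'"
    using bM[of 0] by (auto simp: M'_def b0 intro!: exI[of _ "0::nat"])
  have M'_comm: "commutes h k" if hk: "h \<in> M'" "k \<in> M'" for h k
  proof -
    obtain n m where nm: "conjugate G (q [^] (n::nat)) h \<in> M" "conjugate G (q [^] (m::nat)) k \<in> M"
      and [simp]: "h \<in> carrier G" "k \<in> carrier G"
      using hk by (auto simp: M'_def)
    have "conjugate G (q [^] (m + n)) h \<in> M" "conjugate G (q [^] (m + n)) k \<in> M"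
      using qnM[OF nm(1), of m] qnM[OF nm(2), of n]
      by (simp_all flip: conjugate_mult_left add: nat_pow_mult add.commute)
    from M_comm[OF this]
    have "conjugate G (q [^] (m + n)) (h \<otimes> k) = conjugate G (q [^] (m + n)) (k \<otimes> h)"
      by (simp only: conjugate_mult nat_pow_closed cl \<open>h \<in> carrier G\<close> \<open>k \<in> carrier G\<close>)
    then show ?thesis by (simp add: conjugate_eq_iff)
  qed
  have qq: "commutes (q [^] n) (p [^] i)" for i :: int and n :: nat
  proof (induction n)
    case (Suc n)
    then show ?case
      unfolding nat_pow_Suc by (intro commutes_mult qp) simp_all
  qed simp
  have gen: "\<forall>h\<in>M'. conjugate G u h \<in> M'" if "u \<in> generate G {p, q}" for u
    using that
  proof induction
    case one
    then show ?case by (auto simp: M'_def)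
  next
    case (eng u v)
    then have "u \<in> carrier G" "v \<in> carrier G"
      using generate_in_carrier[of "{p, q}"] by auto
    then show ?case using eng by (auto simp: M'_def conjugate_mult_left)
  next
    case (incl u)
    have "conjugate G (p [^] (1::int)) h \<in> M'" "conjugate G q h \<in> M'" if h: "h \<in> M'" for h
    proof -
      obtain n where n: "conjugate G (q [^] (n::nat)) h \<in> M" and [simp]: "h \<in> carrier G"
        using h by (auto simp: M'_def)
      have "conjugate G (q [^] n) (conjugate G (p [^] (1::int)) h) \<in> M"
        using pM[OF n, of 1] qq[of n 1] by (metis \<open>h \<in> carrier G\<close> cl(2,3) conjugate_mult_left int_pow_closed nat_pow_closed)
      moreover have "conjugate G (q [^] n) (conjugate G q h) \<in> M"
        using qM[OF n] by (metis \<open>h \<in> carrier G\<close> cl(3) conjugate_mult_left nat_pow_closed nat_pow_Suc nat_pow_Suc2)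
      ultimately show "conjugate G (p [^] (1::int)) h \<in> M'" "conjugate G q h \<in> M'"
        by (auto simp: M'_def)
    qed
    then show ?case using incl by auto
  next
    case (inv u)
    have "conjugate G (p [^] (-1::int)) h \<in> M'" "conjugate G (inv q) h \<in> M'" if h: "h \<in> M'" for h
    proof -
      obtain n where n: "conjugate G (q [^] (n::nat)) h \<in> M" and [simp]: "h \<in> carrier G"
        using h by (auto simp: M'_def)
      have "conjugate G (q [^] n) (conjugate G (p [^] (-1::int)) h) \<in> M"
        using pM[OF n, of "-1"] qq[of n "-1"] by (metis \<open>h \<in> carrier G\<close> cl(2,3) conjugate_mult_left int_pow_closed nat_pow_closed)
      \<comment> \<open>One more power of \<open>q\<close> absorbs \<open>inv q\<close>, which is
        why the exponent in \<open>M'\<close> is left free.\<close>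
      moreover have "conjugate G (q [^] Suc n) (conjugate G (inv q) h) \<in> M"
        using n by (simp add: conjugate_mult_left)
      ultimately show "conjugate G (p [^] (-1::int)) h \<in> M'" "conjugate G (inv q) h \<in> M'"
        unfolding M'_def using cl \<open>h \<in> carrier G\<close> by blast+
    qed
    then show ?case using inv by (auto simp: int_pow_neg)
  qed
  have "\<alpha> \<in> M'" "\<beta> \<in> M'" using \<alpha> \<beta> gen aM' by (auto simp: orbit_def)
  then show ?thesis by (rule M'_comm)
qed

section \<open>Finite subgroups from commuting involutions\<close>

lemma generate_commuting_involutions:
  assumes A: "A \<subseteq> carrier G" and c: "\<And>a b. a \<in> A \<Longrightarrow> b \<in> A \<Longrightarrow> commutes a b"
    and i: "\<And>a. a \<in> A \<Longrightarrow> a \<otimes> a = \<one>" and u: "u \<in> generate G A"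
  shows "u \<otimes> u = \<one>"
  using u
proof induction
  case (inv h)
  then show ?case using A i by (metis inv_mult_group inv_one subset_iff)
next
  case (eng h k)
  have "commutes h k" using commutes_generate[OF A A c] eng by blast
  moreover have "h \<in> carrier G" "k \<in> carrier G" using eng generate_in_carrier[OF A] by blast+
  ultimately have "(h \<otimes> k) \<otimes> (h \<otimes> k) = (h \<otimes> h) \<otimes> (k \<otimes> k)" by (metis m_assoc m_closed)
  then show ?case using eng by simp
qed (use i in auto)

lemma finite_generate_commuting_involutions:
  assumes "finite A" "A \<subseteq> carrier G" "\<And>a b. a \<in> A \<Longrightarrow> b \<in> A \<Longrightarrow> commutes a b"
    and "\<And>a. a \<in> A \<Longrightarrow> a \<otimes> a = \<one>"
  shows "finite (generate G A)"
  using assms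
proof (induction A)
  case empty
  then show ?case by (simp add: generate_empty)
next
  case (insert a A)
  have "generate G {a} \<subseteq> {\<one>, a}"
  proof
    fix u assume "u \<in> generate G {a}"
    then show "u \<in> {\<one>, a}"
    proof induction
      case (inv h)
      then show ?case using insert.prems by (auto simp: inv_equality)
    next
      case (eng h k)
      then show ?case using insert.prems by auto
    qed auto
  qed
  then have fin: "finite ((\<lambda>(m, n). m \<otimes> n) ` (generate G {a} \<times> generate G A))"
    using insert by (auto intro: finite_subset)
  have "generate G (insert a A) \<subseteq> (\<lambda>(m, n). m \<otimes> n) ` (generate G {a} \<times> generate G A)"
    using generate_Un_commuting[of "{a}" A] insert.prems by fastforce
  then show ?case using fin by (rule finite_subset)
qed

text \<open>The \<open>V\<close>-parts of the elements of \<open>A\<close> generate a finite group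
  \<open>V0\<close>. Their \<open>B\<close>-parts need not generate a group stable under
  \<open>V0\<close>, so all \<open>V0\<close>-conjugates are taken: finitely many elements,
  generating a finite group \<open>B0\<close> that \<open>V0\<close> normalizes. The product of
  \<open>B0\<close> and \<open>V0\<close> is then a finite subgroup containing
  \<open>A\<close>.\<close>

lemma finite_generate_semidirect:
  assumes B: "subgroup B G" and V: "subgroup V G"
    and conj: "\<And>v b. v \<in> V \<Longrightarrow> b \<in> B \<Longrightarrow> conjugate G v b \<in> B"
    and fB: "\<And>A. finite A \<Longrightarrow> A \<subseteq> B \<Longrightarrow> finite (generate G A)"
    and fV: "\<And>A. finite A \<Longrightarrow> A \<subseteq> V \<Longrightarrow> finite (generate G A)"
    and A: "finite A" and prod: "\<And>a. a \<in> A \<Longrightarrow> \<exists>b\<in>B. \<exists>v\<in>V. a = b \<otimes> v"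
  shows "finite (generate G A)"
proof -
  obtain f g where fg: "\<And>a. a \<in> A \<Longrightarrow> f a \<in> B \<and> g a \<in> V \<and> a = f a \<otimes> g a"
    using prod by metis
  have Bc: "B \<subseteq> carrier G" and Vc: "V \<subseteq> carrier G" using B V by (simp_all add: subgroup.subset)
  define V0 where "V0 = generate G (g ` A)"
  have gc: "g ` A \<subseteq> carrier G" using fg Vc by blast
  have gV: "g ` A \<subseteq> V" and fA: "f ` A \<subseteq> B" using fg by blast+
  have V0: "finite V0" "subgroup V0 G" "V0 \<subseteq> V"
    unfolding V0_def using fV[OF _ gV] A generate_is_subgroup[OF gc] generate_subgroup_incl[OF gV V]
    by simp_all
  have V0c: "V0 \<subseteq> carrier G" using V0 Vc by blast
  define F where "F = (\<lambda>(v, a). conjugate G v (f a)) ` (V0 \<times> A)"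
  have F: "F \<subseteq> B" using V0(3) fA by (auto simp: F_def intro!: conj)
  define B0 where "B0 = generate G F"
  have Fc: "F \<subseteq> carrier G" using F Bc by blast
  have B0: "finite B0" "subgroup B0 G"
    unfolding B0_def using F V0 A Fc by (auto intro!: fB generate_is_subgroup simp: F_def)
  have B0c: "B0 \<subseteq> carrier G" using B0 by (simp add: subgroup.subset)
  have conj0: "conjugate G v b \<in> B0" if v: "v \<in> V0" and b: "b \<in> B0" for v b
  proof (rule conjugate_generate[OF Fc B0(2) _ _ b[unfolded B0_def]])
    show "v \<in> carrier G" using v V0c by blast
    fix c assume "c \<in> F"
    then obtain w a where w: "w \<in> V0" "a \<in> A" "c = conjugate G w (f a)" by (auto simp: F_def)
    have "conjugate G v c = conjugate G (v \<otimes> w) (f a)"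
      using w v V0c fA Bc by (auto simp: conjugate_mult_left subset_iff)
    moreover have "v \<otimes> w \<in> V0" using V0 v w by (simp add: subgroup.m_closed)
    ultimately have "conjugate G v c \<in> F" using w by (auto simp: F_def)
    then show "conjugate G v c \<in> B0" by (simp add: B0_def generate.incl)
  qed
  define P where "P = (\<lambda>(b, v). b \<otimes> v) ` (B0 \<times> V0)"
  have "subgroup P G"
  proof
    show "P \<subseteq> carrier G" using B0c V0c by (auto simp: P_def)
    have "(\<one>, \<one>) \<in> B0 \<times> V0"
      using subgroup.one_closed[OF B0(2)] subgroup.one_closed[OF V0(2)] by simp
    then have "\<one> \<otimes> \<one> \<in> P" unfolding P_def by (rule rev_image_eqI) simp
    then show "\<one> \<in> P" by simp
  next
    fix s t assume "s \<in> P" "t \<in> P"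
    then obtain b v c w where s: "s = b \<otimes> v" "t = c \<otimes> w"
      and m: "b \<in> B0" "c \<in> B0" "v \<in> V0" "w \<in> V0" by (auto simp: P_def)
    have cl: "b \<in> carrier G" "c \<in> carrier G" "v \<in> carrier G" "w \<in> carrier G"
      using m B0c V0c by blast+
    have "s \<otimes> t = (b \<otimes> conjugate G v c) \<otimes> (v \<otimes> w)"
      using cl by (simp add: s conjugate_def m_assoc)
    moreover have "b \<otimes> conjugate G v c \<in> B0" "v \<otimes> w \<in> V0"
      using m conj0 B0 V0 by (auto simp: subgroup.m_closed)
    ultimately show "s \<otimes> t \<in> P" by (auto simp: P_def)
  next
    fix s assume "s \<in> P"
    then obtain b v where s: "s = b \<otimes> v" and m: "b \<in> B0" "v \<in> V0" by (auto simp: P_def)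
    have cl: "b \<in> carrier G" "v \<in> carrier G" using m B0c V0c by blast+
    have "inv s = conjugate G (inv v) (inv b) \<otimes> inv v"
      using cl by (simp add: s conjugate_def m_assoc inv_mult_group)
    moreover have "conjugate G (inv v) (inv b) \<in> B0" "inv v \<in> V0"
      using m conj0 B0 V0 by (auto simp: subgroup.m_inv_closed)
    ultimately show "inv s \<in> P" by (auto simp: P_def)
  qed
  moreover have "A \<subseteq> P"
  proof
    fix a assume a: "a \<in> A"
    have "f a = conjugate G \<one> (f a)" using fA a Bc by (simp add: subset_iff)
    then have "f a \<in> F"
      unfolding F_def using a subgroup.one_closed[OF V0(2)] by force
    then have "f a \<in> B0" by (simp add: B0_def generate.incl)
    moreover have "g a \<in> V0" using a by (simp add: V0_def generate.incl)
    ultimately have "f a \<otimes> g a \<in> P" by (auto simp: P_def)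
    then show "a \<in> P" using fg[OF a] by simp
  qed
  ultimately have "generate G A \<subseteq> P" by (simp add: generate_subgroup_incl)
  moreover have "finite P" using B0 V0 by (simp add: P_def)
  ultimately show ?thesis by (rule finite_subset)
qed

end

section \<open>Free groups and normal closures\<close>

lemma carrier_free_group: "w \<in> carrier (free_group S) \<longleftrightarrow> reduced w \<and> fst ` set w \<subseteq> S"
  by (simp add: free_group_def)

lemma mult_free_group: "u \<otimes>\<^bsub>free_group S\<^esub> v = foldr cancel_cons u v"
  by (simp add: free_group_def)

lemma one_free_group [simp]: "\<one>\<^bsub>free_group S\<^esub> = []"
  by (simp add: free_group_def)

lemma singleton_free_group [simp]: "[(a, b)] \<in> carrier (free_group S) \<longleftrightarrow> a \<in> S"
  by (simp add: free_group_def reduced_Cons)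

lemma Cons_free_group:
  assumes "l # w \<in> carrier (free_group S)"
  shows "[l] \<in> carrier (free_group S)" "w \<in> carrier (free_group S)"
    "l # w = [l] \<otimes>\<^bsub>free_group S\<^esub> w"
  using assms
  by (auto simp: carrier_free_group mult_free_group reduced_Cons cancel_cons_def)

lemma inv_singleton_free_group:
  assumes "a \<in> S"
  shows "inv\<^bsub>free_group S\<^esub> [(a, True)] = [(a, False)]"
proof -
  interpret F: group "free_group S" by (rule group_free_group)
  show ?thesis
    by (rule F.inv_equality)
      (use assms in \<open>auto simp: mult_free_group cancel_cons_def inv_letter_def\<close>)
qed

lemma generate_free_group:
  "generate (free_group S) ((\<lambda>a. [(a, True)]) ` S) = carrier (free_group S)" (is "?L = _")
proof -
  interpret F: group "free_group S" by (rule group_free_group)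
  have "w \<in> ?L" if "w \<in> carrier (free_group S)" for w
    using that
  proof (induction w)
    case Nil
    then show ?case using generate.one[of "free_group S"] by simp
  next
    case (Cons l w)
    obtain a b where l: "l = (a, b)" by (cases l)
    have a: "a \<in> S" using Cons_free_group(1)[OF Cons.prems] by (simp add: l)
    then have "[l] \<in> ?L"
      using generate.incl[of "[(a, True)]" "(\<lambda>a. [(a, True)]) ` S" "free_group S"]
        generate.inv[of "[(a, True)]" "(\<lambda>a. [(a, True)]) ` S" "free_group S"]
      by (cases b) (auto simp: l inv_singleton_free_group)
    then show ?case
      using Cons Cons_free_group[OF Cons.prems] generate.eng by metis
  qed
  moreover have "?L \<subseteq> carrier (free_group S)" by (rule F.generate_incl) auto
  ultimately show ?thesis by blast
qed

text \<open>The existence half of the universal property. It is needed beside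
  \<open>word_value\<close>, which evaluates a letter as the group element that it is and cannot
  send the letters of a foreign alphabet to chosen elements.\<close>

lemma (in group) free_group_extension:
  assumes f: "\<And>a. a \<in> S \<Longrightarrow> f a \<in> carrier G"
  obtains h where "h \<in> hom (free_group S) G" "\<And>a. a \<in> S \<Longrightarrow> h [(a, True)] = f a"
proof -
  define val where "val l = (if snd l then f (fst l) else inv f (fst l))" for l :: "'c \<times> bool"
  define h where "h w = foldr (\<lambda>l g. val l \<otimes> g) w \<one>" for w
  have val: "val l \<in> carrier G" if "fst l \<in> S" for l
    using that f by (auto simp: val_def)
  have cl: "h w \<in> carrier G" if "fst ` set w \<subseteq> S" for w
    using that by (induction w) (auto simp: h_def val)
  have inv: "val l \<otimes> (val (inv_letter l) \<otimes> g) = g" if "fst l \<in> S" "g \<in> carrier G" for l g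
    using that f by (simp add: val_def inv_letter_def)
  have cons: "h (cancel_cons l w) = val l \<otimes> h w" if "fst l \<in> S" "fst ` set w \<subseteq> S" for l w
    using that cl[of "tl w"] inv[of l "h (tl w)"]
    by (cases w) (auto simp: cancel_cons_def h_def)
  have "h (foldr cancel_cons u v) = h u \<otimes> h v"
    if "fst ` set u \<subseteq> S" "fst ` set v \<subseteq> S" for u v
    using that
  proof (induction u)
    case Nil
    then show ?case using cl[of v] by (simp add: h_def)
  next
    case (Cons l u)
    have sub: "fst ` set (foldr cancel_cons u v) \<subseteq> S"
      using Cons.prems set_foldr_cancel_cons[of u v] by fastforce
    have "h (foldr cancel_cons (l # u) v) = val l \<otimes> (h u \<otimes> h v)"
      using Cons cons[OF _ sub, of l] by simp
    also have "\<dots> = h (l # u) \<otimes> h v"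
      using Cons.prems cl[of u] cl[of v] val[of l] by (simp add: h_def m_assoc)
    finally show ?case .
  qed
  then have "h \<in> hom (free_group S) G"
    using cl by (auto simp: hom_def free_group_def)
  moreover have "h [(a, True)] = f a" if "a \<in> S" for a
    using that f by (simp add: h_def val_def)
  ultimately show thesis by (rule that)
qed

lemma free_group_hom_eq:
  assumes "group G" "h \<in> hom (free_group S) G" "k \<in> hom (free_group S) G"
    and "\<And>a. a \<in> S \<Longrightarrow> h [(a, True)] = k [(a, True)]" "w \<in> carrier (free_group S)"
  shows "h w = k w"
proof -
  interpret F: group "free_group S" by (rule group_free_group)
  interpret G: group G by fact
  interpret h: group_hom "free_group S" G h using assms by unfold_locales
  interpret k: group_hom "free_group S" G k using assms by unfold_locales
  have "w \<in> generate (free_group S) ((\<lambda>a. [(a, True)]) ` S)"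
    using assms(5) by (simp add: generate_free_group)
  then show ?thesis
  proof induction
    case (eng u v)
    then have "u \<in> carrier (free_group S)" "v \<in> carrier (free_group S)"
      by (simp_all add: generate_free_group)
    then show ?case using eng by simp
  next
    case one
    then show ?case using h.hom_one k.hom_one by simp
  qed (use assms(4) in auto)
qed

section \<open>Word length in free groups\<close>

lemma length_cancel_cons: "length (cancel_cons l w) \<le> Suc (length w)"
  by (auto simp: cancel_cons_def)

lemma length_mult_free_group:
  "length (u \<otimes>\<^bsub>free_group S\<^esub> v) \<le> length u + length v"
proof -
  have "length (foldr cancel_cons u v) \<le> length u + length v"
    by (induction u) (auto intro: order_trans[OF length_cancel_cons])
  then show ?thesis by (simp add: mult_free_group)
qed

lemma length_inv_free_group:
  assumes "u \<in> carrier (free_group S)"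
  shows "length (inv\<^bsub>free_group S\<^esub> u) \<le> length u"
proof -
  interpret F: group "free_group S" by (rule group_free_group)
  define v where "v = foldr cancel_cons (rev (map inv_letter u)) []"
  have "fst ` set v \<subseteq> fst ` set (rev (map inv_letter u))"
    using set_foldr_cancel_cons[of "rev (map inv_letter u)" "[]"] by (auto simp: v_def)
  also have "\<dots> \<subseteq> S" using assms by (auto simp: free_group_def)
  finally have v: "v \<in> carrier (free_group S)"
    by (simp add: free_group_def v_def reduced_foldr)
  have "v \<otimes>\<^bsub>free_group S\<^esub> u = \<one>\<^bsub>free_group S\<^esub>"
    using assms foldr_cancel_cons_rev[of "[]" u]
    by (simp add: free_group_def v_def foldr_cancel_cons_assoc foldr_cancel_cons_Nil)
  then have "inv\<^bsub>free_group S\<^esub> u = v" using v assms by (intro F.inv_equality)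
  then show ?thesis
    using length_mult_free_group[where S = S, of "rev (map inv_letter u)" "[]"]
    by (simp add: v_def mult_free_group)
qed

lemma length_conjugate_free_group:
  assumes "u \<in> carrier (free_group S)"
  shows "length (conjugate (free_group S) u v) \<le> 2 * length u + length v"
  using length_mult_free_group[of S "u \<otimes>\<^bsub>free_group S\<^esub> v" "inv\<^bsub>free_group S\<^esub> u"]
    length_mult_free_group[of S u v] length_inv_free_group[OF assms]
  unfolding conjugate_def by linarith

lemma length_commutator_free_group:
  assumes "u \<in> carrier (free_group S)" "v \<in> carrier (free_group S)"
  shows "length (commutator (free_group S) u v) \<le> 2 * length u + 2 * length v"
  using length_mult_free_group[of S "u \<otimes>\<^bsub>free_group S\<^esub> v \<otimes>\<^bsub>free_group S\<^esub> inv\<^bsub>free_group S\<^esub> u" "inv\<^bsub>free_group S\<^esub> v"]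
    length_mult_free_group[of S "u \<otimes>\<^bsub>free_group S\<^esub> v" "inv\<^bsub>free_group S\<^esub> u"]
    length_mult_free_group[of S u v] assms[THEN length_inv_free_group]
  unfolding commutator_def by linarith

lemma length_pow_free_group:
  "length (u [^]\<^bsub>free_group S\<^esub> (n::nat)) \<le> n * length u"
proof (induction n)
  case (Suc n)
  interpret F: group "free_group S" by (rule group_free_group)
  show ?case
    using Suc length_mult_free_group[of S "u [^]\<^bsub>free_group S\<^esub> n" u] by simp
qed (simp add: nat_pow_def)

section \<open>Normal closures\<close>

context group
begin

lemma normal_normal_closure:
  assumes "A \<subseteq> carrier G"
  shows "normal_closure G A \<lhd> G"
proof (rule normalI_conjugate)
  have "carrier G \<lhd> G" by (rule normal_self)
  then have ne: "{H. H \<lhd> G \<and> A \<subseteq> H} \<noteq> {}" using assms by blast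
  show "subgroup (normal_closure G A) G"
    unfolding normal_closure_def by (rule subgroups_Inter[OF _ ne]) (auto dest: normal_imp_subgroup)
  show "conjugate G u a \<in> normal_closure G A"
    if "u \<in> carrier G" "a \<in> normal_closure G A" for u a
    using that by (auto simp: normal_closure_def intro: normal_conjugate)
qed

lemma normal_closure_minimal: "H \<lhd> G \<Longrightarrow> A \<subseteq> H \<Longrightarrow> normal_closure G A \<subseteq> H"
  by (auto simp: normal_closure_def)

lemma normal_closure_incl: "A \<subseteq> normal_closure G A"
  by (auto simp: normal_closure_def)

lemma normal_closure_mono: "A \<subseteq> B \<Longrightarrow> normal_closure G A \<subseteq> normal_closure G B"
  by (auto simp: normal_closure_def)

end

context group_hom
begin

lemma hom_conjugate:
  "u \<in> carrier G \<Longrightarrow> a \<in> carrier G \<Longrightarrow> h (conjugate G u a) = conjugate H (h u) (h a)"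
  by (simp add: conjugate_def)

lemma hom_commutator:
  "a \<in> carrier G \<Longrightarrow> b \<in> carrier G \<Longrightarrow> h (commutator G a b) = commutator H (h a) (h b)"
  by (simp add: commutator_def)

lemma normal_vimage:
  assumes "M \<lhd> H"
  shows "{w \<in> carrier G. h w \<in> M} \<lhd> G"
proof (rule G.normalI_conjugate)
  interpret M: normal M H by fact
  show "subgroup {w \<in> carrier G. h w \<in> M} G" by unfold_locales auto
  show "conjugate G u a \<in> {w \<in> carrier G. h w \<in> M}"
    if "u \<in> carrier G" "a \<in> {w \<in> carrier G. h w \<in> M}" for u a
    using that assms by (auto simp: hom_conjugate intro: H.normal_conjugate)
qed

lemma hom_normal_closure:
  assumes "M \<lhd> H" "h ` A \<subseteq> M" "A \<subseteq> carrier G" "w \<in> normal_closure G A"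
  shows "h w \<in> M"
  using G.normal_closure_minimal[OF normal_vimage[OF assms(1)]] assms by blast

end

section \<open>A finitely presented group\<close>

text \<open>\<open>Gp\<close>, \<open>Gq\<close>, \<open>Gr\<close>, \<open>Gs\<close> are for the
  torus and \<open>Gx\<close>, \<open>Gy\<close>, \<open>Gz\<close> for the three superdiagonal
  entries; entries further from the diagonal arise as commutators. Each of the two inner diagonal
  entries gets two torus generators, one for the unit t and one for 1 + t.\<close>

datatype gen = Gp | Gq | Gr | Gs | Gx | Gy | Gz

lemma UNIV_gen: "UNIV = {Gp, Gq, Gr, Gs, Gx, Gy, Gz}"
  using gen.exhaust by blast

text \<open>
  When \<open>p\<close> acts on \<open>x\<close> as \<open>t\<close>, the last three relators say that \<open>q\<close> acts on \<open>x\<close> as \<open>1 + t\<close>,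
  and likewise for \<open>p\<^sup>-\<^sup>1, q\<^sup>-\<^sup>1\<close> on \<open>y\<close> and \<open>r, s\<close> on \<open>z\<close>.
\<close>

definition relators :: "('a, 'b) monoid_scheme \<Rightarrow> (gen \<Rightarrow> 'a) \<Rightarrow> 'a set" where
  "relators G f =
    (let p = f Gp; q = f Gq; r = f Gr; s = f Gs; x = f Gx; y = f Gy; z = f Gz;
         e = commutator G x y; g = commutator G y z;
         p' = inv\<^bsub>G\<^esub> p; q' = inv\<^bsub>G\<^esub> q
     in (\<lambda>(a, b). commutator G a b) `
          {(p, q), (p, r), (p, s), (q, r), (q, s), (r, s),
           (r, x), (s, x), (p \<otimes>\<^bsub>G\<^esub> inv\<^bsub>G\<^esub> r, y), (q \<otimes>\<^bsub>G\<^esub> inv\<^bsub>G\<^esub> s, y), (p, z), (q, z),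
           (p, e), (q, e), (r, g), (s, g),
           (x, conjugate G p x), (y, conjugate G p' y), (z, conjugate G r z),
           (x, z), (e, x), (e, y), (g, y), (g, z), (e, g)}
        \<union> {x \<otimes>\<^bsub>G\<^esub> x, y \<otimes>\<^bsub>G\<^esub> y, z \<otimes>\<^bsub>G\<^esub> z}
        \<union> {conjugate G q x \<otimes>\<^bsub>G\<^esub> inv\<^bsub>G\<^esub> (x \<otimes>\<^bsub>G\<^esub> conjugate G p x),
           conjugate G q' y \<otimes>\<^bsub>G\<^esub> inv\<^bsub>G\<^esub> (y \<otimes>\<^bsub>G\<^esub> conjugate G p' y),
           conjugate G s z \<otimes>\<^bsub>G\<^esub> inv\<^bsub>G\<^esub> (z \<otimes>\<^bsub>G\<^esub> conjugate G r z)})"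

text \<open>Stated for any group with generators satisfying the relators, because it is applied to
  the final group and also to quotients in which only some of the central elements have been
  killed.\<close>

locale abels = group G for G (structure) +
  fixes f :: "gen \<Rightarrow> 'a"
  assumes f_closed [simp, intro]: "f a \<in> carrier G"
    and generate_f: "generate G (range f) = carrier G"
    and relators_one: "relators G f \<subseteq> {\<one>}"
begin

abbreviation "p \<equiv> f Gp"
abbreviation "q \<equiv> f Gq"
abbreviation "r \<equiv> f Gr"
abbreviation "s \<equiv> f Gs"
abbreviation "x \<equiv> f Gx"
abbreviation "y \<equiv> f Gy"
abbreviation "z \<equiv> f Gz"
abbreviation "e \<equiv> commutator G x y"
abbreviation "g \<equiv> commutator G y z"

lemma relations:
  "commutes p q" "commutes p r" "commutes p s" "commutes q r" "commutes q s" "commutes r s"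
  "commutes r x" "commutes s x" "commutes (p \<otimes> inv r) y" "commutes (q \<otimes> inv s) y"
  "commutes p z" "commutes q z" "commutes p e" "commutes q e" "commutes r g" "commutes s g"
  "commutes x (conjugate G p x)" "commutes y (conjugate G (inv p) y)"
  "commutes z (conjugate G r z)"
  "commutes x z" "commutes e x" "commutes e y" "commutes g y" "commutes g z" "commutes e g"
proof -
  have *: "commutes a b"
    if "commutator G a b \<in> relators G f" "a \<in> carrier G" "b \<in> carrier G" for a b
    using that relators_one by (auto simp flip: commutator_eq_one_iff)
  show
    "commutes p q" "commutes p r" "commutes p s" "commutes q r" "commutes q s" "commutes r s"
    "commutes r x" "commutes s x" "commutes (p \<otimes> inv r) y" "commutes (q \<otimes> inv s) y"
    "commutes p z" "commutes q z" "commutes p e" "commutes q e" "commutes r g" "commutes s g"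
    "commutes x (conjugate G p x)" "commutes y (conjugate G (inv p) y)"
    "commutes z (conjugate G r z)"
    "commutes x z" "commutes e x" "commutes e y" "commutes g y" "commutes g z" "commutes e g"
    by (rule *; simp add: relators_def Let_def)+
qed

lemma involutions: "x \<otimes> x = \<one>" "y \<otimes> y = \<one>" "z \<otimes> z = \<one>"
  using relators_one by (auto simp: relators_def Let_def)

lemma unipotent_action:
  "conjugate G q x = x \<otimes> conjugate G p x"
  "conjugate G (inv q) y = y \<otimes> conjugate G (inv p) y"
  "conjugate G s z = z \<otimes> conjugate G r z"
proof -
  have *: "a = b" if "a \<otimes> inv b \<in> relators G f" "a \<in> carrier G" "b \<in> carrier G" for a b
    using that relators_one by (metis inv_solve_right' l_one one_closed singletonD subsetD)
  show
    "conjugate G q x = x \<otimes> conjugate G p x"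
    "conjugate G (inv q) y = y \<otimes> conjugate G (inv p) y"
    "conjugate G s z = z \<otimes> conjugate G r z"
    by (rule *; simp add: relators_def Let_def)+
qed

section \<open>The torus and its three rank-two subgroups\<close>

definition "T = generate G {p, q, r, s}"
text \<open>In matrices, conjugation by a diagonal matrix scales the entry in row i and column k by
  the quotient of the diagonal entries i and k. With diagonal (1, a, b, 1), \<open>T1\<close> (b =
  1) fixes \<open>z\<close> and \<open>e\<close>, \<open>T2\<close> (a = 1) fixes \<open>x\<close>
  and \<open>g\<close>, and \<open>T3\<close> (a = b) fixes \<open>y\<close>.\<close>

definition "T1 = generate G {p, q}"
definition "T2 = generate G {r, s}"
definition "T3 = generate G {p \<otimes> inv r, q \<otimes> inv s}"

lemma T_subgroup: "subgroup T G" and T_subset: "T \<subseteq> carrier G"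
  using generate_is_subgroup[of "{p, q, r, s}"] by (simp_all add: T_def subgroup.subset)

lemma T_gens: "p \<in> T" "q \<in> T" "r \<in> T" "s \<in> T"
  by (auto simp: T_def intro: generate.incl)

lemma T_inv: "u \<in> T \<Longrightarrow> inv u \<in> T"
  using T_subgroup by (rule subgroup.m_inv_closed)

lemma T_mult: "u \<in> T \<Longrightarrow> v \<in> T \<Longrightarrow> u \<otimes> v \<in> T"
  using T_subgroup by (rule subgroup.m_closed)

lemma T_commutes: "u \<in> T \<Longrightarrow> v \<in> T \<Longrightarrow> commutes u v"
  unfolding T_def
  by (rule commutes_generate[of "{p, q, r, s}" "{p, q, r, s}"]) (use relations in auto)

lemma T_closed [simp]: "u \<in> T \<Longrightarrow> u \<in> carrier G"
  using T_subset by blast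

lemma T_sub: "T1 \<subseteq> T" "T2 \<subseteq> T" "T3 \<subseteq> T"
  unfolding T1_def T2_def T3_def
  by (intro generate_subgroup_incl T_subgroup; use T_gens T_inv T_mult in auto)+

lemma factor:
  assumes "A \<subseteq> T" "B \<subseteq> T" "{p, q, r, s} \<subseteq> generate G (A \<union> B)" "u \<in> T"
  shows "\<exists>m\<in>generate G A. \<exists>n\<in>generate G B. u = m \<otimes> n"
proof (rule generate_Un_commuting)
  show "A \<subseteq> carrier G" "B \<subseteq> carrier G" using assms T_subset by blast+
  then have "generate G {p, q, r, s} \<subseteq> generate G (A \<union> B)"
    using assms by (intro generate_subset_generate) auto
  then show "u \<in> generate G (A \<union> B)" using assms by (auto simp: T_def)
qed (use assms T_commutes in blast)

text \<open>\<open>r\<close> is recovered from \<open>p\<close> and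
  \<open>p \<otimes> inv r\<close>, and \<open>s\<close> likewise, so any two of the three subgroups
  generate the commutative group \<open>T\<close>.\<close>

lemma factor_T:
  assumes "u \<in> T"
  shows "\<exists>m\<in>T1. \<exists>n\<in>T2. u = m \<otimes> n" "\<exists>m\<in>T2. \<exists>n\<in>T1. u = m \<otimes> n"
    "\<exists>m\<in>T1. \<exists>n\<in>T3. u = m \<otimes> n" "\<exists>m\<in>T3. \<exists>n\<in>T1. u = m \<otimes> n"
    "\<exists>m\<in>T2. \<exists>n\<in>T3. u = m \<otimes> n"
proof -
  have sub: "{p, q} \<subseteq> T" "{r, s} \<subseteq> T" "{p \<otimes> inv r, q \<otimes> inv s} \<subseteq> T"
    using T_gens T_inv T_mult by auto
  have 12: "{p, q, r, s} \<subseteq> generate G ({p, q} \<union> {r, s})"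
    by (auto intro: generate.incl)
  have 13: "{p, q, r, s} \<subseteq> generate G ({p, q} \<union> {p \<otimes> inv r, q \<otimes> inv s})" (is "_ \<subseteq> ?L")
  proof -
    have L: "subgroup ?L G" by (rule generate_is_subgroup) auto
    have "p \<in> ?L" "q \<in> ?L" "p \<otimes> inv r \<in> ?L" "q \<otimes> inv s \<in> ?L" by (auto intro: generate.incl)
    then have "inv (p \<otimes> inv r) \<otimes> p \<in> ?L" "inv (q \<otimes> inv s) \<otimes> q \<in> ?L"
      using L by (auto intro!: subgroup.m_closed subgroup.m_inv_closed)
    then show ?thesis
      using \<open>p \<in> ?L\<close> \<open>q \<in> ?L\<close> by (simp add: inv_mult_group m_assoc)
  qed
  have 23: "{p, q, r, s} \<subseteq> generate G ({r, s} \<union> {p \<otimes> inv r, q \<otimes> inv s})" (is "_ \<subseteq> ?L")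
  proof -
    have L: "subgroup ?L G" by (rule generate_is_subgroup) auto
    have "r \<in> ?L" "s \<in> ?L" "p \<otimes> inv r \<in> ?L" "q \<otimes> inv s \<in> ?L" by (auto intro: generate.incl)
    then have "(p \<otimes> inv r) \<otimes> r \<in> ?L" "(q \<otimes> inv s) \<otimes> s \<in> ?L"
      using L by (auto intro!: subgroup.m_closed)
    then show ?thesis
      using \<open>r \<in> ?L\<close> \<open>s \<in> ?L\<close> by (simp add: m_assoc)
  qed
  show "\<exists>m\<in>T1. \<exists>n\<in>T2. u = m \<otimes> n" "\<exists>m\<in>T2. \<exists>n\<in>T1. u = m \<otimes> n"
    "\<exists>m\<in>T1. \<exists>n\<in>T3. u = m \<otimes> n" "\<exists>m\<in>T3. \<exists>n\<in>T1. u = m \<otimes> n"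
    "\<exists>m\<in>T2. \<exists>n\<in>T3. u = m \<otimes> n"
    unfolding T1_def T2_def T3_def
    using factor[OF sub(1,2) 12 assms] factor[OF sub(2,1) _ assms] 12
      factor[OF sub(1,3) 13 assms] factor[OF sub(3,1) _ assms] 13 factor[OF sub(2,3) 23 assms]
    by (simp_all add: Un_commute)
qed

lemma fixed:
  "n \<in> T2 \<Longrightarrow> conjugate G n x = x" "n \<in> T3 \<Longrightarrow> conjugate G n y = y"
  "n \<in> T1 \<Longrightarrow> conjugate G n z = z"
  "n \<in> T1 \<Longrightarrow> conjugate G n e = e" "n \<in> T2 \<Longrightarrow> conjugate G n g = g"
proof -
  have *: "conjugate G n a = a"
    if "n \<in> generate G A" "A \<subseteq> T" "\<And>t. t \<in> A \<Longrightarrow> commutes t a" "a \<in> carrier G" for n a A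
  proof -
    have "A \<subseteq> carrier G" using that T_subset by blast
    then show ?thesis
      using commutes_generate[of A "{a}" n a] that generate_in_carrier[of A n]
      by (auto simp: conjugate_eq_iff_commutes generate.incl)
  qed
  have sub: "{p, q} \<subseteq> T" "{r, s} \<subseteq> T" "{p \<otimes> inv r, q \<otimes> inv s} \<subseteq> T"
    using T_gens T_inv T_mult by auto
  show "n \<in> T2 \<Longrightarrow> conjugate G n x = x" "n \<in> T3 \<Longrightarrow> conjugate G n y = y"
    "n \<in> T1 \<Longrightarrow> conjugate G n z = z"
    "n \<in> T1 \<Longrightarrow> conjugate G n e = e" "n \<in> T2 \<Longrightarrow> conjugate G n g = g"
    unfolding T1_def T2_def T3_def
    by (erule *; use sub relations in auto)+
qed

section \<open>Torus orbits of the root elements\<close>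

definition "X = orbit G T x"
definition "Y = orbit G T y"
definition "Z = orbit G T z"
definition "E13 = orbit G T e"
definition "E24 = orbit G T g"
text \<open>Corner elements do not form a single torus orbit, since the torus fixes each of them;
  hence all pairs from \<open>X\<close> and \<open>E24\<close> are taken.\<close>

definition "E14 = (\<lambda>(a, b). commutator G a b) ` (X \<times> E24)"

lemmas orbit_defs = X_def Y_def Z_def E13_def E24_def

lemma orbit_closed [simp]:
  "a \<in> X \<Longrightarrow> a \<in> carrier G" "a \<in> Y \<Longrightarrow> a \<in> carrier G" "a \<in> Z \<Longrightarrow> a \<in> carrier G"
  "a \<in> E13 \<Longrightarrow> a \<in> carrier G" "a \<in> E24 \<Longrightarrow> a \<in> carrier G"
  unfolding orbit_defs by (erule subsetD[OF orbit_subset_carrier[OF T_subset], rotated]; simp)+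

lemma E14_closed [simp]: "a \<in> E14 \<Longrightarrow> a \<in> carrier G"
  by (auto simp: E14_def)

lemma orbit_gens: "x \<in> X" "y \<in> Y" "z \<in> Z" "e \<in> E13" "g \<in> E24"
  unfolding orbit_defs by (auto intro: orbit_self T_subgroup)

lemma conjugate_T:
  assumes "u \<in> T"
  shows "a \<in> X \<Longrightarrow> conjugate G u a \<in> X" "a \<in> Y \<Longrightarrow> conjugate G u a \<in> Y"
    "a \<in> Z \<Longrightarrow> conjugate G u a \<in> Z" "a \<in> E13 \<Longrightarrow> conjugate G u a \<in> E13"
    "a \<in> E24 \<Longrightarrow> conjugate G u a \<in> E24"
  unfolding orbit_defs using assms T_subgroup by (auto intro: conjugate_orbit)

text \<open>The pairs listed are those fixed by different groups among \<open>T1\<close>,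
  \<open>T2\<close>, \<open>T3\<close>. The two pairs of root elements left out, \<open>e\<close>
  with \<open>z\<close> and \<open>x\<close> with \<open>g\<close>, are each fixed by one and the
  same group; their commutators are the ones that produce \<open>E14\<close>.\<close>

lemma simultaneous:
  "a \<in> X \<Longrightarrow> b \<in> Y \<Longrightarrow> \<exists>u\<in>T. a = conjugate G u x \<and> b = conjugate G u y"
  "a \<in> X \<Longrightarrow> b \<in> Z \<Longrightarrow> \<exists>u\<in>T. a = conjugate G u x \<and> b = conjugate G u z"
  "a \<in> Y \<Longrightarrow> b \<in> Z \<Longrightarrow> \<exists>u\<in>T. a = conjugate G u y \<and> b = conjugate G u z"
  "a \<in> E13 \<Longrightarrow> b \<in> X \<Longrightarrow> \<exists>u\<in>T. a = conjugate G u e \<and> b = conjugate G u x"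
  "a \<in> E13 \<Longrightarrow> b \<in> Y \<Longrightarrow> \<exists>u\<in>T. a = conjugate G u e \<and> b = conjugate G u y"
  "a \<in> E24 \<Longrightarrow> b \<in> Y \<Longrightarrow> \<exists>u\<in>T. a = conjugate G u g \<and> b = conjugate G u y"
  "a \<in> E24 \<Longrightarrow> b \<in> Z \<Longrightarrow> \<exists>u\<in>T. a = conjugate G u g \<and> b = conjugate G u z"
  "a \<in> E13 \<Longrightarrow> b \<in> E24 \<Longrightarrow> \<exists>u\<in>T. a = conjugate G u e \<and> b = conjugate G u g"
  unfolding orbit_defs
  by (rule simultaneous_conjugate[OF T_subgroup], simp, simp,
      erule factor_T, rule T_sub, rule T_sub, erule fixed, erule fixed, assumption, assumption)+

lemma commutes_orbits:
  "a \<in> X \<Longrightarrow> b \<in> Z \<Longrightarrow> commutes a b"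
  "a \<in> E13 \<Longrightarrow> b \<in> X \<Longrightarrow> commutes a b"
  "a \<in> E13 \<Longrightarrow> b \<in> Y \<Longrightarrow> commutes a b"
  "a \<in> E24 \<Longrightarrow> b \<in> Y \<Longrightarrow> commutes a b"
  "a \<in> E24 \<Longrightarrow> b \<in> Z \<Longrightarrow> commutes a b"
  "a \<in> E13 \<Longrightarrow> b \<in> E24 \<Longrightarrow> commutes a b"
  by (frule (1) simultaneous; clarify;
      rule commutes_conjugate; simp add: relations)+

lemma commutator_XY: "a \<in> X \<Longrightarrow> b \<in> Y \<Longrightarrow> commutator G a b \<in> E13"
  by (frule (1) simultaneous(1)) (auto simp: E13_def orbit_def simp flip: conjugate_commutator)

lemma commutator_YZ: "a \<in> Y \<Longrightarrow> b \<in> Z \<Longrightarrow> commutator G a b \<in> E24"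
  by (frule (1) simultaneous(3)) (auto simp: E24_def orbit_def simp flip: conjugate_commutator)

text \<open>As \<open>T2\<close> fixes \<open>x\<close>, the orbit of \<open>x\<close> under
  \<open>T\<close> is already its orbit under \<open>T1\<close>, where \<open>p\<close> and
  \<open>q\<close> act as t and 1 + t. For \<open>y\<close> the group is again \<open>T1\<close>,
  but with \<open>inv p\<close> and \<open>inv q\<close> in these roles; for \<open>z\<close> it is
  \<open>T2\<close> with \<open>r\<close> and \<open>s\<close>.\<close>

lemma commutes_same_orbit:
  "a \<in> X \<Longrightarrow> b \<in> X \<Longrightarrow> commutes a b"
  "a \<in> Y \<Longrightarrow> b \<in> Y \<Longrightarrow> commutes a b"
  "a \<in> Z \<Longrightarrow> b \<in> Z \<Longrightarrow> commutes a b"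
proof -
  have *: "orbit G T a \<subseteq> orbit G S a"
    if fac: "\<And>u. u \<in> T \<Longrightarrow> \<exists>m\<in>S. \<exists>n\<in>S'. u = m \<otimes> n" and "S \<subseteq> T" "S' \<subseteq> T"
      and fix': "\<And>n. n \<in> S' \<Longrightarrow> conjugate G n a = a" and a: "a \<in> carrier G" for a S S'
  proof
    fix b assume "b \<in> orbit G T a"
    then obtain u where u: "u \<in> T" "b = conjugate G u a" by (auto simp: orbit_def)
    then obtain m n where mn: "m \<in> S" "n \<in> S'" "u = m \<otimes> n" using fac by blast
    then have "m \<in> carrier G" "n \<in> carrier G" using that T_subset by blast+
    then have "b = conjugate G m a" using u mn a fix' by (simp add: conjugate_mult_left)
    then show "b \<in> orbit G S a" using mn by (simp add: orbit_def)
  qed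
  have inv: "T1 \<subseteq> generate G {inv p, inv q}"
    unfolding T1_def
  proof (rule generate_subset_generate)
    have "inv (inv p) \<in> generate G {inv p, inv q}" "inv (inv q) \<in> generate G {inv p, inv q}"
      by (rule generate.inv, simp)+
    then show "{p, q} \<subseteq> generate G {inv p, inv q}" by simp
  qed simp
  have "X \<subseteq> orbit G (generate G {p, q}) x"
    unfolding X_def T1_def[symmetric]
    by (rule *[OF factor_T(1) T_sub(1,2) fixed(1)]) auto
  then show "a \<in> X \<Longrightarrow> b \<in> X \<Longrightarrow> commutes a b"
    using commutes_orbit[of x p q a b] relations unipotent_action by auto
  have "Y \<subseteq> orbit G T1 y"
    unfolding Y_def by (rule *[OF factor_T(3) T_sub(1,3) fixed(2)]) auto
  also have "\<dots> \<subseteq> orbit G (generate G {inv p, inv q}) y"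
    using inv by (auto simp: orbit_def)
  finally show "a \<in> Y \<Longrightarrow> b \<in> Y \<Longrightarrow> commutes a b"
    using commutes_orbit[of y "inv p" "inv q" a b] relations unipotent_action
      T_commutes[OF T_inv T_inv, of p q] T_gens by auto
  have "Z \<subseteq> orbit G (generate G {r, s}) z"
    unfolding Z_def T2_def[symmetric]
    by (rule *[OF factor_T(2) T_sub(2,1) fixed(3)]) auto
  then show "a \<in> Z \<Longrightarrow> b \<in> Z \<Longrightarrow> commutes a b"
    using commutes_orbit[of z r s a b] relations unipotent_action by auto
qed

section \<open>Centrality of the corner commutators\<close>

lemma commutes_commutator:
  assumes "a \<in> carrier G" "b \<in> carrier G" "d \<in> carrier G" "commutes a d" "commutes b d"
  shows "commutes (commutator G a b) d"
  unfolding commutator_def using assms by (intro commutes_mult commutes_inv) simp_all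

lemma commutator_eq:
  assumes a: "a \<in> X" and b: "b \<in> Y" and c: "c \<in> Z"
  shows "commutator G a (commutator G b c) = commutator G (commutator G a b) c"
  using assms commutator_XY[OF a b] commutator_YZ[OF b c]
  by (intro commutator_commutator commutes_orbits) simp_all

lemma central_generate:
  assumes "c \<in> carrier G" "\<And>a. commutes c (f a)" "u \<in> carrier G"
  shows "commutes c u"
  by (rule commutes_generate[of "{c}" "range f"]) (use assms generate_f in \<open>auto intro: generate.incl\<close>)

text \<open>Up to torus conjugation \<open>c\<close> is \<open>d = [x, g']\<close> with
  \<open>g'\<close> a torus translate of \<open>g\<close>, and \<open>d\<close> is also
  \<open>[e', z]\<close>. The first form is fixed by \<open>T2\<close> and commutes with
  \<open>Z\<close> and \<open>E13\<close>; the second is fixed by \<open>T1\<close> and commutes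
  with \<open>X\<close>. Only \<open>y\<close> takes an extra argument.\<close>

lemma E14_central:
  assumes c: "c \<in> E14" and u: "u \<in> carrier G"
  shows "commutes c u"
proof -
  obtain a b where ab: "a \<in> X" "b \<in> E24" "c = commutator G a b" using c by (auto simp: E14_def)
  obtain u v where uv: "u \<in> T" "v \<in> T" "a = conjugate G u x" "b = conjugate G v g"
    using ab by (auto simp: orbit_defs orbit_def)
  \<comment> \<open>In the factorization \<open>m \<otimes> n\<close> of this element,
    \<open>n\<close> fixes \<open>g\<close>, so \<open>b\<close> is the conjugate of
    \<open>g'\<close> by \<open>u\<close>; and \<open>m\<close> fixes \<open>z\<close>, so
    \<open>g'\<close> is still a commutator with \<open>z\<close> itself.\<close>
  have "inv u \<otimes> v \<in> T" using uv T_mult T_inv by blast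
  then obtain m n where mn: "m \<in> T1" "n \<in> T2" "inv u \<otimes> v = m \<otimes> n" using factor_T(1) by blast
  then have mT: "m \<in> T" "n \<in> T" using T_sub by blast+
  define y' g' e' where "y' = conjugate G m y" and "g' = commutator G y' z"
    and "e' = commutator G x y'"
  have y': "y' \<in> Y" unfolding y'_def using conjugate_T mT orbit_gens by blast
  have g': "g' \<in> E24" unfolding g'_def using commutator_YZ y' orbit_gens by blast
  have e': "e' \<in> E13" unfolding e'_def using commutator_XY y' orbit_gens by blast
  have g'_eq: "g' = conjugate G m g"
    using mT fixed(3)[OF mn(1)] by (simp add: g'_def y'_def conjugate_commutator)
  define d where "d = commutator G x g'"
  have d_eq: "d = commutator G e' z"
    unfolding d_def g'_def e'_def using commutator_eq y' orbit_gens by blast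
  note cl [simp] = orbit_closed(2)[OF y'] orbit_closed(5)[OF g'] orbit_closed(4)[OF e']
  have [simp]: "d \<in> carrier G" by (simp add: d_def)
  have dX: "commutes d a" if "a \<in> X" for a
    unfolding d_eq using that e' orbit_gens
    by (intro commutes_commutator commutes_orbits commutes_orbits(1)[symmetric]) simp_all
  have dZ: "commutes d a" if "a \<in> Z" for a
    unfolding d_def using that g' orbit_gens
    by (intro commutes_commutator commutes_orbits) simp_all
  have dE: "commutes d a" if "a \<in> E13" for a
    unfolding d_def using that g' orbit_gens
    by (intro commutes_commutator commutes_orbits(2,6)[symmetric]) simp_all
  \<comment> \<open>Conjugating the relation between \<open>g'\<close> and \<open>y\<close> by
    \<open>x\<close> replaces them by \<open>d \<otimes> g'\<close> and
    \<open>e \<otimes> y\<close>. Then \<open>e\<close> is stripped off because it commutes with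
    \<open>d \<otimes> g'\<close>, and \<open>g'\<close> because it commutes with
    \<open>y\<close>.\<close>
  have dy: "commutes d y"
  proof -
    have "commutes (conjugate G x g') (conjugate G x y)"
      using g' orbit_gens by (intro commutes_conjugate commutes_orbits) simp_all
    then have 1: "commutes (d \<otimes> g') (e \<otimes> y)"
      by (simp add: conjugate_eq_commutator d_def)
    have 2: "commutes (d \<otimes> g') e"
      using dE[OF orbit_gens(4)] commutes_orbits(6)[OF orbit_gens(4) g']
      by (intro commutes_mult) simp_all
    have "commutes (inv e \<otimes> (e \<otimes> y)) (d \<otimes> g')"
      using 1 2 by (intro commutes_mult[of "inv e" "e \<otimes> y"] commutes_inv) simp_all
    then have "commutes (d \<otimes> g') y" by simp
    then have "commutes ((d \<otimes> g') \<otimes> inv g') y"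
      using commutes_orbits(4)[OF g' orbit_gens(2)]
      by (intro commutes_mult[of "d \<otimes> g'" "inv g'"] commutes_inv) simp_all
    then show ?thesis by (simp add: m_assoc)
  qed
  have d1: "conjugate G w d = d" if w: "w \<in> T1" for w
  proof -
    have wT: "w \<in> T" using w T_sub by blast
    obtain k where k: "k \<in> T" "e' = conjugate G k e" using e' by (auto simp: E13_def orbit_def)
    then have "conjugate G w e' = conjugate G k (conjugate G w e)"
      using wT T_commutes by (simp flip: conjugate_mult_left)
    then have "conjugate G w e' = e'" using fixed(4)[OF w] k by simp
    then show ?thesis
      using wT fixed(3)[OF w] by (simp add: d_eq conjugate_commutator)
  qed
  have d2: "conjugate G w d = d" if w: "w \<in> T2" for w
  proof -
    have wT: "w \<in> T" using w T_sub by blast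
    have "conjugate G w g' = conjugate G m (conjugate G w g)"
      using wT mT T_commutes by (simp add: g'_eq flip: conjugate_mult_left)
    then have "conjugate G w g' = g'" using fixed(5)[OF w] by (simp add: g'_eq)
    then show ?thesis
      using wT fixed(1)[OF w] by (simp add: d_def conjugate_commutator)
  qed
  have central: "commutes d w" if "w \<in> carrier G" for w
  proof (rule central_generate[OF _ _ that])
    fix a
    have "commutes (f t) d" if "t \<in> {Gp, Gq}" for t
      using d1[of "f t"] that by (auto simp: conjugate_eq_iff_commutes T1_def generate.incl)
    moreover have "commutes (f t) d" if "t \<in> {Gr, Gs}" for t
      using d2[of "f t"] that by (auto simp: conjugate_eq_iff_commutes T2_def generate.incl)
    ultimately show "commutes d (f a)"
      using dX[OF orbit_gens(1)] dy dZ[OF orbit_gens(3)] by (cases a) auto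
  qed simp
  have "v = u \<otimes> (inv u \<otimes> v)" using uv by simp
  then have v: "v = u \<otimes> (m \<otimes> n)" using mn by simp
  have "conjugate G v g = conjugate G u (conjugate G m (conjugate G n g))"
    unfolding v using uv mT by (simp add: conjugate_mult_left)
  then have "b = conjugate G u g'" using uv fixed(5)[OF mn(2)] g'_eq by simp
  then have "c = conjugate G u d"
    using ab uv by (simp add: d_def conjugate_commutator)
  also have "\<dots> = d"
    using central[of u] uv by (simp add: conjugate_eq_iff_commutes)
  finally show ?thesis using central assms(2) by simp
qed

section \<open>Local finiteness of \<open>N\<close>\<close>

lemma involutions_orbits:
  "a \<in> X \<Longrightarrow> a \<otimes> a = \<one>" "a \<in> Y \<Longrightarrow> a \<otimes> a = \<one>" "a \<in> Z \<Longrightarrow> a \<otimes> a = \<one>"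
  "a \<in> E13 \<Longrightarrow> a \<otimes> a = \<one>" "a \<in> E24 \<Longrightarrow> a \<otimes> a = \<one>"
proof -
  have *: "b \<otimes> b = \<one>" if "b \<in> orbit G T a" "a \<in> carrier G" "a \<otimes> a = \<one>" for a b
    using that by (auto simp: orbit_def simp flip: conjugate_mult)
  have "e \<otimes> e = \<one>" by (rule commutator_square) (simp_all add: involutions relations)
  moreover have "g \<otimes> g = \<one>" by (rule commutator_square) (simp_all add: involutions relations)
  ultimately show "a \<in> X \<Longrightarrow> a \<otimes> a = \<one>" "a \<in> Y \<Longrightarrow> a \<otimes> a = \<one>" "a \<in> Z \<Longrightarrow> a \<otimes> a = \<one>"
    "a \<in> E13 \<Longrightarrow> a \<otimes> a = \<one>" "a \<in> E24 \<Longrightarrow> a \<otimes> a = \<one>"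
    using involutions unfolding orbit_defs by (auto intro: *)
qed

lemma E14_involution:
  assumes "c \<in> E14"
  shows "c \<otimes> c = \<one>"
proof -
  obtain a b where "a \<in> X" "b \<in> E24" "c = commutator G a b" using assms by (auto simp: E14_def)
  then show ?thesis
    using commutator_square[of a b] E14_central[OF assms, of a] involutions_orbits(1)[of a] by simp
qed

text \<open>In the matrix picture \<open>B\<close> is the upper right two by two block and
  \<open>V\<close> consists of the two unipotent diagonal blocks. Both are commutative of exponent
  two, and \<open>N\<close> is their product with \<open>B\<close> normal.\<close>

definition "B = generate G (Y \<union> E13 \<union> E24 \<union> E14)"
definition "V = generate G (X \<union> Z)"
definition "N = generate G (X \<union> Y \<union> Z)"

lemma B_gens_closed: "Y \<union> E13 \<union> E24 \<union> E14 \<subseteq> carrier G"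
  and V_gens_closed: "X \<union> Z \<subseteq> carrier G"
  and N_gens_closed: "X \<union> Y \<union> Z \<subseteq> carrier G"
  by auto

lemma commutes_E13_E13:
  assumes a: "a \<in> E13" and b: "b \<in> E13"
  shows "commutes a b"
proof -
  obtain u where u: "u \<in> T" "a = conjugate G u e" using a by (auto simp: E13_def orbit_def)
  have "conjugate G u x \<in> X" "conjugate G u y \<in> Y"
    using u conjugate_T orbit_gens by blast+
  then show ?thesis
    using u b commutes_orbits(2,3)[OF b]
    by (auto simp: conjugate_commutator intro!: commutes_commutator)
qed

lemma commutes_E24_E24:
  assumes a: "a \<in> E24" and b: "b \<in> E24"
  shows "commutes a b"
proof -
  obtain u where u: "u \<in> T" "a = conjugate G u g" using a by (auto simp: E24_def orbit_def)
  have "conjugate G u y \<in> Y" "conjugate G u z \<in> Z"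
    using u conjugate_T orbit_gens by blast+
  then show ?thesis
    using u b commutes_orbits(4,5)[OF b]
    by (auto simp: conjugate_commutator intro!: commutes_commutator)
qed

lemma B_commuting:
  assumes "a \<in> Y \<union> E13 \<union> E24 \<union> E14" "b \<in> Y \<union> E13 \<union> E24 \<union> E14"
  shows "commutes a b"
  using assms B_gens_closed
  by (auto intro: commutes_orbits commutes_orbits[symmetric] commutes_same_orbit
      commutes_E13_E13 commutes_E24_E24 E14_central E14_central[symmetric])

lemma V_commuting: "a \<in> X \<union> Z \<Longrightarrow> b \<in> X \<union> Z \<Longrightarrow> commutes a b"
  by (auto intro: commutes_orbits commutes_orbits[symmetric] commutes_same_orbit)

lemma conjugate_commuting:
  "u \<in> carrier G \<Longrightarrow> a \<in> carrier G \<Longrightarrow> commutes u a \<Longrightarrow> conjugate G u a = a"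
  by (simp add: conjugate_eq_iff_commutes)

lemma B_subgroup: "subgroup B G" and V_subgroup: "subgroup V G" and N_subgroup: "subgroup N G"
  unfolding B_def V_def N_def
  using B_gens_closed V_gens_closed N_gens_closed by (simp_all only: generate_is_subgroup)

lemma B_gens:
  "a \<in> Y \<Longrightarrow> a \<in> B" "a \<in> E13 \<Longrightarrow> a \<in> B" "a \<in> E24 \<Longrightarrow> a \<in> B" "a \<in> E14 \<Longrightarrow> a \<in> B"
  by (auto simp: B_def intro: generate.incl)

lemma V_gens: "a \<in> X \<Longrightarrow> a \<in> V" "a \<in> Z \<Longrightarrow> a \<in> V"
  by (auto simp: V_def intro: generate.incl)

lemma N_gens: "a \<in> X \<Longrightarrow> a \<in> N" "a \<in> Y \<Longrightarrow> a \<in> N" "a \<in> Z \<Longrightarrow> a \<in> N"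
  by (auto simp: N_def intro: generate.incl)

lemma commutator_E13_Z:
  assumes a: "a \<in> E13" and b: "b \<in> Z"
  shows "commutator G a b \<in> E14"
proof -
  obtain u where u: "u \<in> T" "a = conjugate G u e" using a by (auto simp: E13_def orbit_def)
  have XY: "conjugate G u x \<in> X" "conjugate G u y \<in> Y"
    using u conjugate_T orbit_gens by blast+
  have "commutator G a b = commutator G (conjugate G u x) (commutator G (conjugate G u y) b)"
    using commutator_eq[OF XY b] u by (simp add: conjugate_commutator)
  then show ?thesis
    using XY commutator_YZ[OF XY(2) b] by (auto simp: E14_def)
qed

lemma conjugate_X_B:
  assumes a: "a \<in> X" and b: "b \<in> Y \<union> E13 \<union> E24 \<union> E14"
  shows "conjugate G a b \<in> B"
proof -
  have "conjugate G a b = commutator G a b \<otimes> b"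
    using a b B_gens_closed by (intro conjugate_eq_commutator) auto
  moreover have "commutator G a b \<in> B"
  proof -
    consider "b \<in> Y" | "b \<in> E24" | "commutes a b"
      using a b commutes_orbits(2)[of b a] E14_central[of b a] by auto
    then show ?thesis
    proof cases
      case 1 then show ?thesis using a commutator_XY B_gens by blast
    next
      case 2 then show ?thesis using a B_gens(4) by (force simp: E14_def)
    next
      case 3 then show ?thesis
        using a b B_gens_closed subgroup.one_closed[OF B_subgroup]
        by (metis commutator_eq_one_iff orbit_closed(1) subsetD)
    qed
  qed
  moreover have "b \<in> B" using b B_gens by blast
  ultimately show ?thesis using B_subgroup by (simp add: subgroup.m_closed)
qed

lemma conjugate_Z_B:
  assumes a: "a \<in> Z" and b: "b \<in> Y \<union> E13 \<union> E24 \<union> E14"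
  shows "conjugate G a b \<in> B"
proof -
  have bc: "b \<in> carrier G" using b B_gens_closed by blast
  have "conjugate G a b = inv (commutator G b a) \<otimes> b"
    using a bc by (simp add: inv_commutator conjugate_eq_commutator)
  moreover have "commutator G b a \<in> B"
  proof -
    consider "b \<in> Y" | "b \<in> E13" | "commutes b a"
      using a b commutes_orbits(5)[of b a] E14_central[of b a] by auto
    then show ?thesis
    proof cases
      case 1 then show ?thesis using a commutator_YZ B_gens by blast
    next
      case 2 then show ?thesis using a commutator_E13_Z B_gens by blast
    next
      case 3 then show ?thesis
        using a bc subgroup.one_closed[OF B_subgroup]
        by (metis commutator_eq_one_iff orbit_closed(3))
    qed
  qed
  moreover have "b \<in> B" using b B_gens by blast
  ultimately show ?thesis using B_subgroup by (simp add: subgroup.m_closed subgroup.m_inv_closed)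
qed

lemma inv_involution: "a \<in> carrier G \<Longrightarrow> a \<otimes> a = \<one> \<Longrightarrow> inv a = a"
  by (rule inv_equality)

lemma B_normal: "B \<lhd> G"
  unfolding B_def
proof (rule normal_generate[OF B_gens_closed _ generate_f])
  have gen: "conjugate G t a \<in> B"
    if ta: "t \<in> T \<union> {x, y, z}" "a \<in> Y \<union> E13 \<union> E24 \<union> E14" for t a
  proof (cases "a \<in> E14")
    case True
    then have "conjugate G t a = a"
      using ta by (intro conjugate_commuting E14_central[symmetric]) auto
    then show ?thesis using ta True B_gens by simp
  next
    case False
    then consider "t \<in> T" | "t = x" | "t = y" | "t = z" using ta by blast
    then show ?thesis
    proof cases
      case 1 then show ?thesis using False ta conjugate_T B_gens by blast
    next
      case 2 then show ?thesis using conjugate_X_B[OF orbit_gens(1)] ta by simp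
    next
      case 3
      then have "conjugate G t a = a"
        using B_commuting[of y a] ta orbit_gens B_gens_closed
        by (intro conjugate_commuting) auto
      then show ?thesis using ta B_gens by auto
    next
      case 4 then show ?thesis using conjugate_Z_B[OF orbit_gens(3)] ta by simp
    qed
  qed
  fix t a assume t: "t \<in> range f" and a: "a \<in> Y \<union> E13 \<union> E24 \<union> E14"
  have "t \<in> T \<union> {x, y, z}" using t T_gens by (auto simp: UNIV_gen)
  moreover from this have "inv t \<in> T \<union> {x, y, z}"
    using T_inv inv_involution involutions by auto
  ultimately show "conjugate G t a \<in> generate G (Y \<union> E13 \<union> E24 \<union> E14)"
    "conjugate G (inv t) a \<in> generate G (Y \<union> E13 \<union> E24 \<union> E14)"
    using gen a by (simp_all only: B_def)
qed auto

lemma N_normal: "N \<lhd> G"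
  unfolding N_def
proof (rule normal_generate[OF N_gens_closed _ generate_f])
  have gen: "conjugate G t a \<in> N"
    if "t \<in> T \<union> {x, y, z}" "a \<in> X \<union> Y \<union> Z" for t a
  proof (cases "t \<in> T")
    case True
    then show ?thesis using that conjugate_T N_gens by blast
  next
    case False
    then have "t \<in> N" "a \<in> N" using that orbit_gens N_gens by blast+
    then show ?thesis
      using N_subgroup by (simp add: conjugate_def subgroup.m_closed subgroup.m_inv_closed)
  qed
  fix t a assume t: "t \<in> range f" and a: "a \<in> X \<union> Y \<union> Z"
  have "t \<in> T \<union> {x, y, z}" using t T_gens by (auto simp: UNIV_gen)
  moreover from this have "inv t \<in> T \<union> {x, y, z}"
    using T_inv inv_involution involutions by auto
  ultimately show "conjugate G t a \<in> generate G (X \<union> Y \<union> Z)"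
    "conjugate G (inv t) a \<in> generate G (X \<union> Y \<union> Z)"
    using gen a by (simp_all only: N_def)
qed auto

lemma N_factor:
  assumes "n \<in> N"
  shows "\<exists>b\<in>B. \<exists>v\<in>V. n = b \<otimes> v"
proof -
  have Bc: "B \<subseteq> carrier G" and Vc: "V \<subseteq> carrier G"
    using B_subgroup V_subgroup by (simp_all add: subgroup.subset)
  have one: "\<one> \<in> B" "\<one> \<in> V" using B_subgroup V_subgroup by (simp_all add: subgroup.one_closed)
  have "\<exists>b\<in>B. \<exists>v\<in>V. a = b \<otimes> v" if "a \<in> B \<union> V" for a
  proof -
    have "a = a \<otimes> \<one>" "a = \<one> \<otimes> a" using that Bc Vc by auto
    then show ?thesis using that one by blast
  qed
  moreover have "a \<in> B \<union> V" "inv a \<in> B \<union> V" if "a \<in> X \<union> Y \<union> Z" for a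
    using that B_gens V_gens B_subgroup V_subgroup by (auto intro: subgroup.m_inv_closed)
  ultimately have gen: "\<exists>b\<in>B. \<exists>v\<in>V. a = b \<otimes> v" "\<exists>b\<in>B. \<exists>v\<in>V. inv a = b \<otimes> v"
    if "a \<in> X \<union> Y \<union> Z" for a
    using that by blast+
  show ?thesis
    using assms unfolding N_def
  proof induction
    case one
    then show ?case using \<open>\<one> \<in> B\<close> \<open>\<one> \<in> V\<close> by (metis l_one one_closed)
  next
    case (eng h k)
    then obtain b v c w where *: "b \<in> B" "v \<in> V" "h = b \<otimes> v" "c \<in> B" "w \<in> V" "k = c \<otimes> w"
      by blast
    have cl: "b \<in> carrier G" "c \<in> carrier G" "v \<in> carrier G" "w \<in> carrier G"
      using * Bc Vc by blast+
    have "h \<otimes> k = (b \<otimes> conjugate G v c) \<otimes> (v \<otimes> w)"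
      using cl by (simp add: * conjugate_def m_assoc)
    moreover have "b \<otimes> conjugate G v c \<in> B"
      using * cl B_subgroup normal_conjugate[OF B_normal, of v c] by (simp add: subgroup.m_closed)
    moreover have "v \<otimes> w \<in> V" using * V_subgroup by (simp add: subgroup.m_closed)
    ultimately show ?case by blast
  qed (use gen in blast)+
qed

lemma finite_generate_B: "finite A \<Longrightarrow> A \<subseteq> B \<Longrightarrow> finite (generate G A)"
proof (rule finite_generate_commuting_involutions)
  assume A: "A \<subseteq> B"
  then show "A \<subseteq> carrier G" using B_subgroup subgroup.subset by blast
  show "commutes a b" if "a \<in> A" "b \<in> A" for a b
    by (rule commutes_generate[OF B_gens_closed B_gens_closed])
      (use that A in \<open>auto simp: B_def[symmetric] intro: B_commuting\<close>)
  show "a \<otimes> a = \<one>" if "a \<in> A" for a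
    by (rule generate_commuting_involutions[OF B_gens_closed])
      (use that A in \<open>auto simp: B_def[symmetric] intro: B_commuting involutions_orbits E14_involution\<close>)
qed

lemma finite_generate_V: "finite A \<Longrightarrow> A \<subseteq> V \<Longrightarrow> finite (generate G A)"
proof (rule finite_generate_commuting_involutions)
  assume A: "A \<subseteq> V"
  then show "A \<subseteq> carrier G" using V_subgroup subgroup.subset by blast
  show "commutes a b" if "a \<in> A" "b \<in> A" for a b
    by (rule commutes_generate[OF V_gens_closed V_gens_closed])
      (use that A in \<open>auto simp: V_def[symmetric] intro: V_commuting\<close>)
  show "a \<otimes> a = \<one>" if "a \<in> A" for a
    by (rule generate_commuting_involutions[OF V_gens_closed])
      (use that A in \<open>auto simp: V_def[symmetric] intro: V_commuting involutions_orbits\<close>)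
qed

lemma locally_finite_N: "locally_finite_group (G\<lparr>carrier := N\<rparr>)"
  unfolding locally_finite_group_def
proof (intro conjI allI impI)
  show "group (G\<lparr>carrier := N\<rparr>)" using N_subgroup by (rule subgroup_imp_group)
  fix A assume A: "finite A \<and> A \<subseteq> carrier (G\<lparr>carrier := N\<rparr>)"
  then have "A \<subseteq> N" by simp
  have "conjugate G v b \<in> B" if "v \<in> V" "b \<in> B" for v b
    using normal_conjugate[OF B_normal _ that(2)] subgroup.mem_carrier[OF V_subgroup that(1)] .
  then have "finite (generate G A)"
    using A \<open>A \<subseteq> N\<close> N_factor
    by (intro finite_generate_semidirect[OF B_subgroup V_subgroup _ finite_generate_B
        finite_generate_V]) blast+
  then show "finite (generate (G\<lparr>carrier := N\<rparr>) A)"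
    using generate_consistent[OF \<open>A \<subseteq> N\<close> N_subgroup] by simp
qed

section \<open>Nilpotency of \<open>N\<close> and the abelian quotient\<close>

definition "Z1 = centralizer G {\<one>} N"
text \<open>Like \<open>Z1\<close> and \<open>Z3\<close> this is taken in the whole group, not in
  \<open>N\<close>: centralizers of the normal subgroup \<open>N\<close> modulo normal subgroups are
  normal there, and all commutators can be computed in one group.\<close>

definition "Z2 = centralizer G Z1 N"
definition "Z3 = centralizer G Z2 N"

lemma Z_normal: "Z1 \<lhd> G" "Z2 \<lhd> G" "Z3 \<lhd> G"
  unfolding Z1_def Z2_def Z3_def
  by (intro normal_centralizer one_is_normal N_normal)+

lemma centralizer_NI:
  assumes M: "M \<lhd> G" and a: "a \<in> carrier G"
    and *: "\<And>b. b \<in> X \<union> Y \<union> Z \<Longrightarrow> commutator G a b \<in> M"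
  shows "a \<in> centralizer G M N"
proof -
  have "commutator G a n \<in> M" if "n \<in> N" for n
    by (rule commutator_generate[OF M _ N_gens_closed, of "{a}"])
      (use that a * in \<open>auto simp: N_def[symmetric] intro: generate.incl\<close>)
  then show ?thesis using a by (simp add: centralizer_def)
qed

lemma commutator_commuting_mem:
  assumes "M \<lhd> G" "a \<in> carrier G" "b \<in> carrier G" "commutes a b"
  shows "commutator G a b \<in> M"
proof -
  interpret M: normal M G by fact
  show ?thesis using assms commutator_eq_one_iff M.one_closed by metis
qed

lemma E14_Z1: "a \<in> E14 \<Longrightarrow> a \<in> Z1"
  unfolding Z1_def
  by (rule centralizer_NI[OF one_is_normal], simp,
      rule commutator_commuting_mem[OF one_is_normal]) (auto intro: E14_central)

lemma E13_Z2:
  assumes a: "a \<in> E13"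
  shows "a \<in> Z2"
  unfolding Z2_def
proof (rule centralizer_NI[OF Z_normal(1)])
  fix b assume "b \<in> X \<union> Y \<union> Z"
  then show "commutator G a b \<in> Z1"
    using a commutator_E13_Z[OF a] E14_Z1
    by (auto intro: commutator_commuting_mem[OF Z_normal(1)] commutes_orbits)
qed (use a in simp)

lemma E24_Z2:
  assumes a: "a \<in> E24"
  shows "a \<in> Z2"
  unfolding Z2_def
proof (rule centralizer_NI[OF Z_normal(1)])
  fix b assume b: "b \<in> X \<union> Y \<union> Z"
  show "commutator G a b \<in> Z1"
  proof (cases "b \<in> X")
    case True
    then have "commutator G b a \<in> E14" using a by (auto simp: E14_def)
    then show ?thesis using a True E14_Z1 centralizer_sym[OF Z_normal(1), of b a] by simp
  next
    case False
    then show ?thesis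
      using a b by (auto intro: commutator_commuting_mem[OF Z_normal(1)] commutes_orbits)
  qed
qed (use a in simp)

text \<open>The levels are the diagonals of the matrix: generators that do not commute have their
  commutator in \<open>E13\<close> or \<open>E24\<close> up to inversion, and commutators of those
  with generators of \<open>N\<close> are trivial or lie, up to inversion, in the central set
  \<open>E14\<close>.\<close>

lemma N_Z3: "N \<subseteq> Z3"
  unfolding N_def
proof (rule generate_subgroup_incl)
  show "subgroup Z3 G" using Z_normal(3) by (rule normal_imp_subgroup)
  show "X \<union> Y \<union> Z \<subseteq> Z3"
  proof
    fix a assume a: "a \<in> X \<union> Y \<union> Z"
    show "a \<in> Z3"
      unfolding Z3_def
    proof (rule centralizer_NI[OF Z_normal(2)])
      fix b assume b: "b \<in> X \<union> Y \<union> Z"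
      have XY: "commutator G a b \<in> Z2" if "a \<in> X" "b \<in> Y" for a b
        using that commutator_XY E13_Z2 by blast
      have YZ: "commutator G a b \<in> Z2" if "a \<in> Y" "b \<in> Z" for a b
        using that commutator_YZ E24_Z2 by blast
      consider "commutes a b" | "a \<in> X" "b \<in> Y" | "a \<in> Y" "b \<in> Z" | "b \<in> X" "a \<in> Y"
        | "b \<in> Y" "a \<in> Z"
        using a b commutes_same_orbit commutes_orbits(1) by (metis UnE)
      then show "commutator G a b \<in> Z2"
      proof cases
        case 1
        then show ?thesis
          using a b N_gens_closed by (intro commutator_commuting_mem[OF Z_normal(2)]) auto
      qed (use XY YZ centralizer_sym[OF Z_normal(2), of b a] in auto)
    qed (use a in auto)
  qed
qed

text \<open>If a term of the lower central series centralizes \<open>N\<close> modulo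
  \<open>M\<close>, the next term lies in \<open>M\<close>. The series starts at index 0 inside
  \<open>Z3\<close>, so three steps lead through \<open>Z2\<close> and \<open>Z1\<close> to the
  trivial group.\<close>

lemma nilpotent_N: "nilpotent_class_at_most 3 (G\<lparr>carrier := N\<rparr>)"
proof -
  let ?H = "G\<lparr>carrier := N\<rparr>"
  interpret H: group ?H using N_subgroup by (rule subgroup_imp_group)
  have Nc: "N \<subseteq> carrier G" using N_subgroup by (rule subgroup.subset)
  have step: "lower_central ?H (Suc n) \<subseteq> N \<inter> M"
    if sub: "lower_central ?H n \<subseteq> N \<inter> centralizer G M N" and M: "M \<lhd> G" for n M
  proof -
    let ?C = "{a \<otimes>\<^bsub>?H\<^esub> b \<otimes>\<^bsub>?H\<^esub> inv\<^bsub>?H\<^esub> a \<otimes>\<^bsub>?H\<^esub> inv\<^bsub>?H\<^esub> b | a b. a \<in> lower_central ?H n \<and> b \<in> carrier ?H}"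
    have C: "?C \<subseteq> N \<inter> M"
    proof
      fix c assume "c \<in> ?C"
      then obtain a b where ab: "a \<in> lower_central ?H n" "b \<in> N"
        "c = a \<otimes>\<^bsub>?H\<^esub> b \<otimes>\<^bsub>?H\<^esub> inv\<^bsub>?H\<^esub> a \<otimes>\<^bsub>?H\<^esub> inv\<^bsub>?H\<^esub> b" by auto
      then have aN: "a \<in> N" "a \<in> centralizer G M N" using sub by blast+
      have c: "c = commutator G a b"
        using ab aN by (simp add: commutator_def m_inv_consistent[OF N_subgroup])
      show "c \<in> N \<inter> M"
      proof
        show "c \<in> M" using c aN ab by (simp add: centralizer_def)
        show "c \<in> N"
          using aN ab N_subgroup
          by (simp add: c commutator_def subgroup.m_closed subgroup.m_inv_closed)
      qed
    qed
    have "subgroup (N \<inter> M) G"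
      using N_subgroup M normal_imp_subgroup subgroups_Inter_pair by blast
    then have "generate G ?C \<subseteq> N \<inter> M" by (rule generate_subgroup_incl[OF C])
    then show ?thesis
      using generate_consistent[of ?C N] C N_subgroup by simp
  qed
  have "lower_central ?H 0 \<subseteq> N \<inter> Z3" using N_Z3 by simp
  then have "lower_central ?H (Suc 0) \<subseteq> N \<inter> Z2"
    unfolding Z3_def by (rule step) (rule Z_normal)
  then have "lower_central ?H (Suc (Suc 0)) \<subseteq> N \<inter> Z1"
    unfolding Z2_def by (rule step) (rule Z_normal)
  then have "lower_central ?H (Suc (Suc (Suc 0))) \<subseteq> N \<inter> {\<one>}"
    unfolding Z1_def by (rule step) (rule one_is_normal)
  moreover have "\<one> \<in> lower_central ?H (Suc (Suc (Suc 0)))"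
    using generate.one[of ?H] by simp
  ultimately have "lower_central ?H 3 = {\<one>}" by (auto simp: numeral_3_eq_3)
  then show ?thesis
    by (simp add: nilpotent_class_at_most_def H.is_group)
qed

lemma comm_group_Mod_N: "comm_group (G Mod N)"
proof -
  interpret N: normal N G by (rule N_normal)
  \<comment> \<open>It is enough to look at generators: torus generators commute with each other,
    and every other generator lies in the normal subgroup \<open>N\<close>.\<close>
  have comm: "commutator G a b \<in> N" if "a \<in> carrier G" "b \<in> carrier G" for a b
  proof (rule commutator_generate[OF N_normal, of "range f" "range f"])
    fix a b assume "a \<in> range f" "b \<in> range f"
    then have ab: "a \<in> T \<union> {x, y, z}" "b \<in> T \<union> {x, y, z}" "a \<in> carrier G" "b \<in> carrier G"
      using T_gens by (auto simp: UNIV_gen)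
    show "commutator G a b \<in> N"
    proof (cases "a \<in> T \<and> b \<in> T")
      case True
      then show ?thesis using ab T_commutes by (intro commutator_commuting_mem N_normal) auto
    next
      case False
      then have "a \<in> N \<or> b \<in> N" using ab orbit_gens N_gens by auto
      moreover have "commutator G a b \<in> N" if "a \<in> N" "b \<in> carrier G" for a b
      proof -
        have "commutator G a b = a \<otimes> conjugate G b (inv a)"
          using that by (simp add: commutator_def conjugate_def m_assoc)
        then show ?thesis using that normal_conjugate[OF N_normal] by simp
      qed
      ultimately show ?thesis using ab centralizer_sym[OF N_normal] by blast
    qed
  qed (use that generate_f in auto)
  show ?thesis
  proof (rule group.group_comm_groupI)
    show "group (G Mod N)" by (rule N.factorgroup_is_group)
    fix A B assume "A \<in> carrier (G Mod N)" "B \<in> carrier (G Mod N)"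
    then obtain a b where ab: "a \<in> carrier G" "b \<in> carrier G" "A = N #> a" "B = N #> b"
      by (auto simp: carrier_FactGroup)
    have "a \<otimes> b = commutator G a b \<otimes> (b \<otimes> a)"
      using ab by (simp add: commutator_def m_assoc)
    then have "a \<otimes> b \<in> N #> (b \<otimes> a)"
      using comm ab by (auto simp: r_coset_def)
    then have "N #> (a \<otimes> b) = N #> (b \<otimes> a)"
      using ab by (metis N.subgroup_axioms m_closed repr_independence)
    then show "A \<otimes>\<^bsub>G Mod N\<^esub> B = B \<otimes>\<^bsub>G Mod N\<^esub> A"
      using ab by (simp add: N.rcos_sum)
  qed
qed

end

section \<open>The matrix representation\<close>

text \<open>
  \<open>UT a b x y z e g c\<close> stands for the matrix with rows
  \<open>(1, x, e, c)\<close>, \<open>(0, a, y, g)\<close>, \<open>(0, 0, b, z)\<close>, \<open>(0, 0, 0, 1)\<close>.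
\<close>

datatype 'k ut = UT 'k 'k 'k 'k 'k 'k 'k 'k

fun ut_mult :: "'k::field ut \<Rightarrow> 'k ut \<Rightarrow> 'k ut" where
  "ut_mult (UT a b x y z e g c) (UT a' b' x' y' z' e' g' c') =
    UT (a * a') (b * b') (x' + x * a') (a * y' + y * b') (b * z' + z)
      (e' + x * y' + e * b') (a * g' + y * z' + g) (c' + x * g' + e * z' + c)"

fun ut_invertible :: "'k::field ut \<Rightarrow> bool" where
  "ut_invertible (UT a b x y z e g c) \<longleftrightarrow> a \<noteq> 0 \<and> b \<noteq> 0"

definition ut_group :: "'k::field ut monoid" where
  "ut_group = \<lparr>carrier = {M. ut_invertible M}, monoid.mult = ut_mult, one = UT 1 1 0 0 0 0 0 0\<rparr>"

lemma ut_group_simps [simp]: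
  "M \<in> carrier ut_group \<longleftrightarrow> ut_invertible M"
  "monoid.mult ut_group = ut_mult"
  "one ut_group = UT 1 1 0 0 0 0 0 0"
  by (simp_all add: ut_group_def)

lemma group_ut_group: "group (ut_group :: 'k::field ut monoid)"
proof (rule groupI)
  fix M :: "'k ut" assume M: "M \<in> carrier ut_group"
  obtain a b x y z e g c where M_eq: "M = UT a b x y z e g c" by (cases M)
  \<comment> \<open>These are the entries of a left inverse, found by solving the matrix equation
    entry by entry.\<close>
  define x' where "x' = - x / a"
  define e' where "e' = - (e + x' * y) / b"
  define y' where "y' = - (y / a) / b"
  define z' where "z' = - z / b"
  define g' where "g' = - (g / a + y' * z)"
  define M' where "M' = UT (1 / a) (1 / b) x' y' z' e' g' (- (c + x' * g + e' * z))"
  have "M' \<in> carrier ut_group" using M by (simp add: M_eq M'_def)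
  moreover have "M' \<otimes>\<^bsub>ut_group\<^esub> M = \<one>\<^bsub>ut_group\<^esub>"
    using M by (simp add: M_eq M'_def x'_def y'_def z'_def e'_def g'_def)
  ultimately show "\<exists>M'\<in>carrier ut_group. M' \<otimes>\<^bsub>ut_group\<^esub> M = \<one>\<^bsub>ut_group\<^esub>" by blast
next
  fix L M N :: "'k ut"
  show "L \<otimes>\<^bsub>ut_group\<^esub> M \<otimes>\<^bsub>ut_group\<^esub> N = L \<otimes>\<^bsub>ut_group\<^esub> (M \<otimes>\<^bsub>ut_group\<^esub> N)"
    by (cases L; cases M; cases N) (simp add: algebra_simps)
next
  fix L M :: "'k ut"
  show "L \<in> carrier ut_group \<Longrightarrow> M \<in> carrier ut_group \<Longrightarrow> L \<otimes>\<^bsub>ut_group\<^esub> M \<in> carrier ut_group"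
    by (cases L; cases M) simp
  show "\<one>\<^bsub>ut_group\<^esub> \<otimes>\<^bsub>ut_group\<^esub> M = M" by (cases M) simp
qed simp

abbreviation ut_center :: "'k::field \<Rightarrow> 'k ut" where
  "ut_center c \<equiv> UT 1 1 0 0 0 0 0 c"

text \<open>Both outer diagonal entries are 1, so a matrix that differs from the identity only in
  the corner is central, and any additive group of corner entries gives a normal subgroup. It is
  used with conditions on the support and on the degree of the corner.\<close>

lemma ut_center_normal:
  fixes A :: "'k::field set"
  assumes "0 \<in> A" "\<And>c d. c \<in> A \<Longrightarrow> d \<in> A \<Longrightarrow> c + d \<in> A" "\<And>c. c \<in> A \<Longrightarrow> - c \<in> A"
  shows "ut_center ` A \<lhd> ut_group"
proof -
  interpret group "ut_group :: 'k ut monoid" by (rule group_ut_group)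
  have inv: "inv\<^bsub>ut_group\<^esub> (ut_center c) = ut_center (- c)" for c :: 'k
    by (rule inv_equality) simp_all
  show ?thesis
  proof (rule normalI_conjugate)
    show "subgroup (ut_center ` A) ut_group"
      using assms by unfold_locales (auto simp: inv)
    fix M a :: "'k ut" assume M: "M \<in> carrier ut_group" and a: "a \<in> ut_center ` A"
    have "M \<otimes>\<^bsub>ut_group\<^esub> a = a \<otimes>\<^bsub>ut_group\<^esub> M"
      using a by (cases M) (auto simp: algebra_simps)
    then have "conjugate ut_group M a = a"
      using M a by (subst conjugate_eq_iff_commutes) auto
    then show "conjugate ut_group M a \<in> ut_center ` A" using a by simp
  qed
qed

text \<open>The reciprocals make \<open>p\<close> scale the entry of \<open>x\<close> by t and
  \<open>q\<close> by 1 + t, and they give \<open>p \<otimes> inv r\<close> and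
  \<open>q \<otimes> inv s\<close> equal inner diagonal entries, so that these fix
  \<open>y\<close>.\<close>

fun gen_matrix :: "'k::field \<Rightarrow> gen \<Rightarrow> 'k ut" where
  "gen_matrix t Gp = UT (1 / t) 1 0 0 0 0 0 0"
| "gen_matrix t Gq = UT (1 / (1 + t)) 1 0 0 0 0 0 0"
| "gen_matrix t Gr = UT 1 t 0 0 0 0 0 0"
| "gen_matrix t Gs = UT 1 (1 + t) 0 0 0 0 0 0"
| "gen_matrix t Gx = UT 1 1 1 0 0 0 0 0"
| "gen_matrix t Gy = UT 1 1 0 1 0 0 0 0"
| "gen_matrix t Gz = UT 1 1 0 0 1 0 0 0"

lemma (in group) conjugate_eqI:
  assumes "u \<in> carrier G" "a \<in> carrier G" "b \<in> carrier G" "u \<otimes> a = b \<otimes> u"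
  shows "conjugate G u a = b"
  using assms by (simp add: conjugate_def m_assoc)

lemma (in group) commutator_eqI:
  assumes "a \<in> carrier G" "b \<in> carrier G" "c \<in> carrier G" "a \<otimes> b = c \<otimes> (b \<otimes> a)"
  shows "commutator G a b = c"
  using assms by (simp add: commutator_def m_assoc)

context
  fixes t :: "'k::field"
  assumes t: "t \<noteq> 0" "1 + t \<noteq> 0" and char_two: "(1::'k) + 1 = 0"
begin

lemma gen_matrix_closed: "gen_matrix t a \<in> carrier ut_group"
  using t by (cases a) simp_all

interpretation M: group "ut_group :: 'k ut monoid" by (rule group_ut_group)

lemma gen_matrix_conjugates:
  "inv\<^bsub>ut_group\<^esub> (gen_matrix t Gp) = UT t 1 0 0 0 0 0 0"
  "inv\<^bsub>ut_group\<^esub> (gen_matrix t Gq) = UT (1 + t) 1 0 0 0 0 0 0"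
  "inv\<^bsub>ut_group\<^esub> (gen_matrix t Gr) = UT 1 (1 / t) 0 0 0 0 0 0"
  "inv\<^bsub>ut_group\<^esub> (gen_matrix t Gs) = UT 1 (1 / (1 + t)) 0 0 0 0 0 0"
  "commutator ut_group (gen_matrix t Gx) (gen_matrix t Gy) = UT 1 1 0 0 0 1 0 0"
  "commutator ut_group (gen_matrix t Gy) (gen_matrix t Gz) = UT 1 1 0 0 0 0 1 0"
  "conjugate ut_group (gen_matrix t Gp) (gen_matrix t Gx) = UT 1 1 t 0 0 0 0 0"
  "conjugate ut_group (gen_matrix t Gq) (gen_matrix t Gx) = UT 1 1 (1 + t) 0 0 0 0 0"
  "conjugate ut_group (UT t 1 0 0 0 0 0 0) (gen_matrix t Gy) = UT 1 1 0 t 0 0 0 0"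
  "conjugate ut_group (UT (1 + t) 1 0 0 0 0 0 0) (gen_matrix t Gy) = UT 1 1 0 (1 + t) 0 0 0 0"
  "conjugate ut_group (gen_matrix t Gr) (gen_matrix t Gz) = UT 1 1 0 0 t 0 0 0"
  "conjugate ut_group (gen_matrix t Gs) (gen_matrix t Gz) = UT 1 1 0 0 (1 + t) 0 0 0"
  using t by (auto intro!: M.inv_equality M.commutator_eqI M.conjugate_eqI simp: char_two)

lemma relators_gen_matrix: "relators ut_group (gen_matrix t) \<subseteq> {\<one>\<^bsub>ut_group\<^esub>}"
proof -
  have 1: "commutator ut_group a b = ut_center 0"
    if "ut_invertible a" "ut_invertible b" "ut_mult a b = ut_mult b a" for a b :: "'k ut"
    using that M.commutator_eq_one_iff[of a b] by simp
  have 2: "ut_mult a (inv\<^bsub>ut_group\<^esub> b) = ut_center 0"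
    if "a = b" "ut_invertible b" for a b :: "'k ut"
    using M.r_inv[of b] that by simp
  show ?thesis
    unfolding relators_def Let_def gen_matrix_conjugates
    using t char_two by (auto intro!: 1 2 simp: algebra_simps)
qed

lemma gen_matrix_pow:
  "gen_matrix t Gp [^]\<^bsub>ut_group\<^esub> (j::nat) = UT ((1 / t) ^ j) 1 0 0 0 0 0 0"
  by (induction j) (simp_all add: nat_pow_def)

text \<open>The power of \<open>p\<close> scales the entry of \<open>g\<close> by the
  \<open>j\<close>-th power of 1/t, and the commutator with \<open>x\<close> copies that entry to
  the corner.\<close>

lemma gen_matrix_center:
  "commutator ut_group (gen_matrix t Gx) (conjugate ut_group (gen_matrix t Gp [^]\<^bsub>ut_group\<^esub> (j::nat))
    (commutator ut_group (gen_matrix t Gy) (gen_matrix t Gz))) = ut_center ((1 / t) ^ j)"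
proof -
  have "conjugate ut_group (UT ((1 / t) ^ j) 1 0 0 0 0 0 0) (UT 1 1 0 0 0 0 1 0) =
      UT 1 1 0 0 0 0 ((1 / t) ^ j) 0"
    using t by (intro M.conjugate_eqI) simp_all
  moreover have "commutator ut_group (gen_matrix t Gx) (UT 1 1 0 0 0 0 ((1 / t) ^ j) 0) =
      ut_center ((1 / t) ^ j)"
    by (rule M.commutator_eqI) simp_all
  ultimately show ?thesis by (simp only: gen_matrix_pow gen_matrix_conjugates)
qed

end

text \<open>A pole of order at most \<open>n\<close> at t = 0, that is, degree at most
  \<open>n\<close> in 1/t. In Laurent series both t and 1 + t are invertible, and the inverse of 1 +
  t is a power series, hence without pole.\<close>

definition deg_le :: "nat \<Rightarrow> 'a::zero fls \<Rightarrow> bool" where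
  "deg_le n f \<longleftrightarrow> (\<forall>k < - int n. fls_nth f k = 0)"

lemma deg_le_mono: "deg_le n f \<Longrightarrow> n \<le> m \<Longrightarrow> deg_le m f"
  by (simp add: deg_le_def)

lemma deg_le_add: "deg_le n f \<Longrightarrow> deg_le n g \<Longrightarrow> deg_le n (f + g)"
  for f g :: "'a::field fls"
  by (simp add: deg_le_def)

lemma deg_le_mult:
  fixes f g :: "'a::field fls"
  assumes "deg_le n f" "deg_le m g"
  shows "deg_le (n + m) (f * g)"
proof (cases "f = 0 \<or> g = 0")
  case True
  then show ?thesis by (auto simp: deg_le_def)
next
  case False
  then have "fls_subdegree f \<ge> - int n" "fls_subdegree g \<ge> - int m"
    using assms by (auto simp: deg_le_def intro!: fls_subdegree_geI)
  then show ?thesis by (auto simp: deg_le_def intro!: fls_times_nth_eq0)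
qed

lemma deg_le_exists: "\<exists>n. deg_le n f"
  by (rule exI[of _ "nat (- fls_subdegree f)"]) (auto simp: deg_le_def)

fun ut_deg_le :: "nat \<Rightarrow> 'a::field fls ut \<Rightarrow> bool" where
  "ut_deg_le n (UT a b x y z e g c) \<longleftrightarrow>
    deg_le n a \<and> deg_le n b \<and> deg_le n x \<and> deg_le n y \<and> deg_le n z \<and> deg_le n e \<and>
    deg_le n g \<and> deg_le n c"

lemma ut_deg_le_mono: "ut_deg_le n M \<Longrightarrow> n \<le> m \<Longrightarrow> ut_deg_le m M"
  by (cases M) (auto intro: deg_le_mono)

lemma ut_deg_le_mult:
  assumes "ut_deg_le n L" "ut_deg_le m M"
  shows "ut_deg_le (n + m) (ut_mult L M)"
  using assms
  by (cases L; cases M)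
    (auto intro!: deg_le_add deg_le_mult intro: deg_le_mono[of n _ "n + m"] deg_le_mono[of m _ "n + m"])

lemma ut_deg_le_exists: "\<exists>n. ut_deg_le n M"
proof (cases M)
  case (UT a b x y z e g c)
  obtain d where d: "deg_le (d f) f" for f :: "'a fls" using deg_le_exists by metis
  show ?thesis
    unfolding UT
    by (rule exI[of _ "Max (d ` {a, b, x, y, z, e, g, c})"])
      (auto intro!: deg_le_mono[OF d] simp del: Max_insert image_insert intro: Max_ge)
qed

section \<open>Adding central relators\<close>

instance gen :: countable by countable_datatype

definition center_elem :: "('a, 'b) monoid_scheme \<Rightarrow> (gen \<Rightarrow> 'a) \<Rightarrow> nat \<Rightarrow> 'a" where
  "center_elem G f j = commutator G (f Gx)
    (conjugate G (f Gp [^]\<^bsub>G\<^esub> j) (commutator G (f Gy) (f Gz)))"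

lemma (in group) normal_central_involution:
  assumes c: "c \<in> carrier G" "c \<otimes> c = \<one>" and central: "\<And>u. u \<in> carrier G \<Longrightarrow> commutes c u"
  shows "{\<one>, c} \<lhd> G"
proof (rule normalI_conjugate)
  have "inv c = c" using c by (intro inv_equality)
  then show "subgroup {\<one>, c} G" using c by unfold_locales auto
  show "conjugate G u a \<in> {\<one>, c}" if "u \<in> carrier G" "a \<in> {\<one>, c}" for u a
    using that c central[of u] by (auto simp: conjugate_eq_iff_commutes[THEN iffD2])
qed

lemma finite_relators: "finite (relators G f)"
  by (simp add: relators_def Let_def)

lemma (in group) relators_closed: "(\<And>a. f a \<in> carrier G) \<Longrightarrow> relators G f \<subseteq> carrier G"
  by (auto simp: relators_def Let_def)

lemma (in group) center_elem_closed: "(\<And>a. f a \<in> carrier G) \<Longrightarrow> center_elem G f j \<in> carrier G"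
  by (simp add: center_elem_def)

lemma (in group_hom) image_relators:
  "(\<And>a. f a \<in> carrier G) \<Longrightarrow> h ` relators G f = relators H (\<lambda>a. h (f a))"
  by (simp add: relators_def Let_def image_Un hom_commutator hom_conjugate)

lemma (in group_hom) hom_center_elem:
  "(\<And>a. f a \<in> carrier G) \<Longrightarrow> h (center_elem G f j) = center_elem H (\<lambda>a. h (f a)) j"
  by (simp add: center_elem_def hom_commutator hom_conjugate hom_nat_pow)

text \<open>Commutators and conjugations do not see central factors, and the power of
  \<open>f Gp\<close> only picks up a central power. This is for generators that can be recovered
  only up to central matrices.\<close>

lemma (in group) center_elem_central_factors:
  assumes f [simp]: "\<And>a. f a \<in> carrier G" and k [simp]: "\<And>a. k a \<in> carrier G"
    and central: "\<And>a u. u \<in> carrier G \<Longrightarrow> commutes (k a) u"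
  shows "center_elem G (\<lambda>a. f a \<otimes> k a) j = center_elem G f j"
proof -
  have conj: "conjugate G (u \<otimes> c) a = conjugate G u a"
    if "u \<in> carrier G" "a \<in> carrier G" "c \<in> carrier G" "\<And>v. v \<in> carrier G \<Longrightarrow> commutes c v" for u a c
    using that by (simp add: conjugate_mult_left conjugate_eq_iff_commutes[THEN iffD2])
  have left: "commutator G (a \<otimes> k c) b = commutator G a b"
    if "a \<in> carrier G" "b \<in> carrier G" for a b c
    using that conj central by (simp add: commutator_eq_conjugate)
  have right: "commutator G a (b \<otimes> k c) = commutator G a b"
    if "a \<in> carrier G" "b \<in> carrier G" for a b c
    using that left[of b a c] by (metis f inv_commutator k m_closed)
  have pow: "(f Gp \<otimes> k Gp) [^] j = f Gp [^] j \<otimes> k Gp [^] j"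
    using central[of "f Gp" Gp] by (intro pow_mult_distrib) simp_all
  have "commutes (k Gp [^] j) u" if "u \<in> carrier G" for u
  proof (induction j)
    case (Suc j)
    then show ?case unfolding nat_pow_Suc using that central by (intro commutes_mult) simp_all
  qed (use that in simp)
  then show ?thesis
    by (simp add: center_elem_def left right pow conj)
qed

section \<open>Kernels obtained by imposing central relators\<close>

abbreviation "gen_group \<equiv> free_group (UNIV :: gen set)"
abbreviation "letter \<equiv> \<lambda>a :: gen. [(a, True)]"

interpretation FT: group gen_group by (rule group_free_group)

text \<open>The free group modulo \<open>relator_closure {}\<close> is the group H of the overview;
  the group of the theorem is the quotient by \<open>relator_closure I\<close>. Other index sets
  occur when a relation is traced to finitely many w_j.\<close>

definition relator_closure :: "nat set \<Rightarrow> (gen \<times> bool) list set" where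
  "relator_closure L =
    normal_closure gen_group (relators gen_group letter \<union> center_elem gen_group letter ` L)"

lemma relator_closure_gens:
  "relators gen_group letter \<union> center_elem gen_group letter ` L \<subseteq> carrier gen_group"
  using FT.relators_closed[of letter] FT.center_elem_closed[of letter] by auto

lemma relator_closure_normal: "relator_closure L \<lhd> gen_group"
  unfolding relator_closure_def by (rule FT.normal_normal_closure[OF relator_closure_gens])

lemma relator_closure_subset: "relator_closure L \<subseteq> carrier gen_group"
  using relator_closure_normal normal_imp_subgroup subgroup.subset by blast

lemma relators_in_closure: "relators gen_group letter \<subseteq> relator_closure L"
  and center_elem_in_closure: "j \<in> L \<Longrightarrow> center_elem gen_group letter j \<in> relator_closure L"
  using FT.normal_closure_incl[of "relators gen_group letter \<union> center_elem gen_group letter ` L"]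
  by (auto simp: relator_closure_def)

lemma relator_closure_mono: "L \<subseteq> M \<Longrightarrow> relator_closure L \<subseteq> relator_closure M"
  unfolding relator_closure_def by (intro FT.normal_closure_mono) auto

lemma hom_relator_closure:
  assumes "group_hom gen_group H h" "M \<lhd> H" "relators H (\<lambda>a. h (letter a)) \<subseteq> M"
    and "\<And>j. j \<in> L \<Longrightarrow> center_elem H (\<lambda>a. h (letter a)) j \<in> M" and w: "w \<in> relator_closure L"
  shows "h w \<in> M"
proof -
  interpret h: group_hom gen_group H h by fact
  show ?thesis
  proof (rule h.hom_normal_closure[OF \<open>M \<lhd> H\<close> _ relator_closure_gens w[unfolded relator_closure_def]])
    show "h ` (relators gen_group letter \<union> center_elem gen_group letter ` L) \<subseteq> M"
      using assms(3,4) by (auto simp: image_Un h.image_relators h.hom_center_elem)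
  qed
qed

lemma (in normal) group_hom_Mod: "group_hom G (G Mod H) (\<lambda>a. H #> a)"
  by (intro group_hom.intro group_hom_axioms.intro is_group factorgroup_is_group r_coset_hom_Mod)

lemma (in normal) r_coset_eq_one_iff: "a \<in> carrier G \<Longrightarrow> H #> a = \<one>\<^bsub>G Mod H\<^esub> \<longleftrightarrow> a \<in> H"
  using coset_join1 coset_join2 subset by (metis one_FactGroup subgroup_axioms)

lemma abels_quotient:
  assumes hom: "h \<in> hom gen_group G" and G: "group G" and surj: "h ` carrier gen_group = carrier G"
    and ker: "\<And>w. w \<in> relators gen_group letter \<Longrightarrow> h w = \<one>\<^bsub>G\<^esub>"
  shows "abels G (\<lambda>a. h (letter a))"
proof -
  interpret G: group G by fact
  interpret h: group_hom gen_group G h using hom by unfold_locales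
  show ?thesis
  proof unfold_locales
    show "h (letter a) \<in> carrier G" for a by simp
    have "generate G (h ` range letter) = h ` generate gen_group (range letter)"
      by (rule h.generate_img) auto
    then show "generate G (range (\<lambda>a. h (letter a))) = carrier G"
      using generate_free_group[of "UNIV :: gen set"] surj by (simp add: image_image)
    show "relators G (\<lambda>a. h (letter a)) \<subseteq> {\<one>\<^bsub>G\<^esub>}"
      using h.image_relators[of letter] ker by auto
  qed
qed

lemma (in abels) center_elem_E14: "center_elem G f j \<in> E14"
proof -
  have "p [^] j \<in> T" by (induction j) (use T_gens T_mult subgroup.one_closed[OF T_subgroup] in auto)
  then have "conjugate G (p [^] j) g \<in> E24" using conjugate_T orbit_gens by blast
  then show ?thesis using orbit_gens by (force simp: center_elem_def E14_def)
qed

text \<open>The quotient by \<open>relator_closure L\<close> still satisfies the relators of H, so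
  the image of w_j is central with trivial square. Together with 1 it forms a normal subgroup
  containing the images of all relators in question; hence the index of
  \<open>relator_closure L\<close> in the larger closure is at most two.\<close>

lemma relator_closure_insert:
  assumes v: "v \<in> relator_closure (insert j L)"
  shows "v \<in> relator_closure L \<or>
    v \<otimes>\<^bsub>gen_group\<^esub> center_elem gen_group letter j \<in> relator_closure L"
proof -
  interpret K: normal "relator_closure L" gen_group by (rule relator_closure_normal)
  let ?H = "gen_group Mod relator_closure L"
  define h where "h w = relator_closure L #>\<^bsub>gen_group\<^esub> w" for w
  interpret h: group_hom gen_group ?H h
    unfolding h_def by (rule K.group_hom_Mod)
  have one: "h w = \<one>\<^bsub>?H\<^esub> \<longleftrightarrow> w \<in> relator_closure L" if "w \<in> carrier gen_group" for w
    unfolding h_def by (rule K.r_coset_eq_one_iff[OF that])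
  interpret H: abels ?H "\<lambda>a. h (letter a)"
  proof (rule abels_quotient)
    show "h \<in> hom gen_group ?H" by (rule h.homh)
    show "group ?H" by (rule K.factorgroup_is_group)
    show "h ` carrier gen_group = carrier ?H"
      by (auto simp: h_def carrier_FactGroup)
    show "h w = \<one>\<^bsub>?H\<^esub>" if "w \<in> relators gen_group letter" for w
      using that one relators_in_closure relator_closure_subset by blast
  qed
  let ?w = "center_elem gen_group letter j"
  have wc: "?w \<in> carrier gen_group" by (rule FT.center_elem_closed) simp
  have "center_elem ?H (\<lambda>a. h (letter a)) j = h ?w" by (simp add: h.hom_center_elem)
  then have c: "h ?w \<in> H.E14" using H.center_elem_E14[of j] by simp
  have cc: "h ?w \<otimes>\<^bsub>?H\<^esub> h ?w = \<one>\<^bsub>?H\<^esub>" by (rule H.E14_involution[OF c])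
  have "{\<one>\<^bsub>?H\<^esub>, h ?w} \<lhd> ?H"
  proof (rule h.H.normal_central_involution)
    show "h ?w \<in> carrier ?H" using wc by (rule h.hom_closed)
    show "h ?w \<otimes>\<^bsub>?H\<^esub> u = u \<otimes>\<^bsub>?H\<^esub> h ?w" if "u \<in> carrier ?H" for u
      by (rule H.E14_central[OF c that])
  qed (rule cc)
  then have "h v \<in> {\<one>\<^bsub>?H\<^esub>, h ?w}"
  proof (rule hom_relator_closure[OF h.group_hom_axioms _ _ _ v])
    show "relators ?H (\<lambda>a. h (letter a)) \<subseteq> {\<one>\<^bsub>?H\<^esub>, h ?w}" using H.relators_one by auto
    fix i assume i: "i \<in> insert j L"
    show "center_elem ?H (\<lambda>a. h (letter a)) i \<in> {\<one>\<^bsub>?H\<^esub>, h ?w}"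
    proof (cases "i = j")
      case False
      then have "h (center_elem gen_group letter i) = \<one>\<^bsub>?H\<^esub>"
        using i one center_elem_in_closure relator_closure_subset by blast
      then show ?thesis by (simp add: h.hom_center_elem)
    qed (simp add: h.hom_center_elem)
  qed
  moreover have vc: "v \<in> carrier gen_group" using v relator_closure_subset by blast
  moreover have "h (v \<otimes>\<^bsub>gen_group\<^esub> ?w) = h v \<otimes>\<^bsub>?H\<^esub> h ?w" using vc wc by simp
  ultimately show ?thesis
    using one[of v] one[of "v \<otimes>\<^bsub>gen_group\<^esub> ?w"] cc wc FT.m_closed by auto
qed

text \<open>The closures of the finite subsets of \<open>L\<close> form a directed family, so their
  union is a normal subgroup. This makes it possible to choose an index set of least size.\<close>

lemma relator_closure_finite:
  assumes "v \<in> relator_closure L"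
  shows "\<exists>F. finite F \<and> F \<subseteq> L \<and> v \<in> relator_closure F"
proof -
  let ?P = "{v. \<exists>F. finite F \<and> F \<subseteq> L \<and> v \<in> relator_closure F}"
  have sg: "subgroup (relator_closure F) gen_group" for F
    using relator_closure_normal by (rule normal_imp_subgroup)
  have "?P \<lhd> gen_group"
  proof (rule FT.normalI_conjugate)
    show "subgroup ?P gen_group"
    proof
      show "?P \<subseteq> carrier gen_group" using relator_closure_subset by blast
      show "\<one>\<^bsub>gen_group\<^esub> \<in> ?P" using subgroup.one_closed[OF sg, of "{}"] by blast
      show "inv\<^bsub>gen_group\<^esub> u \<in> ?P" if "u \<in> ?P" for u
        using that subgroup.m_inv_closed[OF sg] by blast
      fix u v assume "u \<in> ?P" "v \<in> ?P"
      then obtain F F' where F: "finite F" "F \<subseteq> L" "u \<in> relator_closure F"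
        "finite F'" "F' \<subseteq> L" "v \<in> relator_closure F'" by blast
      then have "u \<in> relator_closure (F \<union> F')" "v \<in> relator_closure (F \<union> F')"
        using relator_closure_mono[of F "F \<union> F'"] relator_closure_mono[of F' "F \<union> F'"] by auto
      then have "u \<otimes>\<^bsub>gen_group\<^esub> v \<in> relator_closure (F \<union> F')"
        by (rule subgroup.m_closed[OF sg])
      moreover have "finite (F \<union> F')" "F \<union> F' \<subseteq> L" using F by auto
      ultimately show "u \<otimes>\<^bsub>gen_group\<^esub> v \<in> ?P" by blast
    qed
    show "conjugate gen_group u a \<in> ?P" if "u \<in> carrier gen_group" "a \<in> ?P" for u a
      using that FT.normal_conjugate[OF relator_closure_normal] by blast
  qed
  moreover have "relators gen_group letter \<union> center_elem gen_group letter ` L \<subseteq> ?P"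
  proof -
    have "relators gen_group letter \<subseteq> ?P" using relators_in_closure[of "{}"] by blast
    moreover have "center_elem gen_group letter j \<in> ?P" if "j \<in> L" for j
      using that center_elem_in_closure[of j "{j}"] by (auto intro!: exI[of _ "{j}"])
    ultimately show ?thesis by blast
  qed
  ultimately have "relator_closure L \<subseteq> ?P"
    unfolding relator_closure_def by (rule FT.normal_closure_minimal)
  then show ?thesis using assms by blast
qed

text \<open>A Laurent series has only finitely many terms with negative exponent, so this is the
  span of the powers of 1/t with exponents in \<open>L\<close>. Described by supports, it is visibly
  closed under addition.\<close>

definition support_in :: "nat set \<Rightarrow> bit fls set" where
  "support_in L = {c. \<forall>k. fls_nth c k \<noteq> 0 \<longrightarrow> (\<exists>j\<in>L. k = - int j)}"

lemma inverse_X_power_nth: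
  "fls_nth ((1 / fls_X) ^ j :: bit fls) k = (if k = - int j then 1 else 0)"
proof -
  have "(1 / fls_X :: bit fls) = fls_X_inv"
    by (simp add: fls_inverse_X field_simps flip: fls_inverse_X)
  then show ?thesis by (auto simp: fls_X_inv_power_conv_shift_1)
qed

lemma fls_X_units:
  "(fls_X :: bit fls) \<noteq> 0" "1 + (fls_X :: bit fls) \<noteq> 0" "(1 :: bit fls) + 1 = 0"
proof -
  show "1 + (fls_X :: bit fls) \<noteq> 0"
  proof
    assume "1 + (fls_X :: bit fls) = 0"
    then have "fls_nth (1 + (fls_X :: bit fls)) 0 = 0" by simp
    then show False by simp
  qed
  show "(1 :: bit fls) + 1 = 0" by (rule fls_eqI) (simp only: fls_plus_nth, simp)
qed simp

text \<open>\<open>\<rho>\<close> lives on the free group and kills the relators of H, but not the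
  added relators w_j: their corner entries are what shows which w_j a relation uses.\<close>

locale matrix_rep =
  fixes \<rho> :: "(gen \<times> bool) list \<Rightarrow> bit fls ut"
  assumes hom_\<rho>: "group_hom gen_group ut_group \<rho>"
    and \<rho>_letter: "\<rho> (letter a) = gen_matrix fls_X a"
begin

sublocale \<rho>: group_hom gen_group ut_group \<rho> by (rule hom_\<rho>)

lemma \<rho>_center_elem: "\<rho> (center_elem gen_group letter j) = ut_center ((1 / fls_X) ^ j)"
proof -
  have "\<rho> (center_elem gen_group letter j) = center_elem ut_group (gen_matrix fls_X) j"
    by (subst \<rho>.hom_center_elem, simp, simp only: \<rho>_letter)
  also have "\<dots> = ut_center ((1 / fls_X) ^ j)"
    unfolding center_elem_def by (rule gen_matrix_center[OF fls_X_units])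
  finally show ?thesis .
qed

lemma \<rho>_relator_closure:
  assumes "v \<in> relator_closure L"
  shows "\<rho> v \<in> ut_center ` support_in L"
proof (rule hom_relator_closure[OF hom_\<rho> _ _ _ assms])
  have 0: "0 \<in> support_in L" by (simp add: support_in_def)
  show "ut_center ` support_in L \<lhd> ut_group"
    by (rule ut_center_normal) (force simp: support_in_def)+
  show "relators ut_group (\<lambda>a. \<rho> (letter a)) \<subseteq> ut_center ` support_in L"
    using relators_gen_matrix[OF fls_X_units] 0 by (auto simp: \<rho>_letter)
  show "center_elem ut_group (\<lambda>a. \<rho> (letter a)) j \<in> ut_center ` support_in L" if "j \<in> L" for j
  proof -
    have "(1 / fls_X) ^ j \<in> support_in L"
      unfolding support_in_def mem_Collect_eq inverse_X_power_nth using that by auto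
    moreover have "center_elem ut_group (\<lambda>a. \<rho> (letter a)) j = ut_center ((1 / fls_X) ^ j)"
      by (subst \<rho>.hom_center_elem[symmetric], simp, rule \<rho>_center_elem)
    ultimately show ?thesis by (simp only: imageI)
  qed
qed

text \<open>Choose a smallest finite index set \<open>F\<close> for \<open>v\<close>. If it
  contained some \<open>j > m\<close>, minimality and index at most two would put \<open>v\<close>
  times w_j into the closure for \<open>F - {j}\<close>, whose corner entries have no term at
  exponent \<open>- j\<close>. But w_j contributes this term, and \<open>v\<close>, of degree at
  most \<open>m\<close>, cannot cancel it.\<close>

lemma relator_closure_truncate:
  assumes v: "v \<in> relator_closure L" and deg: "ut_deg_le m (\<rho> v)"
  shows "v \<in> relator_closure (L \<inter> {..m})"
proof -
  let ?P = "\<lambda>F. finite F \<and> F \<subseteq> L \<and> v \<in> relator_closure F"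
  obtain F0 where "?P F0" using relator_closure_finite[OF v] by blast
  then obtain F where F: "?P F" and min: "\<And>F'. ?P F' \<Longrightarrow> card F \<le> card F'"
    using ex_has_least_nat[of ?P F0 card] by blast
  have "F \<subseteq> {..m}"
  proof (rule subsetI, rule ccontr)
    fix j assume j: "j \<in> F" "j \<notin> {..m}"
    let ?F = "F - {j}" and ?w = "center_elem gen_group letter j"
    have "card ?F < card F" using F j by (intro card_Diff1_less) auto
    then have "v \<notin> relator_closure ?F" using min[of ?F] F by auto
    moreover have "v \<in> relator_closure (insert j ?F)" using F j by (simp add: insert_absorb)
    ultimately have "v \<otimes>\<^bsub>gen_group\<^esub> ?w \<in> relator_closure ?F"
      using relator_closure_insert by blast
    then have "\<rho> (v \<otimes>\<^bsub>gen_group\<^esub> ?w) \<in> ut_center ` support_in ?F" by (rule \<rho>_relator_closure)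
    moreover obtain c where c: "\<rho> v = ut_center c" using \<rho>_relator_closure[OF v] by blast
    have vc: "v \<in> carrier gen_group" using v relator_closure_subset by blast
    have wc: "?w \<in> carrier gen_group" by (rule FT.center_elem_closed) simp
    have "\<rho> (v \<otimes>\<^bsub>gen_group\<^esub> ?w) = ut_center ((1 / fls_X) ^ j + c)"
      using \<rho>.hom_mult[OF vc wc] c by (simp add: \<rho>_center_elem)
    ultimately have "(1 / fls_X) ^ j + c \<in> support_in ?F" by auto
    moreover have "fls_nth c (- int j) = 0" using deg c j by (simp add: deg_le_def)
    then have "fls_nth ((1 / fls_X) ^ j + c) (- int j) \<noteq> 0"
      by (simp only: fls_plus_nth inverse_X_power_nth) simp
    ultimately show False unfolding support_in_def by force
  qed
  then show ?thesis using F relator_closure_mono[of F "L \<inter> {..m}"] by blast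
qed

end

lemma matrix_rep_exists: "\<exists>\<rho>. matrix_rep \<rho>"
proof -
  interpret U: group "ut_group :: bit fls ut monoid" by (rule group_ut_group)
  obtain h where "h \<in> hom gen_group (ut_group :: bit fls ut monoid)"
    "\<And>a. h [(a, True)] = gen_matrix fls_X a"
    using U.free_group_extension[of UNIV "gen_matrix fls_X"] gen_matrix_closed[OF fls_X_units]
    by auto
  then have "matrix_rep h" by unfold_locales auto
  then show ?thesis by blast
qed

text \<open>Degrees add under multiplication, so the largest degree among the images of the finitely
  many letters bounds the growth per letter.\<close>

lemma ut_deg_le_hom:
  fixes h :: "('a \<times> bool) list \<Rightarrow> 'k::field fls ut"
  assumes S: "finite S" and hom: "h \<in> hom (free_group S) ut_group"
  obtains D where "\<And>u. u \<in> carrier (free_group S) \<Longrightarrow> ut_deg_le (D * length u) (h u)"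
proof -
  interpret F: group "free_group S" by (rule group_free_group)
  interpret U: group "ut_group :: 'k fls ut monoid" by (rule group_ut_group)
  interpret h: group_hom "free_group S" ut_group h using hom by unfold_locales
  obtain d where d: "ut_deg_le (d M) M" for M :: "'k fls ut" using ut_deg_le_exists by metis
  \<comment> \<open>The inserted 0 keeps the maximum meaningful when \<open>S\<close> is
    empty.\<close>
  define D where "D = Max (insert 0 ((\<lambda>l. d (h [l])) ` (S \<times> UNIV)))"
  have D: "ut_deg_le D (h [l])" if "fst l \<in> S" for l
  proof (rule ut_deg_le_mono[OF d])
    have "d (h [l]) \<in> (\<lambda>l. d (h [l])) ` (S \<times> UNIV)"
      using that by (intro imageI) (simp add: mem_Times_iff)
    then show "d (h [l]) \<le> D" using S by (simp add: D_def)
  qed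
  have "ut_deg_le (D * length u) (h u)" if "u \<in> carrier (free_group S)" for u
    using that
  proof (induction u)
    case Nil
    have "h [] = UT 1 1 0 0 0 0 0 0" using h.hom_one by simp
    then show ?case by (simp add: deg_le_def)
  next
    case (Cons l u)
    note l = Cons_free_group[OF Cons.prems]
    have "fst l \<in> S" using Cons.prems by (simp add: carrier_free_group)
    moreover have "h (l # u) = ut_mult (h [l]) (h u)"
      using h.hom_mult[OF l(1,2)] l(3) by simp
    ultimately show ?case using ut_deg_le_mult[OF D Cons.IH[OF l(2)]] by simp
  qed
  then show thesis by (rule that)
qed

section \<open>The relation range\<close>

lemma (in group) surj_word_value:
  assumes "S \<subseteq> carrier G" "generate G S = carrier G"
  shows "word_value G ` carrier (free_group S) = carrier G"
proof -
  interpret F: group "free_group S" by (rule group_free_group)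
  interpret \<pi>: group_hom "free_group S" G "word_value G"
    using word_value_hom[OF assms(1)] by unfold_locales
  have "word_value G [(a, True)] = a" if "a \<in> S" for a
    using that assms by (auto simp: word_value_def letter_value_def)
  then have "word_value G ` ((\<lambda>a. [(a, True)]) ` S) = S" by (force simp: image_image)
  moreover have "generate G (word_value G ` ((\<lambda>a. [(a, True)]) ` S)) =
      word_value G ` generate (free_group S) ((\<lambda>a. [(a, True)]) ` S)"
    by (rule \<pi>.generate_img) auto
  ultimately show ?thesis using assms by (simp add: generate_free_group)
qed

lemma (in normal) r_coset_eq_iff:
  assumes "a \<in> carrier G" "b \<in> carrier G"
  shows "H #> a = H #> b \<longleftrightarrow> a \<otimes> inv b \<in> H"
  using assms rcos_module[OF is_group] rcos_self repr_independence subgroup_axioms by metis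

text \<open>Only the power of \<open>f Gp\<close> grows with \<open>j\<close>, and it occurs a fixed
  number of times; the factor \<open>j + 1\<close> in place of \<open>j\<close> covers
  \<open>j = 0\<close>.\<close>

lemma center_elem_length:
  assumes "\<And>a. f a \<in> carrier (free_group S)"
  obtains C where "C \<ge> 1" "\<And>j. length (center_elem (free_group S) f j) \<le> C * (j + 1)"
proof -
  interpret F: group "free_group S" by (rule group_free_group)
  define C where
    "C = 1 + 2 * length (f Gx) + 4 * length (f Gp) + 4 * length (f Gy) + 4 * length (f Gz)"
  have "length (center_elem (free_group S) f j) \<le> C * (j + 1)" for j
  proof -
    let ?u = "f Gp [^]\<^bsub>free_group S\<^esub> j" and ?g = "commutator (free_group S) (f Gy) (f Gz)"
    have "length (center_elem (free_group S) f j) \<le>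
        2 * length (f Gx) + 2 * (2 * (j * length (f Gp)) + (2 * length (f Gy) + 2 * length (f Gz)))"
      using length_commutator_free_group[of "f Gx" S "conjugate (free_group S) ?u ?g"]
        length_conjugate_free_group[of ?u S ?g] length_pow_free_group[of S "f Gp" j]
        length_commutator_free_group[of "f Gy" S "f Gz"] assms
      unfolding center_elem_def by (simp add: F.nat_pow_closed)
    also have "\<dots> \<le> C * (j + 1)" by (simp add: C_def algebra_simps)
    finally show ?thesis .
  qed
  moreover have "C \<ge> 1" by (simp add: C_def)
  ultimately show thesis using that by blast
qed

lemma bounded_relators_mono: "m \<le> n \<Longrightarrow> bounded_relators G S m \<subseteq> bounded_relators G S n"
  unfolding bounded_relators_def
  by (intro group.normal_closure_mono[OF group_free_group]) auto

text \<open>\<open>C\<close> comes from the length of w_j as a word over \<open>S\<close>, and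
  \<open>D\<close> from the growth of matrix entries, by which a relation of length \<open>n\<close>
  involves only w_j with \<open>j \<le> D * n\<close>. Lengths up to \<open>n0\<close> are set aside
  for the relators of H and for the change of generators.\<close>

lemma relation_range_bounds:
  assumes G: "group G" and \<phi>: "\<phi> \<in> hom gen_group G" and surj: "\<phi> ` carrier gen_group = carrier G"
    and ker: "kernel gen_group G \<phi> = relator_closure I" and gen: "finite_generating_set G S"
  obtains D C n0 :: nat where "C \<ge> 1"
    "\<And>n. n \<in> relation_range G S \<Longrightarrow> n > n0 \<Longrightarrow> \<exists>j\<in>I. j \<le> D * n \<and> n \<le> C * (j + 1)"
    "\<And>j. j \<in> I \<Longrightarrow> j \<ge> 1 \<Longrightarrow> \<exists>n\<in>relation_range G S. j \<le> D * n \<and> n \<le> C * (j + 1)"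
proof -
  have S: "finite S" "S \<subseteq> carrier G" "generate G S = carrier G"
    using gen by (simp_all add: finite_generating_set_def)
  interpret G: group G by fact
  let ?F = "free_group S" and ?\<pi> = "word_value G"
  interpret F: group ?F by (rule group_free_group)
  interpret \<pi>: group_hom ?F G ?\<pi> using G.word_value_hom[OF S(2)] by unfold_locales
  interpret \<phi>: group_hom gen_group G \<phi> using \<phi> by unfold_locales
  have \<phi>_ker: "\<phi> w = \<one>\<^bsub>G\<^esub> \<longleftrightarrow> w \<in> relator_closure I" if "w \<in> carrier gen_group" for w
    using that ker by (auto simp: kernel_def)
  have "\<exists>u\<in>carrier ?F. ?\<pi> u = \<phi> (letter a)" for a
    using G.surj_word_value[OF S(2,3)] \<phi>.hom_closed[of "letter a"] by (metis UNIV_I image_iff singleton_free_group)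
  then obtain f where f: "f a \<in> carrier ?F" "?\<pi> (f a) = \<phi> (letter a)" for a by metis
  \<comment> \<open>\<open>\<theta>\<close> rewrites words in the seven generators over
    \<open>S\<close>, and \<open>\<sigma>\<close> below goes back. Both respect the maps to
    \<open>G\<close>, but they are inverse to each other only modulo relations; this is the source
    of the second part of \<open>E\<close> and of the central factors in the lower bound.\<close>
  obtain \<theta> where \<theta>: "\<theta> \<in> hom gen_group ?F" and \<theta>_letter: "\<And>a. \<theta> (letter a) = f a"
    using F.free_group_extension[of UNIV f] f(1) by auto
  interpret \<theta>: group_hom gen_group ?F \<theta> using \<theta> by unfold_locales
  have "\<exists>u\<in>carrier gen_group. \<phi> u = s" if "s \<in> S" for s
    using that S surj by (metis image_iff subsetD)
  then obtain k where k: "k s \<in> carrier gen_group" "\<phi> (k s) = s" if "s \<in> S" for s by metis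
  obtain \<sigma> where \<sigma>: "\<sigma> \<in> hom ?F gen_group" and \<sigma>_letter: "\<And>s. s \<in> S \<Longrightarrow> \<sigma> [(s, True)] = k s"
    using FT.free_group_extension[of S k] k(1) by auto
  interpret \<sigma>: group_hom ?F gen_group \<sigma> using \<sigma> by unfold_locales
  have \<pi>\<theta>: "?\<pi> (\<theta> w) = \<phi> w" if "w \<in> carrier gen_group" for w
    using free_group_hom_eq[OF G, of "?\<pi> \<circ> \<theta>" UNIV \<phi> w] that hom_compose[OF \<theta> \<pi>.homh] \<phi> f \<theta>_letter
    by simp
  have \<pi>_letter: "?\<pi> [(s, True)] = s" if "s \<in> S" for s
    using that S by (auto simp: word_value_def letter_value_def)
  have \<phi>\<sigma>: "\<phi> (\<sigma> u) = ?\<pi> u" if "u \<in> carrier ?F" for u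
    using free_group_hom_eq[OF G, of "\<phi> \<circ> \<sigma>" S ?\<pi> u] that hom_compose[OF \<sigma> \<phi>] \<pi>.homh k \<sigma>_letter \<pi>_letter
    by simp
  obtain \<rho> where "matrix_rep \<rho>" using matrix_rep_exists by blast
  then interpret matrix_rep \<rho> .
  obtain D0 where D0: "\<And>u. u \<in> carrier ?F \<Longrightarrow> ut_deg_le (D0 * length u) ((\<rho> \<circ> \<sigma>) u)"
    using ut_deg_le_hom[OF S(1) hom_compose[OF \<sigma> \<rho>.homh]] by blast
  define D where "D = Suc D0"
  have D: "ut_deg_le (D * m) (\<rho> (\<sigma> u))" if "u \<in> carrier ?F" "length u \<le> m" for u m
  proof (rule ut_deg_le_mono)
    show "ut_deg_le (D0 * length u) (\<rho> (\<sigma> u))" using D0[OF that(1)] by simp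
    show "D0 * length u \<le> D * m" unfolding D_def using that(2) by (intro mult_le_mono) auto
  qed
  obtain C where C: "C \<ge> 1" "\<And>j. length (center_elem ?F f j) \<le> C * (j + 1)"
    using center_elem_length[of f S] f(1) by blast
  let ?ker = "kernel ?F G ?\<pi>"
  define K where "K n = bounded_relators G S n" for n
  have K_gens: "{w \<in> ?ker. int (length w) \<le> n} \<subseteq> carrier ?F" for n by (auto simp: kernel_def)
  have K_normal: "K n \<lhd> ?F" for n
    unfolding K_def bounded_relators_def by (rule F.normal_normal_closure[OF K_gens])
  have K_incl: "w \<in> K n" if "w \<in> ?ker" "int (length w) \<le> n" for w n
    using F.normal_closure_incl[of "{w \<in> ?ker. int (length w) \<le> n}"] that
    by (auto simp: K_def bounded_relators_def)
  have K_min: "K n \<subseteq> M" if "M \<lhd> ?F" "\<And>w. w \<in> ?ker \<Longrightarrow> int (length w) \<le> n \<Longrightarrow> w \<in> M" for M n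
    unfolding K_def bounded_relators_def using that by (intro F.normal_closure_minimal) auto
  have K_mono: "K m \<subseteq> K n" if "m \<le> n" for m n
    unfolding K_def using that by (rule bounded_relators_mono)
  have range_iff: "n \<in> relation_range G S \<longleftrightarrow> \<not> K (int n) \<subseteq> K (int n - 1)" for n
    using K_mono[of "int n - 1" "int n"] by (auto simp: relation_range_def K_def)
  define w where "w j = center_elem gen_group letter j" for j
  have wc: "w j \<in> carrier gen_group" for j
    unfolding w_def by (rule FT.center_elem_closed) simp
  have \<theta>w: "\<theta> (w j) = center_elem ?F f j" for j
    unfolding w_def by (subst \<theta>.hom_center_elem) (simp_all add: \<theta>_letter)
  have \<theta>w_ker: "\<theta> (w j) \<in> ?ker" if "j \<in> I" for j
    using \<pi>\<theta>[OF wc] \<phi>_ker[OF wc] center_elem_in_closure[OF that] wc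
    by (simp add: kernel_def w_def)
  have \<theta>w_K: "\<theta> (w j) \<in> K n" if "j \<in> I" "int (C * (j + 1)) \<le> n" for j n
  proof (rule K_incl[OF \<theta>w_ker[OF that(1)]])
    have "int (length (\<theta> (w j))) \<le> int (C * (j + 1))"
      unfolding \<theta>w using C(2)[of j] by (simp only: of_nat_le_iff)
    then show "int (length (\<theta> (w j))) \<le> n" using that(2) by (rule order_trans)
  qed
  \<comment> \<open>Finitely many relations over \<open>S\<close>; modulo these,
    \<open>\<theta>\<close> kills the relators of H and \<open>\<theta> \<circ> \<sigma>\<close> is
    the identity. They are all available from length \<open>n0\<close> on.\<close>
  define E where "E = \<theta> ` relators gen_group letter \<union>
    (\<lambda>s. [(s, True)] \<otimes>\<^bsub>?F\<^esub> inv\<^bsub>?F\<^esub> \<theta> (\<sigma> [(s, True)])) ` S"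
  define n0 where "n0 = Max (insert 0 (length ` E))"
  have finE: "finite E"
    unfolding E_def using S(1) by (intro finite_UnI finite_imageI finite_relators)
  have E_ker: "E \<subseteq> ?ker"
  proof -
    have "\<theta> v \<in> ?ker" if "v \<in> relators gen_group letter" for v
    proof -
      have vI: "v \<in> relator_closure I" using that relators_in_closure by blast
      then have "v \<in> carrier gen_group" using relator_closure_subset by blast
      then show ?thesis using vI \<phi>_ker \<pi>\<theta> by (simp add: kernel_def)
    qed
    moreover have "[(s, True)] \<otimes>\<^bsub>?F\<^esub> inv\<^bsub>?F\<^esub> \<theta> (\<sigma> [(s, True)]) \<in> ?ker" if s: "s \<in> S" for s
    proof -
      have "?\<pi> (\<theta> (\<sigma> [(s, True)])) = s"
        using s \<pi>\<theta>[of "\<sigma> [(s, True)]"] \<phi>\<sigma>[of "[(s, True)]"] \<pi>_letter[OF s] by simp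
      then show ?thesis
        using s S(2) \<pi>_letter[OF s] by (auto simp: kernel_def)
    qed
    ultimately show ?thesis by (auto simp: E_def)
  qed
  have E_K: "v \<in> K n" if "v \<in> E" "int n0 \<le> n" for v n
  proof (rule K_incl)
    show "v \<in> ?ker" using that E_ker by blast
    have "length v \<le> n0" using that finE by (auto simp: n0_def intro!: Max_ge)
    then show "int (length v) \<le> n" using that by simp
  qed
  have \<theta>_K: "\<theta> v \<in> K n"
    if v: "v \<in> relator_closure L" and n: "int n0 \<le> n" and L: "\<And>j. j \<in> L \<Longrightarrow> \<theta> (w j) \<in> K n" for v n L
  proof (rule hom_relator_closure[OF \<theta>.group_hom_axioms K_normal _ _ v])
    show "relators ?F (\<lambda>a. \<theta> (letter a)) \<subseteq> K n"
      using E_K[OF _ n] \<theta>.image_relators[of letter] by (auto simp: E_def)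
    show "center_elem ?F (\<lambda>a. \<theta> (letter a)) j \<in> K n" if "j \<in> L" for j
      using L[OF that] by (simp add: \<theta>w \<theta>_letter)
  qed
  \<comment> \<open>Modulo \<open>K n\<close> the map \<open>\<theta> \<circ> \<sigma>\<close>
    agrees with the identity on letters, hence on all words.\<close>
  have \<theta>\<sigma>_K: "u \<in> K n" if u: "u \<in> carrier ?F" and \<theta>\<sigma>: "\<theta> (\<sigma> u) \<in> K n" and n: "int n0 \<le> n" for u n
  proof -
    interpret K: normal "K n" ?F by (rule K_normal)
    interpret \<kappa>: group_hom ?F "?F Mod K n" "\<lambda>u. K n #>\<^bsub>?F\<^esub> u" by (rule K.group_hom_Mod)
    have "K n #>\<^bsub>?F\<^esub> u = K n #>\<^bsub>?F\<^esub> \<theta> (\<sigma> u)"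
    proof (rule free_group_hom_eq[OF K.factorgroup_is_group \<kappa>.homh _ _ u])
      show "(\<lambda>u. K n #>\<^bsub>?F\<^esub> \<theta> (\<sigma> u)) \<in> hom ?F (?F Mod K n)"
        using hom_compose[OF hom_compose[OF \<sigma> \<theta>] \<kappa>.homh] by (simp add: comp_def)
      fix s assume s: "s \<in> S"
      then have "[(s, True)] \<otimes>\<^bsub>?F\<^esub> inv\<^bsub>?F\<^esub> \<theta> (\<sigma> [(s, True)]) \<in> K n"
        by (intro E_K[OF _ n]) (simp add: E_def)
      then show "K n #>\<^bsub>?F\<^esub> [(s, True)] = K n #>\<^bsub>?F\<^esub> \<theta> (\<sigma> [(s, True)])"
        using s by (subst K.r_coset_eq_iff) simp_all
    qed
    then show ?thesis
      using \<theta>\<sigma> u K.r_coset_eq_one_iff by (metis \<sigma>.hom_closed \<theta>.hom_closed)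
  qed
  have \<sigma>_ker: "\<sigma> u \<in> relator_closure I" if "u \<in> ?ker" for u
    using that \<phi>\<sigma>[of u] \<phi>_ker[of "\<sigma> u"] by (simp add: kernel_def)
  \<comment> \<open>A relation of length at most \<open>n\<close> involves only w_j with
    \<open>j \<le> D * n\<close>. If \<open>C * (j + 1) < n\<close> for all of these in
    \<open>I\<close>, they already lie in \<open>K (int n - 1)\<close>, so nothing new appears at
    \<open>n\<close>. Strictness in \<open>n > n0\<close> makes \<open>E\<close> available at length
    \<open>n - 1\<close> too.\<close>
  have upper: "\<exists>j\<in>I. j \<le> D * n \<and> n \<le> C * (j + 1)" if n: "n \<in> relation_range G S" "n > n0" for n
  proof (rule ccontr)
    assume no: "\<not> ?thesis"
    have "K (int n) \<subseteq> K (int n - 1)"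
    proof (rule K_min[OF K_normal])
      fix u assume u: "u \<in> ?ker" "int (length u) \<le> int n"
      have uc: "u \<in> carrier ?F" using u by (simp add: kernel_def)
      have "\<sigma> u \<in> relator_closure (I \<inter> {..D * n})"
        using relator_closure_truncate[OF \<sigma>_ker[OF u(1)]] D[OF uc, of n] u(2) by simp
      then have "\<theta> (\<sigma> u) \<in> K (int n - 1)"
      proof (rule \<theta>_K)
        show "int n0 \<le> int n - 1" using n by simp
        fix j assume "j \<in> I \<inter> {..D * n}"
        then have jI: "j \<in> I" and lt: "C * (j + 1) < n" using no by auto
        from lt have "int (C * (j + 1)) < int n" by (simp only: of_nat_less_iff)
        then show "\<theta> (w j) \<in> K (int n - 1)"
          by (intro \<theta>w_K[OF jI]) (simp only: zle_diff1_eq)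
      qed
      then show "u \<in> K (int n - 1)" by (rule \<theta>\<sigma>_K[OF uc]) (use n in simp)
    qed
    then show False using n range_iff by blast
  qed
  \<comment> \<open>Rewriting over \<open>S\<close> and back changes each generator by an element of
    \<open>relator_closure I\<close>, whose matrix is central, and w_j is insensitive to central
    factors.\<close>
  have \<rho>\<sigma>\<theta>w: "\<rho> (\<sigma> (\<theta> (w j))) = ut_center ((1 / fls_X) ^ j)" for j
  proof -
    have "\<exists>c. \<rho> (\<sigma> (f a)) = gen_matrix fls_X a \<otimes>\<^bsub>ut_group\<^esub> ut_center c" for a
    proof -
      let ?d = "inv\<^bsub>gen_group\<^esub> letter a \<otimes>\<^bsub>gen_group\<^esub> \<sigma> (f a)"
      have "\<phi> (\<sigma> (f a)) = \<phi> (letter a)" using \<phi>\<sigma> f by simp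
      then have "\<phi> ?d = \<one>\<^bsub>G\<^esub>" using f(1)[of a] by simp
      then have "?d \<in> relator_closure I" using f(1)[of a] \<phi>_ker[of ?d] by simp
      then obtain c where "\<rho> ?d = ut_center c" using \<rho>_relator_closure by blast
      moreover have "\<sigma> (f a) = letter a \<otimes>\<^bsub>gen_group\<^esub> ?d" using f(1)[of a] by simp
      then have "\<rho> (\<sigma> (f a)) = \<rho> (letter a \<otimes>\<^bsub>gen_group\<^esub> ?d)" by simp
      then have "\<rho> (\<sigma> (f a)) = \<rho> (letter a) \<otimes>\<^bsub>ut_group\<^esub> \<rho> ?d"
        using f(1)[of a] by (subst (asm) \<rho>.hom_mult) simp_all
      ultimately show ?thesis using \<rho>_letter by metis
    qed
    then obtain c where c: "\<And>a. \<rho> (\<sigma> (f a)) = gen_matrix fls_X a \<otimes>\<^bsub>ut_group\<^esub> ut_center (c a)"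
      by metis
    have "\<rho> (\<sigma> (\<theta> (w j))) = center_elem ut_group (\<lambda>a. \<rho> (\<sigma> (f a))) j"
      unfolding \<theta>w using f(1) by (simp add: \<sigma>.hom_center_elem \<rho>.hom_center_elem)
    also have "\<dots> = center_elem ut_group (\<lambda>a. gen_matrix fls_X a \<otimes>\<^bsub>ut_group\<^esub> ut_center (c a)) j"
      unfolding c ..
    also have "\<dots> = center_elem ut_group (gen_matrix fls_X) j"
    proof (rule group.center_elem_central_factors[OF group_ut_group])
      show "gen_matrix (fls_X :: bit fls) a \<in> carrier ut_group" for a by (rule gen_matrix_closed[OF fls_X_units])
      show "ut_center (c a) \<otimes>\<^bsub>ut_group\<^esub> M = M \<otimes>\<^bsub>ut_group\<^esub> ut_center (c a)" for a M
        by (cases M) (simp add: algebra_simps)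
    qed simp
    also have "\<dots> = ut_center ((1 / fls_X) ^ j)"
      unfolding center_elem_def by (rule gen_matrix_center[OF fls_X_units])
    finally show ?thesis .
  qed
  \<comment> \<open>Relations of length at most \<open>n\<close> have central matrices with corner
    of degree at most \<open>D * n\<close>. These matrices form a normal subgroup, so passing to the
    normal closure stays inside it, while the corner t^(-j) of w_j lies outside.\<close>
  have lower: "\<theta> (w j) \<notin> K (int n)" if j: "j \<in> I" "D * n < j" for j n
  proof
    assume wK: "\<theta> (w j) \<in> K (int n)"
    let ?M = "ut_center ` {c :: bit fls. deg_le (D * n) c}"
    interpret \<rho>\<sigma>: group_hom ?F ut_group "\<rho> \<circ> \<sigma>"
      using hom_compose[OF \<sigma> \<rho>.homh] by unfold_locales
    have "?M \<lhd> ut_group"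
      by (rule ut_center_normal) (simp_all add: deg_le_def)
    then have "{u \<in> carrier ?F. (\<rho> \<circ> \<sigma>) u \<in> ?M} \<lhd> ?F" by (rule \<rho>\<sigma>.normal_vimage)
    then have "K (int n) \<subseteq> {u \<in> carrier ?F. (\<rho> \<circ> \<sigma>) u \<in> ?M}"
    proof (rule K_min)
      fix u assume u: "u \<in> ?ker" "int (length u) \<le> int n"
      then have uc: "u \<in> carrier ?F" by (simp add: kernel_def)
      obtain c where c: "\<rho> (\<sigma> u) = ut_center c" using \<rho>_relator_closure[OF \<sigma>_ker[OF u(1)]] by blast
      then have "deg_le (D * n) c" using D[OF uc, of n] u(2) by simp
      then show "u \<in> {u \<in> carrier ?F. (\<rho> \<circ> \<sigma>) u \<in> ?M}" using uc c by simp
    qed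
    then have "\<rho> (\<sigma> (\<theta> (w j))) \<in> ?M" using wK by auto
    then have "deg_le (D * n) ((1 / fls_X :: bit fls) ^ j)"
      unfolding \<rho>\<sigma>\<theta>w by auto
    then have "fls_nth ((1 / fls_X :: bit fls) ^ j) (- int j) = 0"
      using j by (simp only: deg_le_def)
    then show False by (simp only: inverse_X_power_nth) simp
  qed
  have lower': "\<exists>n\<in>relation_range G S. j \<le> D * n \<and> n \<le> C * (j + 1)" if j: "j \<in> I" "j \<ge> 1" for j
  proof -
    define m where "m = (LEAST n. \<theta> (w j) \<in> K (int n))"
    have top: "\<theta> (w j) \<in> K (int (C * (j + 1)))" by (rule \<theta>w_K[OF j(1)]) simp
    have m: "\<theta> (w j) \<in> K (int m)" unfolding m_def using top by (rule LeastI)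
    have "m \<le> C * (j + 1)" unfolding m_def using top by (rule Least_le)
    moreover have jm: "j \<le> D * m" using lower[OF j(1), of m] m by linarith
    moreover have "m \<in> relation_range G S"
    proof -
      \<comment> \<open>\<open>m = 0\<close> would force \<open>j = 0\<close>. For positive
        \<open>m\<close> the index \<open>int m - 1\<close> is a natural number, to which minimality
        of \<open>m\<close> applies.\<close>
      have "m \<noteq> 0" using jm j(2) by (cases m) auto
      then have eq: "int m - 1 = int (m - 1)" and lt: "m - 1 < m" by auto
      from lt have "m - 1 < (LEAST n. \<theta> (w j) \<in> K (int n))" by (simp only: m_def[symmetric])
      then have "\<theta> (w j) \<notin> K (int m - 1)" unfolding eq by (rule not_less_Least)
      then show ?thesis using m range_iff by blast
    qed
    ultimately show ?thesis by blast
  qed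
  show thesis using that[OF C(1) upper lower'] by blast
qed

section \<open>Coarse comparison and the final group\<close>

lemma coarse_eqI:
  fixes A B :: "nat set"
  assumes "C \<ge> 1"
    and *: "\<And>n. n \<in> A \<Longrightarrow> n > n0 \<Longrightarrow> \<exists>j\<in>B. j \<le> D * n \<and> n \<le> C * (j + 1)"
    and **: "\<And>j. j \<in> B \<Longrightarrow> j \<ge> 1 \<Longrightarrow> \<exists>n\<in>A. j \<le> D * n \<and> n \<le> C * (j + 1)"
  shows "real ` A \<sim>\<^sub>c real ` B"
proof -
  \<comment> \<open>\<open>2 * C\<close> serves since \<open>j + 1 \<le> 2 * j\<close> for positive
    \<open>j\<close>, \<open>D\<close> gives the opposite bound, and \<open>n0 + 1\<close> puts all
    numbers from \<open>c\<close> on beyond \<open>n0\<close>.\<close>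
  define c where "c = 2 * C + D + n0 + 1"
  have c: "real c \<ge> 1" by (simp add: c_def)
  have bound: "real n \<le> real c * real j" if "n \<le> C * (j + 1)" "j \<ge> 1" for n j
  proof -
    have "C * (j + 1) \<le> C * (2 * j)" using that(2) by (intro mult_le_mono2) simp
    with that(1) have "n \<le> C * (2 * j)" by (rule order_trans)
    also have "\<dots> \<le> c * j" by (simp add: c_def algebra_simps)
    finally show ?thesis by (metis of_nat_le_iff of_nat_mult)
  qed
  have bound': "real j \<le> real c * real n" if "j \<le> D * n" for n j
  proof -
    have "D * n \<le> c * n" by (simp add: c_def algebra_simps)
    with that have "j \<le> c * n" by (rule order_trans)
    then show ?thesis by (metis of_nat_le_iff of_nat_mult)
  qed
  have mem: "real b \<in> {inverse (real c) * real a .. real c * real a}"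
    if "real b \<le> real c * real a" "real a \<le> real c * real b" for a b :: nat
    using that c by (simp add: field_simps)
  have "real ` A \<preceq>\<^sub>c real ` B"
    unfolding coarse_le_def
  proof (intro exI[of _ "real c"] conjI c ballI impI)
    fix a assume "a \<in> real ` A" "a \<ge> real c"
    then obtain n where n: "n \<in> A" "a = real n" "n \<ge> c" by auto
    then obtain j where j: "j \<in> B" "j \<le> D * n" "n \<le> C * (j + 1)"
      using *[of n] by (auto simp: c_def)
    \<comment> \<open>\<open>j = 0\<close> would give \<open>n \<le> C\<close>, which is less than
      \<open>c\<close>.\<close>
    have "j \<ge> 1" using j(3) n(3) \<open>C \<ge> 1\<close> by (cases j) (auto simp: c_def)
    then show "\<exists>b\<in>real ` B. b \<in> {inverse (real c) * a .. real c * a}"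
      using j n bound bound' mem by blast
  qed
  moreover have "real ` B \<preceq>\<^sub>c real ` A"
    unfolding coarse_le_def
  proof (intro exI[of _ "real c"] conjI c ballI impI)
    fix b assume "b \<in> real ` B" "b \<ge> real c"
    then obtain j where j: "j \<in> B" "b = real j" "j \<ge> 1" using c by auto
    then obtain n where "n \<in> A" "j \<le> D * n" "n \<le> C * (j + 1)" using ** by blast
    then show "\<exists>a\<in>real ` A. a \<in> {inverse (real c) * b .. real c * b}"
      using j bound bound' mem by blast
  qed
  ultimately show ?thesis by (simp add: coarse_eq_def)
qed

text \<open>The elements of the quotient are cosets of \<open>K\<close>; being countably many, they
  can be replaced by natural numbers along an injection, which yields the type of group that the
  theorem asks for.\<close>

lemma countable_quotient_nat:
  assumes K: "K \<lhd> F" and F: "group F" and countable: "countable (carrier F)"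
  obtains G :: "nat monoid" and h where "group G" "h \<in> hom F G" "h ` carrier F = carrier G"
    "kernel F G h = K"
proof -
  interpret F: group F by fact
  interpret K: normal K F by fact
  define h where "h a = to_nat_on (carrier (F Mod K)) (K #>\<^bsub>F\<^esub> a)" for a
  have "countable (carrier (F Mod K))"
    using countable by (simp add: carrier_FactGroup)
  then have inj: "inj_on (to_nat_on (carrier (F Mod K))) (carrier (F Mod K))"
    by (rule inj_on_to_nat_on)
  have weak: "weak_group_morphism h K F"
  proof (rule weak_group_morphismsI[OF K])
    fix a b assume ab: "a \<in> carrier F" "b \<in> carrier F"
    then have "K #>\<^bsub>F\<^esub> a \<in> carrier (F Mod K)" "K #>\<^bsub>F\<^esub> b \<in> carrier (F Mod K)"
      by (auto simp: carrier_FactGroup)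
    then show "h a = h b \<longleftrightarrow> a \<otimes>\<^bsub>F\<^esub> inv\<^bsub>F\<^esub> b \<in> K"
      using inj ab by (simp add: h_def inj_on_eq_iff K.r_coset_eq_iff)
  qed
  show thesis
  proof (rule that)
    show "group (image_group h F)" by (rule F.image_group_is_group[OF weak])
    show "h \<in> hom F (image_group h F)" by (rule F.weak_group_morphism_is_hom[OF weak])
    show "h ` carrier F = carrier (image_group h F)" by (simp add: image_group_carrier)
    show "kernel F (image_group h F) h = K" by (rule F.weak_group_morphism_ker[OF weak])
  qed
qed

theorem proposition1p7:
  fixes I :: "nat set"
  shows "\<exists>(G :: nat monoid) N.
    finitely_generated_group G \<and>
    N \<lhd> G \<and>
    locally_finite_group (G\<lparr>carrier := N\<rparr>) \<and>
    nilpotent_class_at_most 3 (G\<lparr>carrier := N\<rparr>) \<and>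
    comm_group (G Mod N) \<and>
    (\<forall>S. finite_generating_set G S \<longrightarrow> real ` relation_range G S \<sim>\<^sub>c real ` I)"
proof -
  obtain G :: "nat monoid" and \<phi> where G: "group G" and \<phi>: "\<phi> \<in> hom gen_group G"
    and surj: "\<phi> ` carrier gen_group = carrier G" and ker: "kernel gen_group G \<phi> = relator_closure I"
    using countable_quotient_nat[OF relator_closure_normal group_free_group] by blast
  interpret A: abels G "\<lambda>a. \<phi> (letter a)"
    using \<phi> G surj
  proof (rule abels_quotient)
    fix w assume "w \<in> relators gen_group letter"
    then have "w \<in> kernel gen_group G \<phi>" using relators_in_closure ker by blast
    then show "\<phi> w = \<one>\<^bsub>G\<^esub>" by (simp add: kernel_def)
  qed
  have "finite_generating_set G (range (\<lambda>a. \<phi> (letter a)))"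
    using A.generate_f by (auto simp: finite_generating_set_def UNIV_gen)
  then have "finitely_generated_group G"
    using G by (auto simp: finitely_generated_group_def)
  \<comment> \<open>\<open>G\<close> is fixed before \<open>S\<close>; only the constants of the
    comparison depend on \<open>S\<close>.\<close>
  moreover have "real ` relation_range G S \<sim>\<^sub>c real ` I" if S: "finite_generating_set G S" for S
    using relation_range_bounds[OF G \<phi> surj ker S] coarse_eqI by metis
  ultimately show ?thesis
    using A.N_normal A.locally_finite_N A.nilpotent_N A.comm_group_Mod_N by blast
qed

end
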